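(* Let $n\ge 1$, let $\phi$ be a nonconstant rational inner function on $\mathbb{D}^n$, and let $\alpha\in\mathbb{C}$. Then: (i) If $\alpha\in\mathbb{D}\cup\mathbb{E}$, then $Z_{\phi-\alpha}$ is atoral. (ii) If $\alpha\in\mathbb{T}$, then $Z_{\phi-\alpha}$ is toral. (iii) If $\alpha\in\mathbb{D}$, then $Z_{\phi-\alpha}\cap\mathbb{E}^n=\emptyset$. (iv) If $\alpha\in\mathbb{E}$, then $Z_{\phi-\alpha}\cap\mathbb{D}^n=\emptyset$. (v) If $\alpha\in\mathbb{T}$, then $Z_{\phi-\alpha}\cap\mathbb{D}^n=Z_{\phi-\alpha}\cap\mathbb{E}^n=\emptyset$.
   Context: $\mathbb{D}=\{z\in\mathbb{C}:|z|<1\}$, $\mathbb{T}=\{z\in\mathbb{C}:|z|=1\}$, $\mathbb{E}=\{z\in\mathbb{C}:|z|>1\}$. An inner function on $\mathbb{D}^n$ is a bounded holomorphic function on $\mathbb{D}^n$ whose radial boundary values have modulus one almost everywhere on $\mathbb{T}^n$; it is rational if it is a quotient of polynomials, and it is then regarded as a rational function on $\mathbb{C}^n$. For a nonzero rational function $f=a/b$ with $a,b\in\mathbb{C}[z_1,\dots,z_n]$ coprime, $Z_f$ denotes the algebraic set $Z_a\subseteq\mathbb{C}^n$, the zero set of the numerator $a$. An algebraic set in $\mathbb{C}^n$ is a finite intersection of zero sets of polynomials. For an algebraic set $A$, $Hol(A)$ is the algebra of functions $f:A\to\mathbb{C}$ such that every $\lambda\in A$ has an open neighborhood $U$ in $\mathbb{C}^n$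 and a holomorphic $g$ on $U$ with $g|_{U\cap A}=f|_{U\cap A}$. A set $X\subseteq\mathbb{C}^n$ (not necessarily contained in $A$) is determining for $A$ if $f\equiv 0$ whenever $f\in Hol(A)$ and $f|_{X\cap A}=0$. $A$ is toral if $\mathbb{T}^n$ is determining for $A$; $A$ is atoral if $\mathbb{T}^n$ is not determining for any irreducible component of $A$. *)

theory Defs
  imports "HOL-Analysis.Analysis" "HOL-Library.Poly_Mapping"
begin

section \<open>Domains in complex n-space\<close>

text \<open>The space \<open>\<complex>\<^sup>n\<close> is \<open>complex ^ 'n\<close> with \<open>n = CARD('n) \<ge> 1\<close>.\<close>

definition polydisc :: "(complex ^ 'n) set" where
  "polydisc = {z. \<forall>i. norm (z $ i) < 1}"

definition torus :: "(complex ^ 'n) set" where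
  "torus = {z. \<forall>i. norm (z $ i) = 1}"

definition exterior_polydisc :: "(complex ^ 'n) set" where
  "exterior_polydisc = {z. \<forall>i. norm (z $ i) > 1}"

text \<open>Holomorphy in several variables: the real Frechet derivative exists at every point of the
  open set and is complex linear.\<close>

definition holomorphic_several :: "(complex ^ 'n \<Rightarrow> complex) \<Rightarrow> (complex ^ 'n) set \<Rightarrow> bool" where
  "holomorphic_several f U \<longleftrightarrow> open U \<and>
     (\<forall>z\<in>U. \<exists>f'. (f has_derivative f') (at z) \<and> (\<forall>c v. f' (c *s v) = c * f' v))"


section \<open>Polynomials and rational functions\<close>

text \<open>A polynomial in variables indexed by \<open>'n\<close> is a finitely supported map from exponent vectors
  to coefficients; the ring structure is the convolution product of \<open>Poly_Mapping\<close>.\<close>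

type_synonym 'n cpoly = "('n \<Rightarrow>\<^sub>0 nat) \<Rightarrow>\<^sub>0 complex"

definition cpoly_eval :: "'n::finite cpoly \<Rightarrow> complex ^ 'n \<Rightarrow> complex" where
  "cpoly_eval p z =
     (\<Sum>m\<in>Poly_Mapping.keys p. Poly_Mapping.lookup p m * (\<Prod>i\<in>UNIV. (z $ i) ^ Poly_Mapping.lookup m i))"

definition cpoly_zeros :: "'n::finite cpoly \<Rightarrow> (complex ^ 'n) set" where
  "cpoly_zeros p = {z. cpoly_eval p z = 0}"

text \<open>This is \<^const>\<open>coprime\<close> unfolded; the library constant needs class \<open>algebraic_semidom\<close>, of which
  this polynomial ring is not an instance.\<close>

definition cpoly_coprime :: "'n cpoly \<Rightarrow> 'n cpoly \<Rightarrow> bool" where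
  "cpoly_coprime a b \<longleftrightarrow> (\<forall>c. c dvd a \<longrightarrow> c dvd b \<longrightarrow> c dvd 1)"

text \<open>A rational function is identified with its values on the polydisc, which determine it as an
  element of \<open>\<complex>(z\<^sub>1,\<dots>,z\<^sub>n)\<close> because the polydisc is a nonempty open set.\<close>

definition is_quotient :: "(complex ^ 'n::finite \<Rightarrow> complex) \<Rightarrow> 'n cpoly \<Rightarrow> 'n cpoly \<Rightarrow> bool" where
  "is_quotient f a b \<longleftrightarrow> b \<noteq> 0 \<and>
     (\<forall>z\<in>polydisc. cpoly_eval b z \<noteq> 0 \<longrightarrow> f z = cpoly_eval a z / cpoly_eval b z)"

definition rational :: "(complex ^ 'n::finite \<Rightarrow> complex) \<Rightarrow> bool" where
  "rational f \<longleftrightarrow> (\<exists>a b. is_quotient f a b)"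

text \<open>Every rational function has a coprime representation, and its numerator is unique up to a
  nonzero constant, so the zero set does not depend on the choice.\<close>

definition numerator :: "(complex ^ 'n::finite \<Rightarrow> complex) \<Rightarrow> 'n cpoly" where
  "numerator f = (SOME a. \<exists>b. is_quotient f a b \<and> cpoly_coprime a b)"

definition Z_rational :: "(complex ^ 'n::finite \<Rightarrow> complex) \<Rightarrow> (complex ^ 'n) set" where
  "Z_rational f = cpoly_zeros (numerator f)"


section \<open>Inner functions\<close>

text \<open>The torus is parametrized by \<open>\<theta> \<mapsto> (e\<^sup>i\<^sup>\<theta>\<^sup>1,\<dots>,e\<^sup>i\<^sup>\<theta>\<^sup>n)\<close>; by periodicity, a subset of the torus is null
  for its product Lebesgue measure iff its preimage in \<open>\<real>\<^sup>n\<close> is Lebesgue null.\<close>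

definition inner_function :: "(complex ^ 'n \<Rightarrow> complex) \<Rightarrow> bool" where
  "inner_function f \<longleftrightarrow>
     holomorphic_several f polydisc \<and> bounded (f ` polydisc) \<and>
     (AE \<theta> in (lborel :: (real ^ 'n) measure).
        \<exists>L. ((\<lambda>r. f (r *\<^sub>R (\<chi> i. cis (\<theta> $ i)))) \<longlongrightarrow> L) (at_left 1) \<and> norm L = 1)"

definition rational_inner :: "(complex ^ 'n::finite \<Rightarrow> complex) \<Rightarrow> bool" where
  "rational_inner f \<longleftrightarrow> inner_function f \<and> rational f"


section \<open>Toral and atoral algebraic sets\<close>

definition algebraic_set :: "(complex ^ 'n::finite) set \<Rightarrow> bool" where
  "algebraic_set A \<longleftrightarrow> (\<exists>P. finite P \<and> A = (\<Inter>p\<in>P. cpoly_zeros p))"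

definition irreducible_algebraic :: "(complex ^ 'n::finite) set \<Rightarrow> bool" where
  "irreducible_algebraic V \<longleftrightarrow> algebraic_set V \<and> V \<noteq> {} \<and>
     (\<forall>B C. algebraic_set B \<longrightarrow> algebraic_set C \<longrightarrow> V = B \<union> C \<longrightarrow> B = V \<or> C = V)"

definition irreducible_component :: "(complex ^ 'n::finite) set \<Rightarrow> (complex ^ 'n) set \<Rightarrow> bool" where
  "irreducible_component V A \<longleftrightarrow> irreducible_algebraic V \<and> V \<subseteq> A \<and>
     (\<forall>W. irreducible_algebraic W \<longrightarrow> V \<subseteq> W \<longrightarrow> W \<subseteq> A \<longrightarrow> W = V)"

text \<open>Functions on \<open>A\<close> are total functions whose values outside \<open>A\<close> are irrelevant.\<close>

definition Hol :: "(complex ^ 'n) set \<Rightarrow> (complex ^ 'n \<Rightarrow> complex) set" where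
  "Hol A = {f. \<forall>w\<in>A. \<exists>U g. open U \<and> w \<in> U \<and> holomorphic_several g U \<and> (\<forall>z\<in>U \<inter> A. g z = f z)}"

definition determining :: "(complex ^ 'n) set \<Rightarrow> (complex ^ 'n) set \<Rightarrow> bool" where
  "determining X A \<longleftrightarrow> (\<forall>f\<in>Hol A. (\<forall>z\<in>X \<inter> A. f z = 0) \<longrightarrow> (\<forall>z\<in>A. f z = 0))"

definition toral :: "(complex ^ 'n) set \<Rightarrow> bool" where
  "toral A \<longleftrightarrow> determining torus A"

definition atoral :: "(complex ^ 'n::finite) set \<Rightarrow> bool" where
  "atoral A \<longleftrightarrow> (\<forall>V. irreducible_component V A \<longrightarrow> \<not> determining torus V)"

end

theory Submission
  imports Defs "HOL-Complex_Analysis.Complex_Analysis"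
    "HOL-Computational_Algebra.Fundamental_Theorem_Algebra"
begin

text \<open>
  Write \<open>\<phi> - \<alpha> = a/b\<close> in lowest terms and put \<open>p = a + \<alpha> b\<close>, so that \<open>\<phi> = p/q\<close> with \<open>q = b\<close>, again in
  lowest terms. Comparing radial limits gives \<open>|p| = |q|\<close> on the torus
  (\<open>inner_numerator_denominator_torus\<close>), and a maximum principle on analytic discs with boundary on the
  torus gives \<open>|\<phi>| < 1\<close> on the polydisc (\<open>rational_inner_norm_lt_1\<close>). The identity \<open>|p|\<^sup>2 = |q|\<^sup>2\<close> extends
  from the torus to \<open>p(z) cnj (p(z*)) = q(z) cnj (q(z*))\<close> for all \<open>z\<close> without zero coordinates, where
  \<open>z*\<close> has the coordinates \<open>1 / cnj z\<^sub>k\<close> (\<open>reflection_identity\<close>). It carries information from the polydisc to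
  the exterior.

  The algebra enters through a local form of Study's lemma (\<open>prime_zeros_not_contained\<close>): near any zero
  of a prime polynomial \<open>g\<close> there are zeros of \<open>g\<close> at which a given polynomial that \<open>g\<close> does not divide is
  nonzero. Hence, if on an open set all zeros of a polynomial are zeros of a coprime polynomial, there are
  none (\<open>coprime_zeros_not_locally_contained\<close>). Since \<open>p = \<phi> q\<close> on the polydisc, \<open>q\<close> has no zeros
  there; by reflection \<open>p\<close> has no zeros in the exterior. If \<open>|\<alpha>| \<ge> 1\<close>, a zero of \<open>a = p - \<alpha> q\<close> in the
  polydisc would thus give \<open>\<phi> = \<alpha>\<close>, contradicting \<open>|\<phi>| < 1\<close>; the case of the exterior and
  \<open>|\<alpha>| \<le> 1\<close> follows by reflection.
  Study's lemma rests on unique factorization, which is proved by adjoining one variable at a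
  time and Gauss's lemma (\<open>irreducible_imp_prime_in\<close>).

  For \<open>|\<alpha>| \<noteq> 1\<close>, zeros of \<open>p - \<alpha> q\<close> on the torus are zeros of \<open>q\<close> because \<open>|p| = |q|\<close>. The components
  of \<open>Z\<^sub>a\<close> are the zero sets of the prime factors of \<open>a\<close>, and by Study's lemma \<open>q\<close> does not vanish
  identically on any of them, so \<open>q\<close> witnesses that the torus is not determining.

  For \<open>|\<alpha>| = 1\<close> only the absence of zeros of \<open>a\<close> in the polydisc and its exterior matters
  (\<open>toral_of_avoiding\<close>). Consider the polynomials \<open>l \<mapsto> a(l \<gamma>(t))\<close> along a curve
  \<open>\<gamma>(t) = (exp (\<i> (x\<^sub>k + t y\<^sub>k)))\<^sub>k\<close>. For real \<open>t\<close> the point \<open>\<gamma>(t)\<close> is on the torus, and every root \<open>l\<close> is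
  unimodular, as otherwise \<open>l \<gamma>(t)\<close> would be a zero of \<open>a\<close> in the polydisc or in the exterior. So the
  roots lie over points of the torus, where a function \<open>f\<close> as in the definition of determining sets
  vanishes. The leading coefficient has constant modulus for real \<open>t\<close>, hence no zeros for complex \<open>t\<close>,
  so the degree is constant, and the power sums of the values of \<open>f\<close> over all roots are entire in \<open>t\<close>.
  They vanish for real \<open>t\<close>, hence identically, and \<open>f\<close> vanishes at all roots
  (\<open>vanishing_on_root_family\<close>). Every zero of \<open>a\<close> without zero coordinates arises in this way, for
  \<open>l = 1\<close> and \<open>t = \<i>\<close>, and these zeros are dense in \<open>Z\<^sub>a\<close>, once more by Study's lemma. Treating all the
  roots at once replaces the connectedness of the regular part of an irreducible variety.
\<close>

(* The symbol $ is to denote vector components only. *)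
no_notation fps_nth (infixl "$" 75)

section \<open>Polynomials as functions\<close>

definition monomial_eval :: "('n::finite \<Rightarrow>\<^sub>0 nat) \<Rightarrow> complex ^ 'n \<Rightarrow> complex" where
  "monomial_eval m z = (\<Prod>i\<in>UNIV. (z $ i) ^ Poly_Mapping.lookup m i)"

lemma monomial_eval_add: "monomial_eval (m + m') z = monomial_eval m z * monomial_eval m' z"
  by (simp add: monomial_eval_def lookup_add power_add prod.distrib)

lemma monomial_eval_0 [simp]: "monomial_eval 0 z = 1"
  by (simp add: monomial_eval_def)

lemma cpoly_eval_eq_sum_superset:
  assumes "finite K" "Poly_Mapping.keys p \<subseteq> K"
  shows "cpoly_eval p z = (\<Sum>m\<in>K. Poly_Mapping.lookup p m * monomial_eval m z)"
  unfolding cpoly_eval_def monomial_eval_def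
  by (intro sum.mono_neutral_left assms) (auto simp: in_keys_iff)

lemma cpoly_eval_0 [simp]: "cpoly_eval 0 z = 0"
  by (simp add: cpoly_eval_def)

lemma cpoly_eval_single [simp]:
  "cpoly_eval (Poly_Mapping.single m c) z = c * monomial_eval m z"
  by (subst cpoly_eval_eq_sum_superset[of "{m}"]) (auto simp: lookup_single)

lemma cpoly_eval_1 [simp]: "cpoly_eval 1 z = 1"
  using cpoly_eval_single[of 0 1 z] by simp

lemma cpoly_eval_add [simp]: "cpoly_eval (p + q) z = cpoly_eval p z + cpoly_eval q z"
proof -
  let ?K = "Poly_Mapping.keys p \<union> Poly_Mapping.keys q"
  show ?thesis
    using Poly_Mapping.keys_add[of p q]
    by (subst (1 2 3) cpoly_eval_eq_sum_superset[of ?K])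
       (auto simp: lookup_add algebra_simps sum.distrib)
qed

lemma cpoly_eval_sum: "cpoly_eval (\<Sum>x\<in>A. f x) z = (\<Sum>x\<in>A. cpoly_eval (f x) z)"
  by (induction A rule: infinite_finite_induct) auto

lemma cpoly_eval_uminus [simp]: "cpoly_eval (- p) z = - cpoly_eval p z"
  using cpoly_eval_add[of p "-p" z] by (simp add: eq_neg_iff_add_eq_0 add.commute)

lemma cpoly_eval_diff [simp]: "cpoly_eval (p - q) z = cpoly_eval p z - cpoly_eval q z"
  using cpoly_eval_add[of p "-q" z] by simp

lemma cpoly_sum_singles:
  "p = (\<Sum>m\<in>Poly_Mapping.keys p. Poly_Mapping.single m (Poly_Mapping.lookup p m))"
  by (rule poly_mapping_eqI) (auto simp: lookup_sum lookup_single when_def in_keys_iff)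

lemma cpoly_eval_mult [simp]: "cpoly_eval (p * q) z = cpoly_eval p z * cpoly_eval q z"
proof -
  have "cpoly_eval (p * q) z =
      cpoly_eval ((\<Sum>m\<in>Poly_Mapping.keys p. Poly_Mapping.single m (Poly_Mapping.lookup p m)) *
        (\<Sum>m\<in>Poly_Mapping.keys q. Poly_Mapping.single m (Poly_Mapping.lookup q m))) z"
    by (metis cpoly_sum_singles)
  also have "\<dots> = cpoly_eval p z * cpoly_eval q z"
    unfolding sum_product mult_single cpoly_eval_sum cpoly_eval_single monomial_eval_add
      cpoly_eval_eq_sum_superset[OF finite_keys order.refl, of p]
      cpoly_eval_eq_sum_superset[OF finite_keys order.refl, of q]
    by (simp add: mult_ac)
  finally show ?thesis .
qed

text \<open>One variable is split off at a time: for fixed values of the others, a polynomial in that variable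
  with infinitely many zeros has zero coefficients.\<close>

lemma monomials_linearly_independent:
  fixes S :: "'n::finite set" and c :: "('n \<Rightarrow> nat) \<Rightarrow> complex"
  assumes "finite S" "finite K" "\<And>m i. m \<in> K \<Longrightarrow> i \<notin> S \<Longrightarrow> m i = 0"
    and "\<And>z::complex ^ 'n. (\<Sum>m\<in>K. c m * (\<Prod>i\<in>S. (z $ i) ^ m i)) = 0"
  shows "\<forall>m\<in>K. c m = 0"
  using assms
proof (induction S arbitrary: K c rule: finite_induct)
  case empty
  have "K \<subseteq> {\<lambda>_. 0}" using empty.prems by auto
  then consider "K = {}" | "K = {\<lambda>_. 0}" by blast
  then show ?case using empty.prems(3)[of 0] by cases auto
next
  case (insert j S)
  show ?case
  proof
    fix m0 assume "m0 \<in> K"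
    define K0 where "K0 = {m\<in>K. m j = m0 j}"
    have drop_inj: "inj_on (\<lambda>m. m(j := 0)) K0"
    proof (rule inj_onI)
      fix m m' assume "m \<in> K0" "m' \<in> K0" and eq: "m(j := 0) = m'(j := 0)"
      then have "m j = m' j" by (simp add: K0_def)
      then show "m = m'" using eq by (metis fun_upd_triv fun_upd_upd)
    qed
    define c' where "c' m = c (m(j := m0 j))" for m
    have c': "c' (m(j := 0)) = c m" if "m \<in> K0" for m
      using that unfolding K0_def c'_def by (metis (mono_tags, lifting) fun_upd_triv fun_upd_upd mem_Collect_eq)
    have "\<forall>m\<in>(\<lambda>m. m(j := 0)) ` K0. c' m = 0"
    proof (rule insert.IH)
      show "finite ((\<lambda>m. m(j := 0)) ` K0)" using insert.prems(1) by (simp add: K0_def)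
      show "m i = 0" if "m \<in> (\<lambda>m. m(j := 0)) ` K0" "i \<notin> S" for m i
        using that insert.prems(2) by (auto simp: K0_def)
      fix z :: "complex ^ 'n"
      define P where "P = (\<Sum>m\<in>K. monom (c m * (\<Prod>i\<in>S. (z $ i) ^ m i)) (m j))"
      have "poly P t = 0" for t
      proof -
        define z' where "z' = (\<chi> i. if i = j then t else z $ i)"
        have "poly P t = (\<Sum>m\<in>K. c m * (\<Prod>i\<in>insert j S. (z' $ i) ^ m i))"
          unfolding P_def poly_sum poly_monom
        proof (intro sum.cong refl)
          fix m
          have "(\<Prod>i\<in>S. (z' $ i) ^ m i) = (\<Prod>i\<in>S. (z $ i) ^ m i)"
            using insert.hyps by (intro prod.cong) (auto simp: z'_def)
          then show "c m * (\<Prod>i\<in>S. z $ i ^ m i) * t ^ m j = c m * (\<Prod>i\<in>insert j S. z' $ i ^ m i)"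
            using insert.hyps by (simp add: z'_def)
        qed
        then show ?thesis using insert.prems(3) by simp
      qed
      then have "P = 0" using poly_all_0_iff_0 by blast
      then have "0 = coeff P (m0 j)" by simp
      also have "\<dots> = (\<Sum>m\<in>K. if m j = m0 j then c m * (\<Prod>i\<in>S. (z $ i) ^ m i) else 0)"
        by (simp add: P_def coeff_sum)
      also have "\<dots> = (\<Sum>m\<in>K0. c m * (\<Prod>i\<in>S. (z $ i) ^ m i))"
        unfolding K0_def using insert.prems(1) by (simp add: sum.inter_filter)
      also have "\<dots> = (\<Sum>m\<in>K0. c' (m(j := 0)) * (\<Prod>i\<in>S. (z $ i) ^ (m(j := 0)) i))"
        using insert.hyps by (intro sum.cong refl arg_cong2[of _ _ _ _ "(*)"] prod.cong) (auto simp: c')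
      also have "\<dots> = (\<Sum>m\<in>(\<lambda>m. m(j := 0)) ` K0. c' m * (\<Prod>i\<in>S. (z $ i) ^ m i))"
        using drop_inj by (simp add: sum.reindex)
      finally show "(\<Sum>m\<in>(\<lambda>m. m(j := 0)) ` K0. c' m * (\<Prod>i\<in>S. (z $ i) ^ m i)) = 0" by simp
    qed
    then show "c m0 = 0" using c'[of m0] \<open>m0 \<in> K\<close> by (auto simp: K0_def)
  qed
qed

lemma cpoly_eval_eq_0_imp:
  assumes "\<And>z. cpoly_eval p z = 0"
  shows "p = 0"
proof -
  let ?K = "Poly_Mapping.lookup ` Poly_Mapping.keys p"
  have inj: "inj_on Poly_Mapping.lookup (Poly_Mapping.keys p)"
    by (simp add: inj_on_def lookup_inject)
  have "\<forall>m\<in>?K. Poly_Mapping.lookup p (Abs_poly_mapping m) = 0"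
  proof (rule monomials_linearly_independent[of UNIV])
    fix z
    show "(\<Sum>m\<in>?K. Poly_Mapping.lookup p (Abs_poly_mapping m) * (\<Prod>i\<in>UNIV. z $ i ^ m i)) = 0"
      using assms[of z] by (simp add: sum.reindex[OF inj] cpoly_eval_def lookup_inverse)
  qed auto
  then show ?thesis
    by (metis (no_types, lifting) Poly_Mapping.lookup_inverse image_eqI in_keys_iff lookup_zero poly_mapping_eqI)
qed

lemma cpoly_eval_inject: "cpoly_eval p = cpoly_eval q \<longleftrightarrow> p = q"
  using cpoly_eval_eq_0_imp[of "p - q"] by (auto simp: fun_eq_iff)

text \<open>Polynomials are represented by their functions: this makes composition with linear maps and
  restriction to lines available, and the absence of zero divisors is inherited from polynomials on
  a line. The type is an integral domain for every finite index type, whereas exponent vectors over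
  an unordered index type carry no canonical monomial order.\<close>

typedef (overloaded) 'n::finite polyfun = "range (cpoly_eval :: 'n cpoly \<Rightarrow> complex ^ 'n \<Rightarrow> complex)"
  morphisms pf_eval Abs_polyfun by blast

setup_lifting type_definition_polyfun

lift_definition of_cpoly :: "'n::finite cpoly \<Rightarrow> 'n polyfun" is cpoly_eval by simp

lemma pf_eval_of_cpoly [simp]: "pf_eval (of_cpoly p) z = cpoly_eval p z"
  by transfer simp

lemma polyfun_eqI: "(\<And>z. pf_eval f z = pf_eval g z) \<Longrightarrow> f = g"
  using pf_eval_inject by blast

lemma of_cpoly_surj: "\<exists>p. f = of_cpoly p"
  by transfer auto

lemma of_cpoly_inject: "of_cpoly p = of_cpoly q \<longleftrightarrow> p = q"
  by transfer (rule cpoly_eval_inject)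

text \<open>Restriction to lines reduces statements on nonvanishing to polynomials in one variable.\<close>

lemma cpoly_eval_line: "\<exists>P. \<forall>t. cpoly_eval p (z + t *s v) = poly P t"
proof -
  define Q where "Q m = (\<Prod>i\<in>UNIV. [:z $ i, v $ i:] ^ Poly_Mapping.lookup m i)" for m
  have Q: "monomial_eval m (z + t *s v) = poly (Q m) t" for m t
    unfolding monomial_eval_def Q_def poly_prod poly_power by simp
  have "cpoly_eval p (z + t *s v) =
      poly (\<Sum>m\<in>Poly_Mapping.keys p. smult (Poly_Mapping.lookup p m) (Q m)) t" for t
    unfolding cpoly_eval_eq_sum_superset[OF finite_keys order.refl] poly_sum poly_smult Q ..
  then show ?thesis by (intro exI allI)
qed

lemma pf_eval_line: "\<exists>P. \<forall>t. pf_eval f (z + t *s v) = poly P t"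
  using of_cpoly_surj[of f] cpoly_eval_line by auto

instantiation polyfun :: (finite) comm_ring_1
begin

lift_definition zero_polyfun :: "'a polyfun" is "\<lambda>_. 0" by (rule range_eqI, rule ext, rule cpoly_eval_0[symmetric])
lift_definition one_polyfun :: "'a polyfun" is "\<lambda>_. 1" by (rule range_eqI, rule ext, rule cpoly_eval_1[symmetric])
lift_definition plus_polyfun :: "'a polyfun \<Rightarrow> 'a polyfun \<Rightarrow> 'a polyfun" is "\<lambda>f g z. f z + g z"
  by (elim rangeE, hypsubst, rule range_eqI, rule ext, rule cpoly_eval_add[symmetric])
lift_definition minus_polyfun :: "'a polyfun \<Rightarrow> 'a polyfun \<Rightarrow> 'a polyfun" is "\<lambda>f g z. f z - g z"
  by (elim rangeE, hypsubst, rule range_eqI, rule ext, rule cpoly_eval_diff[symmetric])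
lift_definition uminus_polyfun :: "'a polyfun \<Rightarrow> 'a polyfun" is "\<lambda>f z. - f z"
  by (elim rangeE, hypsubst, rule range_eqI, rule ext, rule cpoly_eval_uminus[symmetric])
lift_definition times_polyfun :: "'a polyfun \<Rightarrow> 'a polyfun \<Rightarrow> 'a polyfun" is "\<lambda>f g z. f z * g z"
  by (elim rangeE, hypsubst, rule range_eqI, rule ext, rule cpoly_eval_mult[symmetric])

instance
  by standard (transfer; auto simp: fun_eq_iff algebra_simps)+

end

lemma pf_eval_simps [simp]:
  "pf_eval 0 z = 0" "pf_eval 1 z = 1" "pf_eval (f + g) z = pf_eval f z + pf_eval g z"
  "pf_eval (f - g) z = pf_eval f z - pf_eval g z" "pf_eval (- f) z = - pf_eval f z"
  "pf_eval (f * g) z = pf_eval f z * pf_eval g z"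
  by (transfer; simp)+

lemma pf_eval_power [simp]: "pf_eval (f ^ n) z = pf_eval f z ^ n"
  by (induction n) auto

lemma pf_eval_sum: "pf_eval (\<Sum>x\<in>A. f x) z = (\<Sum>x\<in>A. pf_eval (f x) z)"
  by (induction A rule: infinite_finite_induct) auto

lemma pf_eval_prod: "pf_eval (\<Prod>x\<in>A. f x) z = (\<Prod>x\<in>A. pf_eval (f x) z)"
  by (induction A rule: infinite_finite_induct) auto

lemma polyfun_nonzeroE:
  assumes "f \<noteq> 0" obtains z where "pf_eval f z \<noteq> 0"
  using assms polyfun_eqI[of f 0] by auto

instance polyfun :: (finite) idom
proof
  fix f g :: "'a polyfun" assume "f \<noteq> 0" "g \<noteq> 0"
  obtain z where z: "pf_eval f z \<noteq> 0" using polyfun_nonzeroE[OF \<open>f \<noteq> 0\<close>] .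
  obtain w where w: "pf_eval g w \<noteq> 0" using polyfun_nonzeroE[OF \<open>g \<noteq> 0\<close>] .
  obtain P where P: "\<And>t. pf_eval f (z + t *s (w - z)) = poly P t"
    using pf_eval_line[of f z "w - z"] by blast
  obtain Q where Q: "\<And>t. pf_eval g (z + t *s (w - z)) = poly Q t"
    using pf_eval_line[of g z "w - z"] by blast
  have "P \<noteq> 0" "Q \<noteq> 0" using z w P[of 0] Q[of 1] by auto
  then have "P * Q \<noteq> 0" by simp
  then obtain t where "poly (P * Q) t \<noteq> 0" using poly_all_0_iff_0 by blast
  then have "pf_eval (f * g) (z + t *s (w - z)) \<noteq> 0" using P Q by simp
  then show "f * g \<noteq> 0" by (metis pf_eval_simps(1))
qed

lemma of_cpoly_hom [simp]:
  "of_cpoly 0 = 0" "of_cpoly 1 = 1" "of_cpoly (p + q) = of_cpoly p + of_cpoly q"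
  "of_cpoly (p - q) = of_cpoly p - of_cpoly q" "of_cpoly (p * q) = of_cpoly p * of_cpoly q"
  by (auto intro!: polyfun_eqI)

lemma of_cpoly_eq_0_iff [simp]: "of_cpoly p = 0 \<longleftrightarrow> p = 0"
  using of_cpoly_inject[of p 0] by simp

lift_definition pf_const :: "complex \<Rightarrow> 'n::finite polyfun" is "\<lambda>c _. c"
  by (rule range_eqI[of _ _ "Poly_Mapping.single 0 c" for c]) (auto simp: fun_eq_iff)

lemma pf_eval_const [simp]: "pf_eval (pf_const c) z = c"
  by transfer simp

lift_definition pf_var :: "'n::finite \<Rightarrow> 'n polyfun" is "\<lambda>i (z :: complex ^ 'n). z $ i"
proof -
  fix i :: 'n
  have "monomial_eval (Poly_Mapping.single i 1) z = z $ i" for z :: "complex ^ 'n"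
    unfolding monomial_eval_def by (subst prod.remove[of _ i]) (auto simp: lookup_single when_def)
  then show "(\<lambda>z. z $ i) \<in> range (cpoly_eval :: 'n cpoly \<Rightarrow> _)"
    by (intro range_eqI[of _ _ "Poly_Mapping.single (Poly_Mapping.single i 1) 1"]) (auto simp: fun_eq_iff)
qed

lemma pf_eval_var [simp]: "pf_eval (pf_var i) z = z $ i"
  by transfer simp

lemma polyfun_expansion:
  fixes f :: "'n::finite polyfun"
  shows "\<exists>K c. finite K \<and> (\<forall>z. pf_eval f z = (\<Sum>m\<in>K. c m * (\<Prod>i\<in>UNIV. (z $ i) ^ m i)))"
proof -
  obtain p where p: "f = of_cpoly p" using of_cpoly_surj by blast
  have inj: "inj_on Poly_Mapping.lookup (Poly_Mapping.keys p)"
    by (simp add: inj_on_def lookup_inject)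
  show ?thesis
    by (rule exI[of _ "Poly_Mapping.lookup ` Poly_Mapping.keys p"],
        rule exI[of _ "\<lambda>m. Poly_Mapping.lookup p (Abs_poly_mapping m)"])
       (simp add: p sum.reindex[OF inj] cpoly_eval_def lookup_inverse)
qed

section \<open>Irreducible polynomials are prime\<close>

definition poly_in :: "'n::finite set \<Rightarrow> 'n polyfun set" where
  "poly_in S = {f. \<forall>z w. (\<forall>i\<in>S. z $ i = w $ i) \<longrightarrow> pf_eval f z = pf_eval f w}"

lemma poly_inD: "f \<in> poly_in S \<Longrightarrow> (\<And>i. i \<in> S \<Longrightarrow> z $ i = w $ i) \<Longrightarrow> pf_eval f z = pf_eval f w"
  by (auto simp: poly_in_def)

lemma poly_inI: "(\<And>z w. (\<And>i. i \<in> S \<Longrightarrow> z $ i = w $ i) \<Longrightarrow> pf_eval f z = pf_eval f w) \<Longrightarrow> f \<in> poly_in S"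
  unfolding poly_in_def by blast

lemma poly_in_UNIV [simp]: "poly_in UNIV = UNIV"
  by (auto simp: poly_in_def vec_eq_iff[symmetric])

lemma poly_in_mono: "S \<subseteq> T \<Longrightarrow> poly_in S \<subseteq> poly_in T"
  unfolding poly_in_def by blast

lemma poly_in_0 [simp]: "0 \<in> poly_in S" and poly_in_1 [simp]: "1 \<in> poly_in S"
  and poly_in_const [simp]: "pf_const c \<in> poly_in S"
  by (auto simp: poly_in_def)

lemma poly_in_var: "i \<in> S \<Longrightarrow> pf_var i \<in> poly_in S"
  by (auto simp: poly_in_def)

lemma poly_in_add: "f \<in> poly_in S \<Longrightarrow> g \<in> poly_in S \<Longrightarrow> f + g \<in> poly_in S"
  by (rule poly_inI, simp, rule arg_cong2[where f = "(+)"]; erule poly_inD; simp)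

lemma poly_in_diff: "f \<in> poly_in S \<Longrightarrow> g \<in> poly_in S \<Longrightarrow> f - g \<in> poly_in S"
  by (rule poly_inI, simp, rule arg_cong2[where f = "(-)"]; erule poly_inD; simp)

lemma poly_in_mult: "f \<in> poly_in S \<Longrightarrow> g \<in> poly_in S \<Longrightarrow> f * g \<in> poly_in S"
  by (rule poly_inI, simp, rule arg_cong2[where f = "(*)"]; erule poly_inD; simp)

lemma poly_in_power: "f \<in> poly_in S \<Longrightarrow> f ^ n \<in> poly_in S"
  by (induction n) (auto intro: poly_in_mult)

lemma poly_in_sum: "(\<And>x. x \<in> A \<Longrightarrow> f x \<in> poly_in S) \<Longrightarrow> sum f A \<in> poly_in S"
  by (induction A rule: infinite_finite_induct) (auto intro: poly_in_add)

lemma poly_in_prod: "(\<And>x. x \<in> A \<Longrightarrow> f x \<in> poly_in S) \<Longrightarrow> prod f A \<in> poly_in S"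
  by (induction A rule: infinite_finite_induct) (auto intro: poly_in_mult)

lemmas poly_in_intros = poly_in_add poly_in_diff poly_in_mult poly_in_power poly_in_sum poly_in_prod poly_in_var

lemma poly_in_emptyD: "f \<in> poly_in {} \<Longrightarrow> f = pf_const (pf_eval f 0)"
  by (rule polyfun_eqI) (auto intro: poly_inD)

text \<open>The coordinates outside \<open>S\<close> are changed one at a time.\<close>

lemma poly_inI_coordinatewise:
  assumes "\<And>i. i \<notin> S \<Longrightarrow> f \<in> poly_in (-{i})"
  shows "f \<in> poly_in S"
  unfolding poly_in_def
proof (intro CollectI allI impI)
  fix z w :: "complex ^ 'a" assume eq: "\<forall>i\<in>S. z $ i = w $ i"
  have "pf_eval f z = pf_eval f (\<chi> j. if j \<in> T then w $ j else z $ j)" if "finite T" "T \<subseteq> -S" for T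
    using that
  proof (induction T rule: finite_induct)
    case empty
    then show ?case by (simp add: vec_lambda_eta)
  next
    case (insert i T)
    have "pf_eval f (\<chi> j. if j \<in> insert i T then w $ j else z $ j)
        = pf_eval f (\<chi> j. if j \<in> T then w $ j else z $ j)"
      by (rule poly_inD[OF assms[of i]]) (use insert in auto)
    then show ?case using insert by auto
  qed
  from this[of "-S"] have "pf_eval f z = pf_eval f (\<chi> j. if j \<in> -S then w $ j else z $ j)" by simp
  also have "(\<chi> j. if j \<in> -S then w $ j else z $ j) = w"
    using eq by (auto simp: vec_eq_iff)
  finally show "pf_eval f z = pf_eval f w" .
qed

text \<open>In this section a polynomial is also a univariate polynomial in \<open>z\<^sub>i\<close> over the ring \<open>poly_in (-{i})\<close>
  of polynomials without \<open>z\<^sub>i\<close>.\<close>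

definition coeffs_in :: "'n::finite set \<Rightarrow> 'n polyfun poly \<Rightarrow> bool" where
  "coeffs_in S F \<longleftrightarrow> (\<forall>k. coeff F k \<in> poly_in S)"

lemma coeffs_in_mult: "coeffs_in S F \<Longrightarrow> coeffs_in S G \<Longrightarrow> coeffs_in S (F * G)"
  unfolding coeffs_in_def coeff_mult by (auto intro!: poly_in_intros)

lemma coeffs_in_diff: "coeffs_in S F \<Longrightarrow> coeffs_in S G \<Longrightarrow> coeffs_in S (F - G)"
  unfolding coeffs_in_def by (auto intro!: poly_in_intros)

lemma ex_expansion_in: "\<exists>F. coeffs_in (-{i}) F \<and> f = poly F (pf_var i)"
proof -
  obtain K c where K: "finite K" "\<And>z. pf_eval f z = (\<Sum>m\<in>K. c m * (\<Prod>j\<in>UNIV. (z $ j) ^ m j))"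
    using polyfun_expansion[of f] by blast
  define F where "F = (\<Sum>m\<in>K. monom (pf_const (c m) * (\<Prod>j\<in>-{i}. pf_var j ^ m j)) (m i))"
  have "coeffs_in (-{i}) F"
    unfolding coeffs_in_def F_def coeff_sum coeff_monom
    by (auto intro!: poly_in_intros)
  moreover have "f = poly F (pf_var i)"
  proof (rule polyfun_eqI)
    fix z :: "complex ^ 'a"
    have "(\<Prod>j\<in>UNIV. (z $ j) ^ m j) = (z $ i) ^ m i * (\<Prod>j\<in>-{i}. (z $ j) ^ m j)" for m
      by (subst prod.remove[of _ i]) (auto simp: Compl_eq_Diff_UNIV)
    then show "pf_eval f z = pf_eval (poly F (pf_var i)) z"
      unfolding F_def K(2) poly_sum poly_monom
      by (simp add: pf_eval_sum pf_eval_prod mult_ac)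
  qed
  ultimately show ?thesis by blast
qed

lemma pf_eval_poly_var:
  assumes "coeffs_in (-{i}) F"
  shows "pf_eval (poly F (pf_var i)) (\<chi> j. if j = i then t else z $ j)
         = (\<Sum>k\<le>degree F. pf_eval (coeff F k) z * t ^ k)"
  unfolding poly_altdef pf_eval_sum
proof (intro sum.cong refl)
  fix k
  have "pf_eval (coeff F k) (\<chi> j. if j = i then t else z $ j) = pf_eval (coeff F k) z"
    by (rule poly_inD[of _ "-{i}"]) (use assms in \<open>auto simp: coeffs_in_def\<close>)
  then show "pf_eval (coeff F k * pf_var i ^ k) (\<chi> j. if j = i then t else z $ j) =
         pf_eval (coeff F k) z * t ^ k" by simp
qed

lemma pf_eval_coeff_unique:
  assumes "coeffs_in (-{i}) F"
    and "\<And>t. pf_eval (poly F (pf_var i)) (\<chi> j. if j = i then t else z $ j) =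
             pf_eval (poly F (pf_var i)) (\<chi> j. if j = i then t else w $ j)"
  shows "pf_eval (coeff F k) z = pf_eval (coeff F k) w"
proof (cases "k \<le> degree F")
  case True
  define P where "P z = (\<Sum>k\<le>degree F. monom (pf_eval (coeff F k) z) k)" for z
  have "poly (P z) t = poly (P w) t" for t
    using assms(2)[of t] unfolding pf_eval_poly_var[OF assms(1)] P_def by (simp add: poly_sum poly_monom)
  then have "P z = P w" using poly_eq_poly_eq_iff by blast
  moreover have "coeff (P z) k = pf_eval (coeff F k) z" for z
    using True by (simp add: P_def coeff_sum)
  ultimately show ?thesis by metis
qed (simp add: coeff_eq_0)

lemma expansion_in_0:
  assumes "coeffs_in (-{i}) F" "poly F (pf_var i) = 0"
  shows "F = 0"
proof (rule poly_eqI)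
  fix k
  show "coeff F k = coeff 0 k"
  proof (rule polyfun_eqI)
    fix z
    define P where "P = (\<Sum>k\<le>degree F. monom (pf_eval (coeff F k) z) k)"
    have "poly P t = 0" for t
      using pf_eval_poly_var[OF assms(1), of t z] unfolding assms(2) P_def by (simp add: poly_sum poly_monom)
    then have "P = 0" using poly_all_0_iff_0 by blast
    moreover have "coeff P k = pf_eval (coeff F k) z" if "k \<le> degree F"
      using that by (simp add: P_def coeff_sum)
    ultimately show "pf_eval (coeff F k) z = pf_eval (coeff 0 k) z"
      by (cases "k \<le> degree F") (auto simp: coeff_eq_0)
  qed
qed

definition expand_in :: "'n::finite \<Rightarrow> 'n polyfun \<Rightarrow> 'n polyfun poly" where
  "expand_in i f = (SOME F. coeffs_in (-{i}) F \<and> f = poly F (pf_var i))"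

lemma expand_in: "coeffs_in (-{i}) (expand_in i f) \<and> f = poly (expand_in i f) (pf_var i)"
  unfolding expand_in_def by (rule someI_ex) (rule ex_expansion_in)

lemmas coeffs_in_expand_in = expand_in[THEN conjunct1]
  and poly_expand_in [simp] = expand_in[THEN conjunct2, symmetric]

lemma expand_in_eqI:
  assumes "coeffs_in (-{i}) F" "poly F (pf_var i) = f"
  shows "expand_in i f = F"
  using expansion_in_0[OF coeffs_in_diff[OF coeffs_in_expand_in[of i f] assms(1)]] assms(2) by simp

lemma expand_in_diff: "expand_in i (f - g) = expand_in i f - expand_in i g"
  by (rule expand_in_eqI) (auto intro: coeffs_in_diff coeffs_in_expand_in)

lemma expand_in_mult: "expand_in i (f * g) = expand_in i f * expand_in i g"
  by (rule expand_in_eqI) (auto intro: coeffs_in_mult coeffs_in_expand_in)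

lemma expand_in_free: "f \<in> poly_in (-{i}) \<Longrightarrow> expand_in i f = [:f:]"
  by (rule expand_in_eqI) (auto simp: coeffs_in_def coeff_pCons split: nat.split)

lemma expand_in_var_power: "expand_in i (pf_var i ^ n) = monom 1 n"
  by (rule expand_in_eqI) (auto simp: coeffs_in_def poly_monom)

lemma expand_in_eq_0_iff [simp]: "expand_in i f = 0 \<longleftrightarrow> f = 0"
  using poly_expand_in[of i f] expand_in_free[of 0 i] by (metis pCons_0_0 poly_0 poly_in_0)

text \<open>The coefficients are determined by the values of \<open>f\<close> along the lines parallel to the \<open>i\<close>-axis, and
  these values do not change when coordinates outside \<open>insert i S\<close> change.\<close>

lemma coeff_expand_in_poly_in:
  assumes "f \<in> poly_in (insert i S)"
  shows "coeff (expand_in i f) k \<in> poly_in S"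
  unfolding poly_in_def
proof (intro CollectI allI impI)
  fix z w :: "complex ^ 'a" assume eq: "\<forall>i\<in>S. z $ i = w $ i"
  show "pf_eval (coeff (expand_in i f) k) z = pf_eval (coeff (expand_in i f) k) w"
    by (rule pf_eval_coeff_unique[OF coeffs_in_expand_in])
       (use eq in \<open>auto intro!: poly_inD[OF assms]\<close>)
qed

definition deg_in :: "'n::finite \<Rightarrow> 'n polyfun \<Rightarrow> nat" where
  "deg_in i f = degree (expand_in i f)"

lemma deg_in_mult: "f \<noteq> 0 \<Longrightarrow> g \<noteq> 0 \<Longrightarrow> deg_in i (f * g) = deg_in i f + deg_in i g"
  by (simp add: deg_in_def expand_in_mult degree_mult_eq)

lemma deg_in_eq_0_iff: "deg_in i f = 0 \<longleftrightarrow> f \<in> poly_in (-{i})"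
proof
  assume "deg_in i f = 0"
  then obtain c where c: "expand_in i f = [:c:]" unfolding deg_in_def by (metis degree_eq_zeroE)
  then have "f = c" using poly_expand_in[of i f] by (simp del: poly_expand_in)
  with c coeffs_in_expand_in[of i f] show "f \<in> poly_in (-{i})"
    unfolding coeffs_in_def by (metis coeff_pCons_0)
qed (simp add: deg_in_def expand_in_free)

lemma poly_in_divisor:
  assumes "f * g \<in> poly_in S" "f \<noteq> 0"
  shows "g \<in> poly_in S"
proof (cases "g = 0")
  case False
  show ?thesis
  proof (rule poly_inI_coordinatewise)
    fix i assume "i \<notin> S"
    then have "f * g \<in> poly_in (-{i})" using assms(1) poly_in_mono[of S "-{i}"] by blast
    then show "g \<in> poly_in (-{i})"
      using deg_in_mult[OF assms(2) False, of i] by (auto simp: deg_in_eq_0_iff[symmetric])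
  qed
qed auto

text \<open>The sum of the partial degrees bounds the length of factorizations: it is additive on products and
  vanishes only on constants.\<close>

definition sum_deg :: "'n::finite polyfun \<Rightarrow> nat" where
  "sum_deg f = (\<Sum>i\<in>UNIV. deg_in i f)"

lemma sum_deg_mult: "f \<noteq> 0 \<Longrightarrow> g \<noteq> 0 \<Longrightarrow> sum_deg (f * g) = sum_deg f + sum_deg g"
  by (simp add: sum_deg_def deg_in_mult sum.distrib)

lemma sum_deg_eq_0D: "sum_deg f = 0 \<Longrightarrow> f = pf_const (pf_eval f 0)"
  by (rule poly_in_emptyD, rule poly_inI_coordinatewise) (simp add: sum_deg_def deg_in_eq_0_iff)

lemma pf_const_dvd_1: "c \<noteq> 0 \<Longrightarrow> pf_const c dvd 1"
  by (rule dvdI[of _ _ "pf_const (1 / c)"]) (auto intro: polyfun_eqI)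

lemma polyfun_dvd_1_iff: "f dvd 1 \<longleftrightarrow> f \<noteq> 0 \<and> sum_deg f = 0"
proof
  assume "f dvd 1"
  then obtain g where g: "1 = f * g" by (elim dvdE)
  then have nz: "f \<noteq> 0" "g \<noteq> 0" by auto
  have "sum_deg (1 :: 'a polyfun) = 0"
    by (simp add: sum_deg_def deg_in_eq_0_iff)
  then show "f \<noteq> 0 \<and> sum_deg f = 0" using nz sum_deg_mult[OF nz] g by simp
next
  assume "f \<noteq> 0 \<and> sum_deg f = 0"
  then have f: "f = pf_const (pf_eval f 0)" "f \<noteq> 0" using sum_deg_eq_0D by blast+
  have "pf_eval f 0 \<noteq> 0"
  proof
    assume "pf_eval f 0 = 0"
    then have "f = 0" by (subst f(1)) (auto intro: polyfun_eqI)
    with f show False by simp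
  qed
  then have "pf_const (pf_eval f 0) dvd (1 :: 'a polyfun)" by (rule pf_const_dvd_1)
  then show "f dvd 1" using f(1) by simp
qed

lemma polyfun_unit_const: "f dvd 1 \<Longrightarrow> f \<in> poly_in S"
  using sum_deg_eq_0D[of f] poly_in_const[of "pf_eval f 0" S] unfolding polyfun_dvd_1_iff by metis

lemma polyfun_unit_eval: "f dvd 1 \<Longrightarrow> pf_eval f z \<noteq> 0"
proof
  assume "f dvd 1" "pf_eval f z = 0"
  then obtain g where "1 = f * g" by (elim dvdE)
  then have "pf_eval 1 z = pf_eval f z * pf_eval g z" by (metis pf_eval_simps(6))
  then show False using \<open>pf_eval f z = 0\<close> by simp
qed

text \<open>Quotients of elements of \<open>poly_in S\<close> lie in \<open>poly_in S\<close> by \<open>poly_in_divisor\<close>, so divisibility in the full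
  ring is divisibility in the subring.\<close>

definition prime_in :: "'n::finite set \<Rightarrow> 'n polyfun \<Rightarrow> bool" where
  "prime_in S p \<longleftrightarrow> p \<noteq> 0 \<and> \<not> p dvd 1 \<and>
     (\<forall>g\<in>poly_in S. \<forall>h\<in>poly_in S. p dvd g * h \<longrightarrow> p dvd g \<or> p dvd h)"

lemma dvd_iff_dvd_coeffs:
  assumes "p \<in> poly_in (-{i})"
  shows "p dvd g \<longleftrightarrow> (\<forall>k. p dvd coeff (expand_in i g) k)"
proof
  assume "p dvd g"
  then obtain h where "g = p * h" by (elim dvdE)
  then show "\<forall>k. p dvd coeff (expand_in i g) k"
    by (simp add: expand_in_mult expand_in_free[OF assms])
next
  assume "\<forall>k. p dvd coeff (expand_in i g) k"
  then have "p dvd poly (expand_in i g) (pf_var i)"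
    unfolding poly_altdef by (intro dvd_sum) auto
  then show "p dvd g" by simp
qed

text \<open>Gauss's lemma. Of the coefficients of each factor that the prime does not divide, the lowest are
  taken; their product is the only term of the corresponding coefficient of the product that the
  prime might not divide.\<close>

lemma prime_in_insert:
  assumes p: "p \<in> poly_in S" "prime_in S p" and i: "i \<notin> S"
  shows "prime_in (insert i S) p"
  unfolding prime_in_def
proof (intro conjI ballI impI)
  show "p \<noteq> 0" "\<not> p dvd 1" using p by (auto simp: prime_in_def)
  have pi: "p \<in> poly_in (-{i})" using p(1) i poly_in_mono[of S "-{i}"] by blast
  fix g h assume gh: "g \<in> poly_in (insert i S)" "h \<in> poly_in (insert i S)" "p dvd g * h"
  show "p dvd g \<or> p dvd h"
  proof (rule ccontr)
    assume no: "\<not> (p dvd g \<or> p dvd h)"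
    define G H where "G = expand_in i g" and "H = expand_in i h"
    have ex: "\<exists>k. \<not> p dvd coeff G k" "\<exists>k. \<not> p dvd coeff H k"
      using no unfolding G_def H_def dvd_iff_dvd_coeffs[OF pi, of g] dvd_iff_dvd_coeffs[OF pi, of h] by auto
    define j k where "j = (LEAST j. \<not> p dvd coeff G j)" and "k = (LEAST k. \<not> p dvd coeff H k)"
    have j: "\<not> p dvd coeff G j" "\<And>l. l < j \<Longrightarrow> p dvd coeff G l"
      using LeastI_ex[OF ex(1)] not_less_Least unfolding j_def by blast+
    have k: "\<not> p dvd coeff H k" "\<And>l. l < k \<Longrightarrow> p dvd coeff H l"
      using LeastI_ex[OF ex(2)] not_less_Least unfolding k_def by blast+
    have "p dvd coeff (G * H) (j + k)"
      using gh(3) unfolding dvd_iff_dvd_coeffs[OF pi, of "g * h"] G_def H_def expand_in_mult by blast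
    also have "coeff (G * H) (j + k) = coeff G j * coeff H k
        + (\<Sum>l\<in>{..j+k}-{j}. coeff G l * coeff H (j + k - l))"
      unfolding coeff_mult by (subst sum.remove[of _ j]) auto
    finally have "p dvd \<dots>" .
    moreover have "p dvd (\<Sum>l\<in>{..j+k}-{j}. coeff G l * coeff H (j + k - l))"
    proof (rule dvd_sum)
      fix l assume "l \<in> {..j+k}-{j}"
      then have "l < j \<or> j + k - l < k" by auto
      then show "p dvd coeff G l * coeff H (j + k - l)" using j(2) k(2) by auto
    qed
    ultimately have "p dvd coeff G j * coeff H k" by (metis dvd_add_left_iff)
    moreover have "coeff G j \<in> poly_in S" "coeff H k \<in> poly_in S"
      unfolding G_def H_def using gh coeff_expand_in_poly_in by auto
    ultimately show False using p(2) j(1) k(1) unfolding prime_in_def by blast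
  qed
qed

text \<open>Each prime factor of \<open>c\<close> is cancelled against one of the two factors on the right.\<close>

lemma poly_in_primal:
  assumes prime: "\<And>p. p \<in> poly_in S \<Longrightarrow> irreducible p \<Longrightarrow> prime_in T p"
    and "S \<subseteq> T" "c \<in> poly_in S" "c \<noteq> 0" "c * f = q * d" "q \<in> poly_in T" "d \<in> poly_in T"
  shows "\<exists>c1 c2 q' d'. c = c1 * c2 \<and> q = c1 * q' \<and> d = c2 * d' \<and> f = q' * d'"
  using assms(3-)
proof (induction "sum_deg c" arbitrary: c f q d rule: less_induct)
  case less
  consider "c dvd 1" | "irreducible c" | a b where "c = a * b" "\<not> a dvd 1" "\<not> b dvd 1"
    using less.prems(2) unfolding irreducible_def by blast
  then show ?case
  proof cases
    case 1
    then obtain u where u: "1 = c * u" by (elim dvdE)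
    have "f = (c * u) * f" using u by simp
    also have "\<dots> = (u * q) * d" using less.prems(3) by (simp add: mult_ac)
    finally show ?thesis
      by (intro exI[of _ c] exI[of _ 1] exI[of _ "u * q"] exI[of _ d]) (use u in \<open>auto simp: mult.assoc[symmetric]\<close>)
  next
    case 2
    then have "prime_in T c" using prime less.prems by blast
    moreover have "c dvd q * d" using less.prems(3) by (metis dvd_triv_left)
    ultimately have "c dvd q \<or> c dvd d" using less.prems unfolding prime_in_def by blast
    then show ?thesis
    proof
      assume "c dvd q"
      then obtain q' where q': "q = c * q'" by (elim dvdE)
      have "f = q' * d" using less.prems(2,3) q' by (simp add: mult.assoc)
      then show ?thesis using q'
        by (intro exI[of _ c] exI[of _ 1] exI[of _ q'] exI[of _ d]) auto
    next
      assume "c dvd d"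
      then obtain d' where d': "d = c * d'" by (elim dvdE)
      have "f = q * d'" using less.prems(2,3) d' by (simp add: mult.left_commute)
      then show ?thesis using d'
        by (intro exI[of _ 1] exI[of _ c] exI[of _ q] exI[of _ d']) auto
    qed
  next
    case 3
    have nz: "a \<noteq> 0" "b \<noteq> 0" using 3 less.prems(2) by auto
    have in_S: "a \<in> poly_in S" "b \<in> poly_in S"
      using poly_in_divisor[of a b S] poly_in_divisor[of b a S] 3(1) nz less.prems(1) by (auto simp: mult.commute)
    have deg: "sum_deg a < sum_deg c" "sum_deg b < sum_deg c"
      using 3 nz sum_deg_mult[OF nz] polyfun_dvd_1_iff[of a] polyfun_dvd_1_iff[of b] by auto
    obtain a1 a2 q1 d1 where 1: "a = a1 * a2" "q = a1 * q1" "d = a2 * d1" "b * f = q1 * d1"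
      using less.hyps[OF deg(1) in_S(1) nz(1), of "b * f" q d] less.prems 3(1) by (auto simp: mult.assoc)
    have "q1 \<in> poly_in T" "d1 \<in> poly_in T"
      using 1 nz less.prems poly_in_divisor by (metis mult_zero_left mult_zero_right)+
    then obtain b1 b2 q2 d2 where 2: "b = b1 * b2" "q1 = b1 * q2" "d1 = b2 * d2" "f = q2 * d2"
      using less.hyps[OF deg(2) in_S(2) nz(2), of f q1 d1] 1(4) by blast
    show ?thesis
      by (intro exI[of _ "a1 * b1"] exI[of _ "a2 * b2"] exI[of _ q2] exI[of _ d2])
         (simp add: 1 2 3(1) mult_ac)
  qed
qed

text \<open>The part of \<open>f\<close> that divides \<open>c\<close> is a factor of \<open>f\<close>. It is a unit, since the cofactor would
  otherwise be one and \<open>f\<close> would lie in the smaller ring together with \<open>c\<close>.\<close>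

lemma irreducible_dvd_cancel:
  assumes prime: "\<And>p. p \<in> poly_in S \<Longrightarrow> irreducible p \<Longrightarrow> prime_in T p"
    and "S \<subseteq> T" and f: "irreducible f" "f \<in> poly_in T" "f \<notin> poly_in S"
    and c: "c \<in> poly_in S" "c \<noteq> 0" and "w \<in> poly_in T" "f dvd c * w"
  shows "f dvd w"
proof -
  obtain k where k: "c * w = f * k" using assms(9) by (elim dvdE)
  have "f \<noteq> 0" using f(1) by auto
  have "k \<in> poly_in T"
    using k poly_in_divisor[of f k T] \<open>f \<noteq> 0\<close> poly_in_mult[of c T w] c assms(8) poly_in_mono[OF \<open>S \<subseteq> T\<close>] by auto
  then obtain c1 c2 f' k' where *: "c = c1 * c2" "f = c1 * f'" "k = c2 * k'" "w = f' * k'"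
    using poly_in_primal[OF prime \<open>S \<subseteq> T\<close> c k f(2)] by blast
  consider "c1 dvd 1" | "f' dvd 1" using f(1) *(2) irreducibleD by blast
  then show ?thesis
  proof cases
    case 1
    then obtain u where u: "1 = c1 * u" by (elim dvdE)
    have "w = f * (u * k')" using u *(2,4) by (metis mult.assoc mult.commute mult_1)
    then show ?thesis by simp
  next
    case 2
    have "c2 \<noteq> 0" using * c by auto
    then have "c1 \<in> poly_in S" using poly_in_divisor[of c2 c1 S] c * by (simp add: mult.commute)
    then have "f \<in> poly_in S" unfolding *(2) by (intro poly_in_mult polyfun_unit_const[OF 2])
    with f(3) show ?thesis by blast
  qed
qed

text \<open>Division with remainder with respect to \<open>z\<^sub>i\<close>: instead of dividing by the leading coefficient of \<open>d\<close>,
  one multiplies \<open>f\<close> by it before cancelling the leading terms.\<close>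

lemma pseudo_division_in:
  assumes "i \<notin> S" "d \<noteq> 0" "d \<in> poly_in (insert i S)" "f \<in> poly_in (insert i S)"
  shows "\<exists>c\<in>poly_in S. \<exists>q\<in>poly_in (insert i S). c \<noteq> 0 \<and>
           (c * f = q * d \<or> deg_in i (c * f - q * d) < deg_in i d)"
  using assms(4)
proof (induction "deg_in i f" arbitrary: f rule: less_induct)
  case less
  let ?R = "poly_in S" and ?R' = "poly_in (insert i S)"
  have sub: "?R \<subseteq> ?R'" "?R \<subseteq> poly_in (-{i})" using assms(1) by (auto intro!: poly_in_mono)
  show ?case
  proof (cases "deg_in i f < deg_in i d")
    case True
    then show ?thesis by (intro bexI[of _ 1] bexI[of _ 0]) auto
  next
    case False
    define F D where "F = expand_in i f" and "D = expand_in i d"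
    define m n where "m = degree F" and "n = degree D"
    have mn: "n \<le> m" using False by (simp add: m_def n_def F_def D_def deg_in_def)
    define a b where "a = lead_coeff F" and "b = lead_coeff D"
    have ab: "a \<in> ?R" "b \<in> ?R" "b \<noteq> 0"
      unfolding a_def b_def F_def D_def using assms less.prems by (auto intro: coeff_expand_in_poly_in)
    define t where "t = a * pf_var i ^ (m - n)"
    have t: "t \<in> ?R'" unfolding t_def using ab sub by (auto intro!: poly_in_intros)
    define f1 where "f1 = b * f - t * d"
    have f1: "f1 \<in> ?R'" unfolding f1_def using ab sub t less.prems assms by (auto intro!: poly_in_intros)
    have exp: "expand_in i f1 = smult b F - smult a (monom 1 (m - n) * D)"
      using ab sub unfolding f1_def t_def F_def D_def
      by (simp add: expand_in_diff expand_in_mult expand_in_free subset_iff expand_in_var_power)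
    have "degree (expand_in i f1) \<le> m"
      unfolding exp using mn
      by (intro degree_diff_le order.trans[OF degree_smult_le] order.trans[OF degree_mult_le])
         (auto simp: m_def n_def degree_monom_eq)
    moreover have "coeff (expand_in i f1) m = b * coeff F m - a * coeff D n"
      unfolding exp using mn by (simp add: coeff_monom_mult)
    then have "coeff (expand_in i f1) m = 0"
      by (simp add: a_def b_def m_def n_def mult.commute)
    ultimately have "expand_in i f1 = 0 \<or> degree (expand_in i f1) < m"
      by (rule eq_zero_or_degree_less)
    then have "\<exists>c\<in>?R. \<exists>q\<in>?R'. c \<noteq> 0 \<and> (c * f1 = q * d \<or> deg_in i (c * f1 - q * d) < deg_in i d)"
    proof
      assume "expand_in i f1 = 0"
      then show ?thesis by (intro bexI[of _ 1] bexI[of _ 0]) auto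
    next
      assume "degree (expand_in i f1) < m"
      then show ?thesis using less.hyps[of f1] f1 by (simp add: m_def F_def deg_in_def)
    qed
    then obtain c q where cq: "c \<in> ?R" "q \<in> ?R'" "c \<noteq> 0"
        "c * f1 = q * d \<or> deg_in i (c * f1 - q * d) < deg_in i d" by blast
    have "c * f1 - q * d = (c * b) * f - (q + c * t) * d"
      unfolding f1_def by (simp add: algebra_simps)
    then show ?thesis using cq ab t sub
      by (intro bexI[of _ "c * b"] bexI[of _ "q + c * t"]) (auto intro!: poly_in_intros)
  qed
qed

text \<open>Bezout up to a denominator: \<open>d\<close> is an element of lowest degree in \<open>z\<^sub>i\<close> of the ideal generated by
  \<open>f\<close> and \<open>g\<close>, so the remainders of pseudo-division of \<open>f\<close> and \<open>g\<close> by \<open>d\<close> vanish.\<close>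

lemma bezout_in:
  assumes "i \<notin> S" "f \<noteq> 0" "f \<in> poly_in (insert i S)" "g \<in> poly_in (insert i S)"
  obtains u v d where "u \<in> poly_in (insert i S)" "v \<in> poly_in (insert i S)" "d = u * f + v * g" "d \<noteq> 0"
    "\<exists>c\<in>poly_in S. \<exists>q\<in>poly_in (insert i S). c \<noteq> 0 \<and> c * f = q * d"
    "\<exists>c\<in>poly_in S. \<exists>q\<in>poly_in (insert i S). c \<noteq> 0 \<and> c * g = q * d"
proof -
  let ?R = "poly_in S" and ?R' = "poly_in (insert i S)"
  have sub: "?R \<subseteq> ?R'" by (auto intro!: poly_in_mono)
  define I where "I = {u * f + v * g |u v. u \<in> ?R' \<and> v \<in> ?R'}"
  have fI: "f \<in> I" unfolding I_def mem_Collect_eq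
    by (rule exI[of _ 1], rule exI[of _ 0]) simp
  have gI: "g \<in> I" unfolding I_def mem_Collect_eq
    by (rule exI[of _ 0], rule exI[of _ 1]) simp
  have I_lin: "c * w - q * d \<in> I" if "w \<in> I" "d \<in> I" "c \<in> ?R'" "q \<in> ?R'" for c w q d
  proof -
    obtain u v u' v' where "w = u * f + v * g" "d = u' * f + v' * g" and in_R: "u \<in> ?R'" "v \<in> ?R'" "u' \<in> ?R'" "v' \<in> ?R'"
      using \<open>w \<in> I\<close> \<open>d \<in> I\<close> unfolding I_def by blast
    then have "c * w - q * d = (c * u - q * u') * f + (c * v - q * v') * g" by (simp add: algebra_simps)
    then show ?thesis unfolding I_def using in_R that(3,4) by (auto intro!: poly_in_intros)
  qed
  have I_sub: "I \<subseteq> ?R'" unfolding I_def using assms by (auto intro!: poly_in_intros)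
  have "\<exists>d. (d \<in> I \<and> d \<noteq> 0) \<and> (\<forall>w. w \<in> I \<and> w \<noteq> 0 \<longrightarrow> deg_in i d \<le> deg_in i w)"
    by (rule ex_has_least_nat) (use fI assms(2) in simp)
  then obtain d where d: "d \<in> I" "d \<noteq> 0" and min: "\<And>w. w \<in> I \<Longrightarrow> w \<noteq> 0 \<Longrightarrow> deg_in i d \<le> deg_in i w"
    by auto
  have div: "\<exists>c\<in>?R. \<exists>q\<in>?R'. c \<noteq> 0 \<and> c * w = q * d" if w: "w \<in> I" for w
  proof -
    obtain c q where cq: "c \<in> ?R" "q \<in> ?R'" "c \<noteq> 0" "c * w = q * d \<or> deg_in i (c * w - q * d) < deg_in i d"
      using pseudo_division_in[OF assms(1) d(2) subsetD[OF I_sub d(1)] subsetD[OF I_sub w]] by auto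
    have "c * w - q * d \<in> I" using I_lin[OF w d(1)] cq sub by blast
    then have "c * w = q * d" using min[of "c * w - q * d"] cq(4) by (metis leD right_minus_eq)
    then show ?thesis using cq by blast
  qed
  obtain u v where "u \<in> ?R'" "v \<in> ?R'" "d = u * f + v * g" using d(1) unfolding I_def by blast
  then show ?thesis by (rule that[OF _ _ _ d(2) div[OF fI] div[OF gI]])
qed

text \<open>If \<open>f\<close> involves the new variable and divides \<open>g h\<close>, the Bezout element \<open>d\<close> of \<open>f\<close> and \<open>g\<close> satisfies
  \<open>c f = q d\<close> with a constant \<open>c\<close> of the smaller ring. After distribution of \<open>c\<close>, irreducibility leaves
  two cases: either \<open>f\<close> divides \<open>d\<close> and hence \<open>g\<close> up to a constant, or \<open>d\<close> is a constant and \<open>f\<close>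
  divides \<open>d h\<close>.\<close>

lemma irreducible_imp_prime_in:
  assumes "finite S" "f \<in> poly_in S" "irreducible f"
  shows "prime_in S f"
  using assms
proof (induction S arbitrary: f rule: finite_induct)
  case empty
  then have "f = pf_const (pf_eval f 0)" by (blast intro: poly_in_emptyD)
  moreover have "pf_eval f 0 \<noteq> 0"
  proof
    assume "pf_eval f 0 = 0"
    then have "f = 0" using calculation by (intro polyfun_eqI) (metis pf_eval_const pf_eval_simps(1))
    with empty.prems(2) show False by simp
  qed
  ultimately have "f dvd 1" by (metis pf_const_dvd_1)
  then show ?case using empty.prems(2) irreducible_not_unit by blast
next
  case (insert i S)
  let ?R = "poly_in S" and ?R' = "poly_in (insert i S)"
  have sub: "?R \<subseteq> ?R'" by (auto intro!: poly_in_mono)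
  have prime: "prime_in (insert i S) p" if "p \<in> ?R" "irreducible p" for p
    using prime_in_insert insert that by blast
  note cancel = irreducible_dvd_cancel[OF prime subset_insertI insert.prems(2,1)]
  show ?case
  proof (cases "f \<in> ?R")
    case True
    then show ?thesis using prime insert.prems by blast
  next
    case False
    note cancel = cancel[OF _ _ False]
    show ?thesis unfolding prime_in_def
    proof (intro conjI ballI impI)
      show "f \<noteq> 0" "\<not> f dvd 1" using insert.prems irreducible_not_unit by auto
      fix g h assume gh: "g \<in> ?R'" "h \<in> ?R'" "f dvd g * h"
      obtain u v d where d: "u \<in> ?R'" "v \<in> ?R'" "d = u * f + v * g" "d \<noteq> 0"
        and cf: "\<exists>c\<in>?R. \<exists>q\<in>?R'. c \<noteq> 0 \<and> c * f = q * d"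
        and cg: "\<exists>c\<in>?R. \<exists>q\<in>?R'. c \<noteq> 0 \<and> c * g = q * d"
        by (rule bezout_in[OF insert.hyps(2) \<open>f \<noteq> 0\<close> insert.prems(1) gh(1)], rule that)
      have dR': "d \<in> ?R'" unfolding d(3) using d(1,2) insert.prems(1) gh by (intro poly_in_intros)
      obtain c q where c: "c \<in> ?R" "q \<in> ?R'" "c \<noteq> 0" "c * f = q * d" using cf by blast
      obtain c1 c2 q' d' where 1: "c = c1 * c2" "q = c1 * q'" "d = c2 * d'" "f = q' * d'"
        using poly_in_primal[OF prime subset_insertI c(1,3,4,2) dR'] by blast
      consider "q' dvd 1" | "d' dvd 1" using insert.prems(2) 1(4) irreducibleD by blast
      then show "f dvd g \<or> f dvd h"
      proof cases
        case 1
        then obtain w where "1 = q' * w" by (elim dvdE)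
        then have "d = f * (w * c2)" using \<open>d = c2 * d'\<close> \<open>f = q' * d'\<close>
          by (metis mult.assoc mult.commute mult_1)
        then have "f dvd d" by simp
        obtain c' q2 where c': "c' \<in> ?R" "c' \<noteq> 0" "c' * g = q2 * d" using cg by blast
        have "f dvd c' * g" unfolding c'(3) using \<open>f dvd d\<close> by simp
        then show ?thesis using cancel c' gh(1) by blast
      next
        case 2
        have "c1 \<noteq> 0" using 1 c by auto
        then have "c2 \<in> ?R" using poly_in_divisor[of c1 c2 S] c 1 by simp
        then have "d \<in> ?R" unfolding 1(3) by (intro poly_in_mult polyfun_unit_const[OF 2])
        have "d * h = f * (u * h) + v * (g * h)" unfolding d(3) by (simp add: algebra_simps)
        then have "f dvd d * h" using gh(3) by auto
        then show ?thesis using cancel \<open>d \<in> ?R\<close> d(4) gh(2) by blast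
      qed
    qed
  qed
qed

text \<open>Prime factorization as a proof principle: \<open>X\<close> is passed on from a product to one of its factors until
  an irreducible factor is reached, and that factor is prime.\<close>

lemma exists_prime_divisor:
  fixes f :: "'n::finite polyfun"
  assumes split: "\<And>a b. X (a * b) \<Longrightarrow> X a \<or> X b" and unit: "\<And>u. u dvd 1 \<Longrightarrow> \<not> X u"
    and "f \<noteq> 0" "X f"
  shows "\<exists>g. prime_elem g \<and> g dvd f \<and> X g"
  using assms(3,4)
proof (induction "sum_deg f" arbitrary: f rule: less_induct)
  case less
  show ?case
  proof (cases "irreducible f")
    case True
    have "prime_in UNIV f" by (rule irreducible_imp_prime_in) (use True in auto)
    then have "prime_elem f" unfolding prime_in_def prime_elem_def by auto
    then show ?thesis using less.prems by (intro exI[of _ f]) simp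
  next
    case False
    then obtain a b where ab: "f = a * b" "\<not> a dvd 1" "\<not> b dvd 1"
      using less.prems unit unfolding irreducible_def by blast
    have nz: "a \<noteq> 0" "b \<noteq> 0" using less.prems ab by auto
    have "sum_deg a < sum_deg f" "sum_deg b < sum_deg f"
      using ab nz sum_deg_mult[OF nz] polyfun_dvd_1_iff[of a] polyfun_dvd_1_iff[of b] by auto
    moreover have "X a \<or> X b" using split[of a b] less.prems(2) ab(1) by simp
    ultimately have "\<exists>g. prime_elem g \<and> (g dvd a \<or> g dvd b) \<and> X g"
      using less.hyps[of a] less.hyps[of b] nz by auto
    then show ?thesis unfolding ab(1) by (auto intro: dvd_mult dvd_mult2)
  qed
qed

section \<open>Zero sets of prime polynomials\<close>

lemma pf_compose_ex: "\<exists>g. \<forall>z. pf_eval g z = pf_eval f (\<chi> i. pf_eval (h i) z)"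
proof -
  obtain K c where K: "finite K" "\<And>z. pf_eval f z = (\<Sum>m\<in>K. c m * (\<Prod>j\<in>UNIV. (z $ j) ^ m j))"
    using polyfun_expansion[of f] by blast
  show ?thesis
    by (rule exI[of _ "\<Sum>m\<in>K. pf_const (c m) * (\<Prod>j\<in>UNIV. h j ^ m j)"])
       (simp add: K pf_eval_sum pf_eval_prod)
qed

definition pf_compose :: "'n::finite polyfun \<Rightarrow> ('n \<Rightarrow> 'm::finite polyfun) \<Rightarrow> 'm polyfun" where
  "pf_compose f h = (SOME g. \<forall>z. pf_eval g z = pf_eval f (\<chi> i. pf_eval (h i) z))"

lemma pf_eval_compose [simp]: "pf_eval (pf_compose f h) z = pf_eval f (\<chi> i. pf_eval (h i) z)"
  using someI_ex[OF pf_compose_ex[of f h]] unfolding pf_compose_def by blast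

lemma pf_compose_mult: "pf_compose (f * g) h = pf_compose f h * pf_compose g h"
  by (rule polyfun_eqI) simp

lemma pf_compose_dvd: "f dvd g \<Longrightarrow> pf_compose f h dvd pf_compose g h"
  by (metis dvdE dvdI pf_compose_mult)

lemma pf_compose_1: "pf_compose 1 h = 1"
  by (rule polyfun_eqI) simp

lemma continuous_on_pf_eval [continuous_intros]:
  fixes f :: "'n::finite polyfun"
  assumes "continuous_on S g"
  shows "continuous_on S (\<lambda>x. pf_eval f (g x))"
proof -
  obtain K c where K: "finite K" "\<And>z. pf_eval f z = (\<Sum>m\<in>K. c m * (\<Prod>j\<in>UNIV. (z $ j) ^ m j))"
    using polyfun_expansion[of f] by blast
  show ?thesis unfolding K(2) by (intro continuous_intros assms)
qed

lemma continuous_on_vector_smult [continuous_intros]: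
  fixes f :: "'a::topological_space \<Rightarrow> complex" and g :: "'a \<Rightarrow> complex ^ 'n::finite"
  assumes "continuous_on S f" "continuous_on S g"
  shows "continuous_on S (\<lambda>x. f x *s g x)"
  unfolding vector_scalar_mult_def by (intro continuous_intros assms)

lemma nonzero_poly_nonvanishing_nearby:
  fixes P :: "complex poly"
  assumes "P \<noteq> 0" "e > 0"
  obtains r where "0 < r" "r < e" "\<And>t. t \<noteq> 0 \<Longrightarrow> norm t \<le> r \<Longrightarrow> poly P t \<noteq> 0"
proof -
  have "finite {t. poly P t = 0}" using assms(1) by (rule poly_roots_finite)
  then obtain d where d: "d > 0" "\<forall>t\<in>{t. poly P t = 0}. t \<noteq> 0 \<longrightarrow> d \<le> dist 0 t"
    using finite_set_avoid[of "{t. poly P t = 0}" 0] by blast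
  show ?thesis
  proof (rule that[of "min (d / 2) (e / 2)"])
    fix t :: complex assume "t \<noteq> 0" "norm t \<le> min (d / 2) (e / 2)"
    then show "poly P t \<noteq> 0" using d by force
  qed (use d assms in auto)
qed

text \<open>On a line from a point of \<open>U\<close> to a point where \<open>f\<close> does not vanish, \<open>f\<close> has only finitely many zeros.\<close>

lemma polyfun_nonvanishing_dense:
  assumes "f \<noteq> 0" "open U" "U \<noteq> {}"
  obtains z where "z \<in> U" "pf_eval f z \<noteq> 0"
proof -
  obtain z0 where z0: "z0 \<in> U" using assms by blast
  obtain z1 where z1: "pf_eval f z1 \<noteq> 0" using polyfun_nonzeroE[OF assms(1)] .
  obtain P where P: "\<And>t. pf_eval f (z0 + t *s (z1 - z0)) = poly P t"
    using pf_eval_line[of f z0 "z1 - z0"] by blast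
  have "poly P 1 \<noteq> 0" using P[of 1] z1 by simp
  then have "P \<noteq> 0" by auto
  have "open ((\<lambda>t. z0 + t *s (z1 - z0)) -` U)"
    by (rule open_vimage[OF assms(2)]) (intro continuous_intros)
  moreover have "0 \<in> (\<lambda>t. z0 + t *s (z1 - z0)) -` U" using z0 by simp
  ultimately obtain e where e: "e > 0" "ball 0 e \<subseteq> (\<lambda>t. z0 + t *s (z1 - z0)) -` U"
    using open_contains_ball by blast
  obtain r where r: "0 < r" "r < e" "\<And>t. t \<noteq> 0 \<Longrightarrow> norm t \<le> r \<Longrightarrow> poly P t \<noteq> 0"
    by (rule nonzero_poly_nonvanishing_nearby[OF \<open>P \<noteq> 0\<close> e(1)], rule that)
  show ?thesis
  proof (rule that)
    show "z0 + of_real r *s (z1 - z0) \<in> U" using e(2) r by (auto simp: subset_iff dist_norm)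
    show "pf_eval f (z0 + of_real r *s (z1 - z0)) \<noteq> 0" unfolding P using r by simp
  qed
qed

text \<open>If \<open>f\<close> had no zero on the small disc in direction \<open>u\<close> through a nearby point, \<open>1/f\<close> would violate the
  maximum principle there: it is bounded on the circle but large at the centre.\<close>

lemma zero_on_nearby_parallel_lines:
  assumes "pf_eval f z0 = 0" "pf_eval f (z0 + s *s u) \<noteq> 0" "open U" "z0 \<in> U"
  obtains V where "open V" "z0 \<in> V" "\<And>z. z \<in> V \<Longrightarrow> \<exists>t. z + t *s u \<in> U \<and> pf_eval f (z + t *s u) = 0"
proof -
  obtain P where P: "\<And>t. pf_eval f (z0 + t *s u) = poly P t"
    using pf_eval_line[of f z0 u] by blast
  have "P \<noteq> 0" using assms(2) P by auto
  have "open ((\<lambda>(z, t). z + t *s u) -` U)"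
    by (rule open_vimage[OF assms(3)]) (auto intro!: continuous_intros simp: case_prod_unfold)
  moreover have "(z0, 0) \<in> (\<lambda>(z, t). z + t *s u) -` U" using assms(4) by simp
  ultimately obtain A B where AB: "open A" "open B" "(z0, 0) \<in> A \<times> B" "A \<times> B \<subseteq> (\<lambda>(z, t). z + t *s u) -` U"
    by (rule open_prod_elim)
  obtain e where e: "e > 0" "ball 0 e \<subseteq> B" using AB open_contains_ball by blast
  obtain r where r: "0 < r" "r < e" "\<And>t. t \<noteq> 0 \<Longrightarrow> norm t \<le> r \<Longrightarrow> poly P t \<noteq> 0"
    by (rule nonzero_poly_nonvanishing_nearby[OF \<open>P \<noteq> 0\<close> e(1)], rule that)
  define h where "h z t = pf_eval f (z + t *s u)" for z t
  have "\<exists>t0\<in>sphere 0 r. \<forall>t\<in>sphere 0 r. norm (h z0 t0) \<le> norm (h z0 t)"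
    unfolding h_def
    by (rule continuous_attains_inf) (use r in \<open>auto intro!: continuous_intros\<close>)
  then obtain t0 where t0: "norm t0 = r" "\<And>t. norm t = r \<Longrightarrow> norm (h z0 t0) \<le> norm (h z0 t)" by auto
  \<comment> \<open>On the circle of radius r, |h z0| is at least m; near z0 it is at least m/2, while |h z 0| is smaller.\<close>
  define m where "m = norm (h z0 t0)"
  have "m > 0" unfolding m_def h_def P using r(1,3) t0(1) by auto
  have "uniformly_continuous_on (cball z0 1 \<times> cball 0 r) (\<lambda>(z, t). h z t)"
    unfolding h_def
    by (rule compact_uniformly_continuous) (auto intro!: continuous_intros compact_Times simp: case_prod_unfold)
  then obtain d where d: "d > 0" "\<And>p p'. p \<in> cball z0 1 \<times> cball 0 r \<Longrightarrow> p' \<in> cball z0 1 \<times> cball 0 r \<Longrightarrow>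
      dist p' p < d \<Longrightarrow> dist (case p' of (z, t) \<Rightarrow> h z t) (case p of (z, t) \<Rightarrow> h z t) < m / 2"
    using \<open>m > 0\<close> unfolding uniformly_continuous_on_def by (metis half_gt_zero)
  have close: "dist (h z t) (h z0 t) < m / 2" if "dist z z0 < min 1 d" "norm t \<le> r" for z t
    using d(2)[of "(z0, t)" "(z, t)"] that by (auto simp: dist_Pair_Pair dist_commute)
  show ?thesis
  proof (rule that[of "A \<inter> ball z0 (min 1 d)"])
    show "open (A \<inter> ball z0 (min 1 d))" "z0 \<in> A \<inter> ball z0 (min 1 d)" using AB d by auto
    fix z assume z: "z \<in> A \<inter> ball z0 (min 1 d)"
    then have dz: "dist z z0 < min 1 d" by (simp add: dist_commute)
    have "\<exists>t\<in>cball 0 r. h z t = 0"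
    proof (rule ccontr)
      assume "\<not> ?thesis"
      then have nz: "\<And>t. t \<in> cball 0 r \<Longrightarrow> h z t \<noteq> 0" by blast
      obtain Q where Q: "\<And>t. h z t = poly Q t"
        unfolding h_def using pf_eval_line[of f z u] by blast
      have "norm (inverse (h z 0)) \<le> 2 / m"
      proof (rule maximum_modulus_frontier[where S = "cball 0 r" and f = "\<lambda>t. inverse (h z t)"])
        show "(\<lambda>t. inverse (h z t)) holomorphic_on interior (cball 0 r)"
          using nz unfolding Q by (intro holomorphic_intros) auto
        show "continuous_on (closure (cball 0 r)) (\<lambda>t. inverse (h z t))"
          using nz unfolding Q by (intro continuous_intros) auto
        fix t :: complex assume "t \<in> frontier (cball 0 r)"
        then have t: "norm t = r" using r by (simp add: frontier_cball)
        then have "m \<le> norm (h z0 t)" unfolding m_def by (rule t0(2))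
        moreover have "dist (h z t) (h z0 t) < m / 2" using close[OF dz] t by simp
        then have "norm (h z0 t) < norm (h z t) + m / 2"
          using norm_triangle_ineq2[of "h z0 t" "h z t"] by (simp add: dist_norm norm_minus_commute)
        ultimately have "m / 2 \<le> norm (h z t)" by linarith
        then have "inverse (norm (h z t)) \<le> inverse (m / 2)" using \<open>m > 0\<close> by (intro le_imp_inverse_le) auto
        then show "norm (inverse (h z t)) \<le> 2 / m" by (simp add: norm_inverse)
      qed (use r in auto)
      moreover have "norm (h z 0) < m / 2"
        using close[OF dz, of 0] r assms(1) by (simp add: h_def)
      moreover have "h z 0 \<noteq> 0" using nz[of 0] r by simp
      ultimately show False using \<open>m > 0\<close> by (simp add: norm_inverse norm_divide field_simps)
    qed
    then obtain t where t: "norm t \<le> r" "h z t = 0" by auto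
    then have "t \<in> B" using e(2) r(2) by (auto simp: subset_iff dist_norm)
    then have "z + t *s u \<in> U" using AB(4) z by auto
    then show "\<exists>t. z + t *s u \<in> U \<and> pf_eval f (z + t *s u) = 0" using t(2) by (auto simp: h_def)
  qed
qed

text \<open>The zeros of \<open>g\<close> near \<open>z\<^sub>0\<close> project onto a neighbourhood in the variables other than \<open>z\<^sub>i\<close>, because \<open>g\<close> does
  not vanish on the line through \<open>z\<^sub>0\<close> parallel to the \<open>i\<close>-axis. A Bezout element \<open>d = u g + v b\<close>, which is
  free of \<open>z\<^sub>i\<close> because \<open>g\<close> is prime, would vanish at all of these projections if \<open>b\<close> vanished at the zeros
  of \<open>g\<close>.\<close>

lemma prime_zeros_not_contained_axis:
  fixes g b :: "'n::finite polyfun"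
  assumes prime: "prime_elem g" and "\<not> g dvd b" and z0: "pf_eval g z0 = 0" "pf_eval g (z0 + s *s axis i 1) \<noteq> 0"
    and U: "open U" "z0 \<in> U"
  shows "\<exists>z\<in>U. pf_eval g z = 0 \<and> pf_eval b z \<noteq> 0"
proof (rule ccontr)
  assume neg: "\<not> ?thesis"
  let ?R = "poly_in (-{i})"
  have ins: "insert i (-{i}) = (UNIV :: 'n set)" by auto
  have R_line: "pf_eval f (z + t *s axis i 1) = pf_eval f z" if "f \<in> ?R" for f t and z :: "complex ^ 'n"
    by (rule poly_inD[OF that]) (auto simp: axis_def)
  have "g \<noteq> 0" using prime by auto
  have gR: "g \<notin> ?R" using R_line[of g z0 s] z0 by auto
  obtain u v d where d: "d = u * g + v * b" "d \<noteq> 0"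
    and cg: "\<exists>c\<in>?R. \<exists>q\<in>poly_in (insert i (-{i})). c \<noteq> 0 \<and> c * g = q * d"
    and cb: "\<exists>c\<in>?R. \<exists>q\<in>poly_in (insert i (-{i})). c \<noteq> 0 \<and> c * b = q * d"
    by (rule bezout_in[of i "-{i}" g b]) (use \<open>g \<noteq> 0\<close> ins in auto)
  obtain c q where c: "c \<in> ?R" "c \<noteq> 0" "c * g = q * d" using cg by blast
  have "g dvd q * d" unfolding c(3)[symmetric] by simp
  then consider "g dvd q" | "g dvd d" using prime prime_elem_dvd_mult_iff by blast
  then show False
  proof cases
    case 1
    then obtain k where k: "q = g * k" by (elim dvdE)
    have "g * c = g * (k * d)" using c(3) k by (simp add: mult_ac)
    then have "c = k * d" using \<open>g \<noteq> 0\<close> by simp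
    then have dR: "d \<in> ?R" using c poly_in_divisor[of k d "-{i}"] by auto
    obtain V where V: "open V" "z0 \<in> V"
        "\<And>z. z \<in> V \<Longrightarrow> \<exists>t. z + t *s axis i 1 \<in> U \<and> pf_eval g (z + t *s axis i 1) = 0"
      by (rule zero_on_nearby_parallel_lines[OF z0 U], rule that)
    obtain z where z: "z \<in> V" "pf_eval d z \<noteq> 0"
      using polyfun_nonvanishing_dense[OF d(2) V(1)] V(2) by blast
    obtain t where t: "z + t *s axis i 1 \<in> U" "pf_eval g (z + t *s axis i 1) = 0" using V(3)[OF z(1)] by blast
    then have "pf_eval b (z + t *s axis i 1) = 0" using neg by blast
    then have "pf_eval d (z + t *s axis i 1) = 0" using t d(1) by simp
    then show False using R_line[OF dR] z by simp
  next
    case 2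
    obtain c' q' where c': "c' \<in> ?R" "c' \<noteq> 0" "c' * b = q' * d" using cb by blast
    have "g dvd c' * b" unfolding c'(3) using 2 by simp
    then have "g dvd c'" using prime assms(2) prime_elem_dvd_mult_iff by blast
    then obtain k where "c' = k * g" by (metis dvdE mult.commute)
    then have "g \<in> ?R" using poly_in_divisor[of k g "-{i}"] c' by auto
    with gR show False by blast
  qed
qed

lemma prime_elem_compose:
  assumes "prime_elem g" and inv: "\<And>f. pf_compose (pf_compose f h) h' = f" "\<And>f. pf_compose (pf_compose f h') h = f"
  shows "prime_elem (pf_compose g h)"
  unfolding prime_elem_def
proof (intro conjI allI impI)
  have reflect: "x dvd y" if "pf_compose x h dvd pf_compose y h" for x y
    using pf_compose_dvd[OF that, of h'] inv by simp
  show "pf_compose g h \<noteq> 0"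
  proof
    assume "pf_compose g h = 0"
    then have "pf_compose (pf_compose g h) h' = 0" by (intro polyfun_eqI) simp
    with inv assms(1) show False by auto
  qed
  show "\<not> pf_compose g h dvd 1" using reflect[of g 1] assms(1) prime_elem_not_unit by (auto simp: pf_compose_1)
  fix a b assume "pf_compose g h dvd a * b"
  then have "g dvd pf_compose a h' * pf_compose b h'"
    using pf_compose_dvd[of "pf_compose g h" "a * b" h'] inv by (simp add: pf_compose_mult)
  then have "g dvd pf_compose a h' \<or> g dvd pf_compose b h'"
    using assms(1) prime_elem_dvd_mult_iff by blast
  then show "pf_compose g h dvd a \<or> pf_compose g h dvd b"
    using pf_compose_dvd[of g _ h] inv by metis
qed

text \<open>Study's lemma in local form. A shear, under which primes stay prime, makes a line on which \<open>g\<close> does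
  not vanish parallel to a coordinate axis.\<close>

lemma prime_zeros_not_contained:
  fixes g b :: "'n::finite polyfun"
  assumes prime: "prime_elem g" and b: "\<not> g dvd b" and z0: "pf_eval g z0 = 0" and U: "open U" "z0 \<in> U"
  shows "\<exists>z\<in>U. pf_eval g z = 0 \<and> pf_eval b z \<noteq> 0"
proof -
  \<comment> \<open>Any coordinate will do; the direction u is chosen with u $ i = 1.\<close>
  obtain i :: 'n where True by simp
  have "g \<noteq> 0" using prime by auto
  have "pf_var i - pf_const (z0 $ i) \<noteq> (0 :: 'n polyfun)"
  proof
    assume "pf_var i - pf_const (z0 $ i) = (0 :: 'n polyfun)"
    then have "pf_eval (pf_var i - pf_const (z0 $ i)) (\<chi> j. z0 $ i + 1) = 0" by simp
    then show False by simp
  qed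
  with \<open>g \<noteq> 0\<close> have "g * (pf_var i - pf_const (z0 $ i)) \<noteq> 0" by simp
  then obtain z1 where z1: "pf_eval g z1 \<noteq> 0" "z1 $ i \<noteq> z0 $ i"
    by (rule polyfun_nonzeroE) auto
  define s where "s = z1 $ i - z0 $ i"
  define u where "u = inverse s *s (z1 - z0)"
  have "s \<noteq> 0" using z1 by (simp add: s_def)
  have u: "u $ i = 1" "z0 + s *s u = z1" using \<open>s \<noteq> 0\<close> by (simp_all add: u_def vec_eq_iff s_def flip: right_diff_distrib)
  define w where "w = u - axis i 1"
  have wi: "w $ i = 0" using u by (simp add: w_def)
  define L where "L z = z + z $ i *s w" for z :: "complex ^ 'n"
  define L' where "L' z = z - z $ i *s w" for z :: "complex ^ 'n"
  have LL': "L (L' z) = z" "L' (L z) = z" for z by (simp_all add: L_def L'_def wi vec_eq_iff)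
  define h where "h j = pf_var j + pf_var i * pf_const (w $ j)" for j
  define h' where "h' j = pf_var j - pf_var i * pf_const (w $ j)" for j
  have h: "(\<chi> j. pf_eval (h j) z) = L z" "(\<chi> j. pf_eval (h' j) z) = L' z" for z
    by (simp_all add: h_def h'_def L_def L'_def vec_eq_iff)
  have inv: "pf_compose (pf_compose f h) h' = f" "pf_compose (pf_compose f h') h = f" for f
    by (rule polyfun_eqI; simp add: h LL')+
  have "\<exists>z\<in>L -` U. pf_eval (pf_compose g h) z = 0 \<and> pf_eval (pf_compose b h) z \<noteq> 0"
  proof (rule prime_zeros_not_contained_axis)
    show "prime_elem (pf_compose g h)" by (rule prime_elem_compose[OF prime inv])
    show "\<not> pf_compose g h dvd pf_compose b h"
      using pf_compose_dvd[of "pf_compose g h" "pf_compose b h" h'] inv b by auto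
    show "pf_eval (pf_compose g h) (L' z0) = 0" using z0 by (simp add: h LL')
    have "L (L' z0 + s *s axis i 1) = z0 + s *s u"
      using u(1) by (simp add: L_def L'_def w_def vec_eq_iff axis_def algebra_simps)
    then show "pf_eval (pf_compose g h) (L' z0 + s *s axis i 1) \<noteq> 0" using u z1 by (simp add: h)
    show "open (L -` U)" by (rule open_vimage[OF U(1)]) (unfold L_def, intro continuous_intros)
    show "L' z0 \<in> L -` U" using U(2) LL' by simp
  qed
  then show ?thesis by (auto simp: h)
qed

text \<open>Coprimality in the form in which Study's lemma consumes it.\<close>

definition no_common_prime :: "'n::finite polyfun \<Rightarrow> 'n polyfun \<Rightarrow> bool" where
  "no_common_prime a b \<longleftrightarrow> (\<forall>g. prime_elem g \<longrightarrow> g dvd a \<longrightarrow> \<not> g dvd b)"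

lemma pf_prime_zero_divisor:
  assumes "f \<noteq> 0" "pf_eval f z = 0"
  obtains g where "prime_elem g" "g dvd f" "pf_eval g z = 0"
proof -
  have "\<exists>g. prime_elem g \<and> g dvd f \<and> pf_eval g z = 0"
    by (rule exists_prime_divisor) (use assms polyfun_unit_eval in auto)
  then show ?thesis using that by blast
qed

text \<open>A prime factor of \<open>b\<close> that vanishes at \<open>z\<close> does not divide \<open>a\<close>, so by Study's lemma \<open>a\<close> is nonzero at
  some of its zeros in \<open>U\<close>.\<close>

lemma coprime_zeros_not_locally_contained:
  assumes "no_common_prime a b" "b \<noteq> 0" "open U" "\<And>z. z \<in> U \<Longrightarrow> pf_eval b z = 0 \<Longrightarrow> pf_eval a z = 0"
    and "z \<in> U"
  shows "pf_eval b z \<noteq> 0"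
proof
  assume "pf_eval b z = 0"
  then obtain g where g: "prime_elem g" "g dvd b" "pf_eval g z = 0"
    using pf_prime_zero_divisor assms(2) by blast
  then have "\<not> g dvd a" using assms(1) unfolding no_common_prime_def by blast
  then obtain w where w: "w \<in> U" "pf_eval g w = 0" "pf_eval a w \<noteq> 0"
    using prime_zeros_not_contained[OF g(1) _ g(3) assms(3,5)] by blast
  obtain k where "b = g * k" using g(2) by (elim dvdE)
  then have "pf_eval b w = 0" using w by simp
  with assms(4) w show False by blast
qed

lemma cpoly_coprime_no_common_prime:
  assumes "cpoly_coprime a b"
  shows "no_common_prime (of_cpoly a) (of_cpoly b)"
  unfolding no_common_prime_def
proof (intro allI impI notI)
  fix g assume g: "prime_elem g" "g dvd of_cpoly a" "g dvd of_cpoly b"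
  obtain c where c: "g = of_cpoly c" using of_cpoly_surj by blast
  have dvd: "c dvd x" if dvd_x: "g dvd of_cpoly x" for x
  proof -
    obtain k where k: "of_cpoly x = g * k" using dvd_x by (elim dvdE)
    obtain k' where "k = of_cpoly k'" using of_cpoly_surj by blast
    then have "of_cpoly x = of_cpoly (c * k')" using k c by simp
    then show "c dvd x" by (simp only: of_cpoly_inject dvd_triv_left)
  qed
  have "c dvd 1" using assms dvd[OF g(2)] dvd[OF g(3)] unfolding cpoly_coprime_def by blast
  then obtain k where "1 = c * k" by (elim dvdE)
  then have "of_cpoly 1 = g * of_cpoly k" using c of_cpoly_hom(5)[of c k] by (simp del: of_cpoly_hom(2,5))
  then have "g dvd 1" by (metis dvdI of_cpoly_hom(2))
  with g(1) show False using prime_elem_not_unit by blast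
qed

section \<open>Irreducible components of a hypersurface\<close>

lemma algebraic_set_cpoly_zeros: "algebraic_set (cpoly_zeros p)"
  unfolding algebraic_set_def by (rule exI[of _ "{p}"]) simp

lemma algebraic_set_Int: "algebraic_set A \<Longrightarrow> algebraic_set B \<Longrightarrow> algebraic_set (A \<inter> B)"
  unfolding algebraic_set_def by (metis INT_Un finite_UnI)

lemma algebraic_set_separating:
  assumes "algebraic_set B" "z \<notin> B"
  obtains p where "cpoly_eval p z \<noteq> 0" "\<And>w. w \<in> B \<Longrightarrow> cpoly_eval p w = 0"
  using assms unfolding algebraic_set_def cpoly_zeros_def by blast

text \<open>Polynomials that separate points of the zero set from two proper closed pieces are not divisible
  by \<open>g\<close>, nor is their product; so by Study's lemma the product is nonzero somewhere on the zero set.\<close>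

lemma prime_zeros_irreducible:
  assumes "prime_elem (of_cpoly g)" "cpoly_zeros g \<noteq> {}"
  shows "irreducible_algebraic (cpoly_zeros g)"
  unfolding irreducible_algebraic_def
proof (intro conjI allI impI)
  fix B C assume BC: "algebraic_set B" "algebraic_set C" "cpoly_zeros g = B \<union> C"
  show "B = cpoly_zeros g \<or> C = cpoly_zeros g"
  proof (rule ccontr)
    assume "\<not> ?thesis"
    then obtain z w where zw: "z \<in> cpoly_zeros g" "z \<notin> B" "w \<in> cpoly_zeros g" "w \<notin> C"
      using BC(3) by blast
    obtain p where p: "cpoly_eval p z \<noteq> 0" "\<And>x. x \<in> B \<Longrightarrow> cpoly_eval p x = 0"
      using algebraic_set_separating[OF BC(1) zw(2)] by blast
    obtain q where q: "cpoly_eval q w \<noteq> 0" "\<And>x. x \<in> C \<Longrightarrow> cpoly_eval q x = 0"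
      using algebraic_set_separating[OF BC(2) zw(4)] by blast
    have not_dvd: "\<not> of_cpoly g dvd of_cpoly r" if nz: "cpoly_eval r x \<noteq> 0" "x \<in> cpoly_zeros g" for r x
    proof
      assume "of_cpoly g dvd of_cpoly r"
      then obtain k where "of_cpoly r = of_cpoly g * k" by (elim dvdE)
      then have "pf_eval (of_cpoly r) x = pf_eval (of_cpoly g * k) x" by simp
      then show False using nz by (simp add: cpoly_zeros_def)
    qed
    have "\<not> of_cpoly g dvd of_cpoly p * of_cpoly q"
      using not_dvd[OF p(1) zw(1)] not_dvd[OF q(1) zw(3)] assms(1) prime_elem_dvd_mult_iff by blast
    moreover have "pf_eval (of_cpoly g) z = 0" using zw by (simp add: cpoly_zeros_def)
    ultimately obtain x where "cpoly_eval g x = 0" "cpoly_eval p x * cpoly_eval q x \<noteq> 0"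
      using prime_zeros_not_contained[OF assms(1), of "of_cpoly p * of_cpoly q" z UNIV] by auto
    then show False using BC(3) p(2) q(2) by (auto simp: cpoly_zeros_def)
  qed
qed (use assms(2) algebraic_set_cpoly_zeros in auto)

text \<open>An irreducible set in the zero set of a product lies in the zero set of one factor, hence in that of
  a prime factor of \<open>a\<close>; being a maximal irreducible subset it equals the latter.\<close>

lemma irreducible_component_prime_zeros:
  assumes "irreducible_component V (cpoly_zeros a)" "a \<noteq> 0"
  obtains g where "prime_elem (of_cpoly g)" "of_cpoly g dvd of_cpoly a" "V = cpoly_zeros g"
proof -
  have V: "irreducible_algebraic V" "V \<subseteq> cpoly_zeros a"
    and max: "\<And>W. irreducible_algebraic W \<Longrightarrow> V \<subseteq> W \<Longrightarrow> W \<subseteq> cpoly_zeros a \<Longrightarrow> W = V"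
    using assms(1) unfolding irreducible_component_def by auto
  have alg: "algebraic_set V" and ne: "V \<noteq> {}"
    and irr: "\<And>B C. algebraic_set B \<Longrightarrow> algebraic_set C \<Longrightarrow> V = B \<union> C \<Longrightarrow> B = V \<or> C = V"
    using V(1) unfolding irreducible_algebraic_def by blast+
  define X where "X f \<longleftrightarrow> (\<forall>z\<in>V. pf_eval f z = 0)" for f
  have "\<exists>g. prime_elem g \<and> g dvd of_cpoly a \<and> X g"
  proof (rule exists_prime_divisor)
    fix f h assume fh: "X (f * h)"
    obtain p where p: "f = of_cpoly p" using of_cpoly_surj by blast
    obtain q where q: "h = of_cpoly q" using of_cpoly_surj by blast
    have "V = (V \<inter> cpoly_zeros p) \<union> (V \<inter> cpoly_zeros q)"
      using fh by (auto simp: X_def p q cpoly_zeros_def)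
    then have "V \<inter> cpoly_zeros p = V \<or> V \<inter> cpoly_zeros q = V"
      using irr algebraic_set_Int[OF alg algebraic_set_cpoly_zeros] by blast
    then show "X f \<or> X h" by (auto simp: X_def p q cpoly_zeros_def)
  next
    fix u :: "'a polyfun" assume "u dvd 1"
    then show "\<not> X u" using ne polyfun_unit_eval unfolding X_def by blast
  next
    show "of_cpoly a \<noteq> 0" using assms(2) by simp
    show "X (of_cpoly a)" using V(2) by (auto simp: X_def cpoly_zeros_def)
  qed
  then obtain g' where g': "prime_elem g'" "g' dvd of_cpoly a" "X g'" by blast
  obtain g where g: "g' = of_cpoly g" using of_cpoly_surj by blast
  have sub: "V \<subseteq> cpoly_zeros g" using g'(3) by (auto simp: X_def g cpoly_zeros_def)
  obtain k where k: "of_cpoly a = of_cpoly g * k" using g'(2) unfolding g by (elim dvdE)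
  have "cpoly_eval a z = cpoly_eval g z * pf_eval k z" for z
    using arg_cong[OF k, of "\<lambda>f. pf_eval f z"] by simp
  then have "cpoly_zeros g \<subseteq> cpoly_zeros a" by (auto simp: cpoly_zeros_def)
  moreover have "irreducible_algebraic (cpoly_zeros g)"
    by (rule prime_zeros_irreducible) (use g' g sub ne in auto)
  ultimately have "cpoly_zeros g = V" using max sub by blast
  then show ?thesis using that g' g by blast
qed

lemma component_not_in_coprime_zeros:
  assumes "irreducible_component V (cpoly_zeros a)" "a \<noteq> 0" "no_common_prime (of_cpoly a) (of_cpoly b)"
  obtains z where "z \<in> V" "cpoly_eval b z \<noteq> 0"
proof -
  obtain g where g: "prime_elem (of_cpoly g)" "of_cpoly g dvd of_cpoly a" "V = cpoly_zeros g"
    using irreducible_component_prime_zeros[OF assms(1,2)] .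
  have "V \<noteq> {}" using assms(1) unfolding irreducible_component_def irreducible_algebraic_def by blast
  then obtain z where z: "cpoly_eval g z = 0" using g(3) by (auto simp: cpoly_zeros_def)
  have "\<not> of_cpoly g dvd of_cpoly b" using assms(3) g unfolding no_common_prime_def by blast
  then obtain w where "pf_eval (of_cpoly g) w = 0" "pf_eval (of_cpoly b) w \<noteq> 0"
    using prime_zeros_not_contained[OF g(1), of "of_cpoly b" z UNIV] z by auto
  then show ?thesis using that g(3) by (auto simp: cpoly_zeros_def)
qed

section \<open>Holomorphic families of polynomials in one variable\<close>

lemma continuous_on_contour_integral_param:
  assumes "continuous_on (A \<times> path_image g) (\<lambda>(x, y). f x y)"
    and "continuous_on {0..1} g" "continuous_on {0..1} (\<lambda>t. vector_derivative g (at t))"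
  shows "continuous_on A (\<lambda>x. contour_integral g (f x))"
proof -
  have "continuous_on (A \<times> cbox 0 1) (\<lambda>(x, t). f x (g t) * vector_derivative g (at t))"
  proof -
    have 1: "continuous_on (A \<times> cbox 0 (1::real)) (\<lambda>p. g (snd p))"
      by (rule continuous_on_compose2[OF assms(2) continuous_on_snd]) (auto intro: continuous_intros)
    have 2: "continuous_on (A \<times> cbox 0 (1::real)) (\<lambda>p. vector_derivative g (at (snd p)))"
      by (rule continuous_on_compose2[OF assms(3) continuous_on_snd]) (auto intro: continuous_intros)
    have "continuous_on (A \<times> cbox 0 1) (\<lambda>p. case (fst p, g (snd p)) of (x, y) \<Rightarrow> f x y)"
      by (rule continuous_on_compose2[OF assms(1)])
         (use 1 in \<open>auto intro!: continuous_intros simp: path_image_def\<close>)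
    with 2 show ?thesis by (simp add: case_prod_unfold continuous_on_mult)
  qed
  then have "continuous_on A (\<lambda>x. integral (cbox 0 1) (\<lambda>t. f x (g t) * vector_derivative g (at t)))"
    by (rule integral_continuous_on_param)
  then show ?thesis unfolding contour_integral_integral by simp
qed

lemma continuous_on_vector_derivative_circlepath:
  "continuous_on A (\<lambda>t. vector_derivative (circlepath c r) (at t))"
  by (simp add: vector_derivative_circlepath) (intro continuous_intros)

lemma contour_integral_swap_circlepath_linepath:
  assumes "continuous_on (closed_segment a b \<times> path_image (circlepath c r)) (\<lambda>(t, l). K t l)"
  shows "contour_integral (linepath a b) (\<lambda>t. contour_integral (circlepath c r) (K t)) =
         contour_integral (circlepath c r) (\<lambda>l. contour_integral (linepath a b) (\<lambda>t. K t l))"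
    and "(\<lambda>l. contour_integral (linepath a b) (\<lambda>t. K t l)) contour_integrable_on circlepath c r"
proof -
  show "contour_integral (linepath a b) (\<lambda>t. contour_integral (circlepath c r) (K t)) =
         contour_integral (circlepath c r) (\<lambda>l. contour_integral (linepath a b) (\<lambda>t. K t l))"
    by (rule contour_integral_swap)
       (use assms in \<open>auto intro!: continuous_intros continuous_on_vector_derivative_circlepath\<close>)
  have "continuous_on (path_image (circlepath c r) \<times> path_image (linepath a b)) (\<lambda>(l, t). K t l)"
    using continuous_on_swap_args[OF assms] by simp
  then have "continuous_on (path_image (circlepath c r)) (\<lambda>l. contour_integral (linepath a b) (\<lambda>t. K t l))"
    by (rule continuous_on_contour_integral_param) (auto intro!: continuous_intros continuous_on_linepath)
  then show "(\<lambda>l. contour_integral (linepath a b) (\<lambda>t. K t l)) contour_integrable_on circlepath c r"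
    by (rule contour_integrable_continuous_circlepath)
qed

text \<open>Morera's theorem: the integrals over the sides of a triangle are exchanged with the integral over
  the circle, where Cauchy's theorem applies to each integrand.\<close>

lemma holomorphic_on_circle_integral_param:
  assumes "open T" and cont: "continuous_on (T \<times> path_image (circlepath c r)) (\<lambda>(t, l). K t l)"
    and hol: "\<And>l. l \<in> path_image (circlepath c r) \<Longrightarrow> (\<lambda>t. K t l) holomorphic_on T"
  shows "(\<lambda>t. contour_integral (circlepath c r) (K t)) holomorphic_on T"
proof -
  have "(\<lambda>t. contour_integral (circlepath c r) (K t)) analytic_on T"
  proof (rule Morera_triangle[OF _ \<open>open T\<close>], goal_cases)
    case 1
    show ?case
      by (rule continuous_on_contour_integral_param[OF cont])
         (auto intro!: continuous_intros continuous_on_vector_derivative_circlepath path_circlepath[unfolded path_def])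
  next
    case (2 x y z)
    show ?case
    proof
      assume hull: "convex hull {x, y, z} \<subseteq> T"
      have seg: "closed_segment p q \<subseteq> convex hull {x, y, z}"
        if "p \<in> {x, y, z}" "q \<in> {x, y, z}" for p q
        using that by (intro closed_segment_subset_convex_hull) (auto intro: hull_inc)
      have cont': "continuous_on (closed_segment p q \<times> path_image (circlepath c r)) (\<lambda>(t, l). K t l)"
        if "p \<in> {x, y, z}" "q \<in> {x, y, z}" for p q
        by (rule continuous_on_subset[OF cont]) (use seg[OF that] hull in auto)
      note swap = contour_integral_swap_circlepath_linepath[OF cont']
      let ?I = "\<lambda>p q l. contour_integral (linepath p q) (\<lambda>t. K t l)"
      have "contour_integral (circlepath c r) (\<lambda>l. ?I x y l + ?I y z l + ?I z x l)
          = contour_integral (circlepath c r) (\<lambda>l. 0)"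
      proof (rule contour_integral_eq)
        fix l assume "l \<in> path_image (circlepath c r)"
        then have "(\<lambda>t. K t l) holomorphic_on convex hull {x, y, z}"
          using hol hull holomorphic_on_subset by blast
        then show "?I x y l + ?I y z l + ?I z x l = 0"
          by (intro has_chain_integral_chain_integral3 Cauchy_theorem_triangle)
      qed
      then show "contour_integral (linepath x y) (\<lambda>t. contour_integral (circlepath c r) (K t)) +
          contour_integral (linepath y z) (\<lambda>t. contour_integral (circlepath c r) (K t)) +
          contour_integral (linepath z x) (\<lambda>t. contour_integral (circlepath c r) (K t)) = 0"
        by (simp add: swap contour_integral_add contour_integrable_add)
    qed
  qed
  then show ?thesis by (rule analytic_imp_holomorphic)
qed

lemma entire_zero_on_reals:
  assumes "f holomorphic_on UNIV" "\<And>t. t \<in> \<real> \<Longrightarrow> f t = 0"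
  shows "f t = (0::complex)"
proof (rule analytic_continuation[of f UNIV \<real> 0])
  show "(0::complex) islimpt \<real>"
    unfolding islimpt_approachable
  proof (intro allI impI)
    fix e :: real assume "e > 0"
    then show "\<exists>x'\<in>\<real>. x' \<noteq> 0 \<and> dist x' (0::complex) < e"
      by (intro bexI[of _ "of_real (e / 2)"]) auto
  qed
qed (use assms in auto)

lemma entire_mult_zeroD:
  assumes "f holomorphic_on UNIV" "g holomorphic_on UNIV" "\<And>t. f t * g t = 0" "f t0 \<noteq> 0"
  shows "g t = (0::complex)"
proof -
  have cont: "continuous_on UNIV f" using assms(1) by (rule holomorphic_on_imp_continuous_on)
  have "open {t. f t \<noteq> 0}"
    by (rule open_Collect_neq[OF cont continuous_on_const])
  show ?thesis
    by (rule analytic_continuation_open[of "{t. f t \<noteq> 0}" UNIV g "\<lambda>_. 0"])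
       (use assms(2-4) \<open>open {t. f t \<noteq> 0}\<close> in auto)
qed

text \<open>For real \<open>t\<close> the product formula for the constant term shows that the leading coefficient has modulus
  \<open>|c|\<close>. Hence the highest coefficient function \<open>\<alpha>\<close> that is not identically zero satisfies
  \<open>\<alpha>(t) * cnj (\<alpha>(cnj t)) = |c|\<^sup>2\<close> for all complex \<open>t\<close>, so it has no zeros.\<close>

lemma degree_constant_of_unimodular_roots:
  fixes P :: "complex \<Rightarrow> complex poly"
  assumes hol: "\<And>k. (\<lambda>t. coeff (P t) k) holomorphic_on UNIV"
    and bound: "\<And>t. degree (P t) \<le> N"
    and const: "\<And>t. coeff (P t) 0 = c" "c \<noteq> 0"
    and unim: "\<And>t l. t \<in> \<real> \<Longrightarrow> poly (P t) l = 0 \<Longrightarrow> norm l = 1"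
  shows "\<exists>D. \<forall>t. degree (P t) = D"
proof -
  define A where "A = {k. k \<le> N \<and> (\<exists>t. coeff (P t) k \<noteq> 0)}"
  define D where "D = Max A"
  have A: "finite A" "0 \<in> A" unfolding A_def using const by auto
  then have "D \<in> A" unfolding D_def by (intro Max_in) auto
  then obtain t0 where t0: "coeff (P t0) D \<noteq> 0" by (auto simp: A_def)
  have above: "coeff (P t) k = 0" if "k > D" for t k
  proof (rule ccontr)
    assume nz: "coeff (P t) k \<noteq> 0"
    then have "k \<le> N" using bound[of t] le_degree order.trans by blast
    then have "k \<in> A" using nz by (auto simp: A_def)
    then show False using Max_ge[OF A(1)] that by (fastforce simp: D_def)
  qed
  have le: "degree (P t) \<le> D" for t using above by (intro degree_le) auto
  define a where "a t = coeff (P t) D" for t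
  \<comment> \<open>The factor a in a * b covers the real t at which the degree might drop below D.\<close>
  define b where "b t = a t * (cnj \<circ> a \<circ> cnj) t - of_real ((norm c)\<^sup>2)" for t
  have hol_a: "a holomorphic_on UNIV" unfolding a_def by (rule hol)
  have "(cnj \<circ> a \<circ> cnj) holomorphic_on UNIV"
    by (rule holomorphic_on_compose_cnj_cnj[OF holomorphic_on_subset[OF hol_a]]) auto
  then have hol_b: "b holomorphic_on UNIV"
    unfolding b_def using hol_a by (intro holomorphic_intros)
  have real: "a t * b t = 0" if t: "t \<in> \<real>" for t
  proof (cases "a t = 0")
    case False
    then have deg: "degree (P t) = D" using le[of t] le_degree[of "P t" D] by (simp add: a_def)
    have "norm c = norm (poly (P t) 0)" using const by (simp add: poly_0_coeff_0)
    also have "\<dots> = norm (poly (smult (lead_coeff (P t)) (\<Prod>z|poly (P t) z = 0. [:-z, 1:] ^ order z (P t))) 0)"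
      by (subst complex_poly_decompose) simp
    also have "\<dots> = norm (a t) * (\<Prod>z|poly (P t) z = 0. norm z ^ order z (P t))"
      by (simp add: poly_prod poly_power norm_mult prod_norm[symmetric] norm_power deg a_def)
    also have "(\<Prod>z|poly (P t) z = 0. norm z ^ order z (P t)) = 1"
      by (intro prod.neutral) (use unim[OF t] in auto)
    finally have "norm (a t) = norm c" by simp
    moreover have "cnj t = t" using t by (metis Reals_cnj_iff)
    moreover have "a t * cnj (a t) = c * cnj c" using calculation(1) by (metis complex_norm_square)
    ultimately have "b t = 0" by (simp add: b_def complex_norm_square del: of_real_power)
    then show ?thesis by simp
  qed simp
  have "a t * b t = 0" for t
    by (rule entire_zero_on_reals[of "\<lambda>t. a t * b t"]) (use hol_a hol_b real in \<open>auto intro!: holomorphic_intros\<close>)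
  then have b0: "b t = 0" for t
    by (rule entire_mult_zeroD[OF hol_a hol_b]) (use t0 in \<open>simp add: a_def\<close>)
  have "a t \<noteq> 0" for t using b0[of t] const(2) by (auto simp: b_def)
  then have "D \<le> degree (P t)" for t unfolding a_def by (rule le_degree)
  with le show ?thesis by (metis antisym)
qed

text \<open>The polynomial whose roots are \<open>0\<close> and the values other than \<open>v l0\<close> has no constant term, so its weighted
  sum over the values is a combination of power sums; only the value \<open>v l0\<close> contributes to it.\<close>

lemma power_sums_zero_imp_zero:
  fixes v :: "'a \<Rightarrow> complex" and w :: "'a \<Rightarrow> int"
  assumes "finite Z" "\<And>l. l \<in> Z \<Longrightarrow> w l > 0"
    and sums: "\<And>m. m \<ge> 1 \<Longrightarrow> (\<Sum>l\<in>Z. of_int (w l) * v l ^ m) = 0"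
    and "l0 \<in> Z"
  shows "v l0 = 0"
proof (rule ccontr)
  assume nz: "v l0 \<noteq> 0"
  define p where "p = [:0, 1:] * (\<Prod>y\<in>v ` Z - {v l0}. [:- y, 1:])"
  have "(\<Sum>l\<in>Z. of_int (w l) * poly p (v l)) = (\<Sum>k\<le>degree p. coeff p k * (\<Sum>l\<in>Z. of_int (w l) * v l ^ k))"
    unfolding poly_altdef sum_distrib_left by (subst sum.swap) (simp add: mult_ac)
  also have "\<dots> = 0"
  proof (rule sum.neutral, rule ballI)
    fix k
    show "coeff p k * (\<Sum>l\<in>Z. of_int (w l) * v l ^ k) = 0"
      using sums[of k] by (cases "k = 0") (auto simp: p_def)
  qed
  finally have "(\<Sum>l\<in>Z. of_int (w l) * poly p (v l)) = 0" .
  moreover have "(\<Sum>l\<in>Z. of_int (w l) * poly p (v l)) = (\<Sum>l\<in>{l\<in>Z. v l = v l0}. of_int (w l) * poly p (v l0))"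
    using assms(1) by (intro sum.mono_neutral_cong_right) (auto simp: p_def poly_prod)
  moreover have "\<dots> = of_int (\<Sum>l\<in>{l\<in>Z. v l = v l0}. w l) * poly p (v l0)"
    by (simp add: sum_distrib_right)
  moreover have "poly p (v l0) \<noteq> 0"
    using nz assms(1) by (auto simp: p_def poly_prod)
  moreover have "(\<Sum>l\<in>{l\<in>Z. v l = v l0}. w l) > 0"
    by (rule sum_pos) (use assms in auto)
  then have "of_int (\<Sum>l\<in>{l\<in>Z. v l = v l0}. w l) \<noteq> (0 :: complex)"
    by (simp only: of_int_eq_0_iff)
  ultimately show False by (metis mult_eq_0_iff)
qed

lemma poly_family_eval:
  fixes P :: "complex \<Rightarrow> complex poly"
  assumes "\<And>t. degree (P t) = D"
  shows "poly (P t) l = (\<Sum>k\<le>D. coeff (P t) k * l ^ k)"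
  by (simp add: poly_altdef assms)

text \<open>Roots near infinity are inverses of roots near \<open>0\<close> of the reversed polynomials, which at \<open>t0\<close> do not
  vanish at \<open>0\<close> since the degree is constant. On the remaining compact set outside \<open>W\<close> the polynomial at
  \<open>t0\<close> has no zeros.\<close>

lemma roots_stay_close:
  fixes P :: "complex \<Rightarrow> complex poly"
  assumes cont: "\<And>k. continuous_on UNIV (\<lambda>t. coeff (P t) k)"
    and deg: "\<And>t. degree (P t) = D" and nz: "P t0 \<noteq> 0"
    and W: "open W" "\<And>l. poly (P t0) l = 0 \<Longrightarrow> l \<in> W"
  obtains T where "open T" "t0 \<in> T" "\<And>t l. t \<in> T \<Longrightarrow> poly (P t) l = 0 \<Longrightarrow> l \<in> W"
proof -
  have cont_P: "continuous_on UNIV (\<lambda>(t, l). poly (P t) l)"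
    unfolding poly_family_eval[of P D, OF deg] case_prod_unfold
    by (intro continuous_intros continuous_on_compose2[OF cont]) auto
  have "poly (reflect_poly (P t)) l = (\<Sum>k\<le>D. coeff (P t) (D - k) * l ^ k)" for t l
  proof -
    have "poly (reflect_poly (P t)) l = (\<Sum>k\<le>D. coeff (reflect_poly (P t)) k * l ^ k)"
      unfolding poly_altdef
    proof (rule sum.mono_neutral_left)
      show "{..degree (reflect_poly (P t))} \<subseteq> {..D}"
        using degree_reflect_poly_le[of "P t"] deg[of t] by auto
    qed (auto simp: coeff_eq_0)
    then show ?thesis by (simp add: coeff_reflect_poly deg)
  qed
  then have cont_R: "continuous_on UNIV (\<lambda>(t, l). poly (reflect_poly (P t)) l)"
    by (simp add: case_prod_unfold, intro continuous_intros continuous_on_compose2[OF cont]) auto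
  have open_P: "open {p. (case p of (t, l) \<Rightarrow> poly (P t) l) \<noteq> 0}"
    by (rule open_Collect_neq[OF cont_P continuous_on_const])
  have open_R: "open {p. (case p of (t, l) \<Rightarrow> poly (reflect_poly (P t)) l) \<noteq> 0}"
    by (rule open_Collect_neq[OF cont_R continuous_on_const])
  have "(t0, 0) \<in> {p. (case p of (t, l) \<Rightarrow> poly (reflect_poly (P t)) l) \<noteq> 0}"
    using nz by simp
  then obtain A B where AB: "open A" "open B" "(t0, 0) \<in> A \<times> B"
      "A \<times> B \<subseteq> {p. (case p of (t, l) \<Rightarrow> poly (reflect_poly (P t)) l) \<noteq> 0}"
    by (rule open_prod_elim[OF open_R])
  obtain e where e: "e > 0" "ball 0 e \<subseteq> B" using AB open_contains_ball by blast
  have "compact (cball 0 (1 / e) - W)" using W(1) by (intro compact_diff) auto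
  then have "\<exists>X. t0 \<in> X \<and> open X \<and> X \<times> (cball 0 (1 / e) - W) \<subseteq> {p. (case p of (t, l) \<Rightarrow> poly (P t) l) \<noteq> 0}"
  proof (rule Elementary_Topology.tube_lemma[OF _ open_P])
    show "{t0} \<times> (cball 0 (1 / e) - W) \<subseteq> {p. (case p of (t, l) \<Rightarrow> poly (P t) l) \<noteq> 0}"
      using W(2) by auto
  qed
  then obtain X where X: "t0 \<in> X" "open X" "X \<times> (cball 0 (1 / e) - W) \<subseteq> {p. (case p of (t, l) \<Rightarrow> poly (P t) l) \<noteq> 0}"
    by (elim exE conjE) (rule that)
  show ?thesis
  proof (rule that[of "A \<inter> X"])
    show "open (A \<inter> X)" "t0 \<in> A \<inter> X" using AB X by auto
    fix t l assume t: "t \<in> A \<inter> X" and root: "poly (P t) l = 0"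
    show "l \<in> W"
    proof (cases "norm l \<le> 1 / e")
      case True
      then show ?thesis using X(3) t root by (auto simp: subset_iff)
    next
      case False
      have "1 / e > 0" using e by simp
      then have "l \<noteq> 0" using False by auto
      have "norm (inverse l) < e" using False e \<open>l \<noteq> 0\<close> by (simp add: norm_inverse norm_divide field_simps)
      then have "inverse l \<in> B" using e(2) by auto
      then have "poly (reflect_poly (P t)) (inverse l) \<noteq> 0" using AB(4) t by auto
      then show ?thesis using root \<open>l \<noteq> 0\<close> by (simp add: poly_reflect_poly_nz)
    qed
  qed
qed

lemma zorder_poly_pos:
  assumes "p \<noteq> 0" "poly p l = 0"
  shows "zorder (poly p) l > 0"
proof -
  have "poly p holomorphic_on UNIV" unfolding poly_altdef[abs_def] by (intro holomorphic_intros)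
  moreover have "\<exists>w\<in>UNIV. poly p w \<noteq> 0" using poly_all_0_iff_0[of p] assms(1) by auto
  ultimately show ?thesis
    using zorder_exist_zero[of "poly p" UNIV l] assms(2) connected_UNIV by auto
qed

text \<open>The argument principle with weight \<open>h\<close>; the disc of radius \<open>R\<close> leaves room around the circle.\<close>

lemma sum_roots_in_disc:
  assumes "p \<noteq> 0" "0 < r" "r < R" "h holomorphic_on ball c R"
    and "\<And>l. l \<in> sphere c r \<Longrightarrow> poly p l \<noteq> 0"
  shows "contour_integral (circlepath c r) (\<lambda>x. poly (pderiv p) x * h x / poly p x)
       = 2 * pi * \<i> * (\<Sum>l\<in>{l\<in>ball c r. poly p l = 0}. of_int (zorder (poly p) l) * h l)"
proof -
  have fin: "finite {w\<in>ball c R. poly p w = 0 \<or> w \<in> {}}"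
    using poly_roots_finite[OF assms(1)] by (rule finite_subset[rotated]) auto
  have path: "path_image (circlepath c r) = sphere c r" using assms(2) by simp
  have out: "winding_number (circlepath c r) z = 0" if "z \<notin> cball c r" for z
    by (rule winding_number_zero_outside[of _ "cball c r"]) (use that assms(2) in \<open>auto simp: path\<close>)
  have "contour_integral (circlepath c r) (\<lambda>x. deriv (poly p) x * h x / poly p x) = 2 * pi * \<i> *
      (\<Sum>l\<in>{w\<in>ball c R. poly p w = 0 \<or> w \<in> {}}. winding_number (circlepath c r) l * h l * zorder (poly p) l)"
  proof (rule argument_principle)
    show "\<forall>z. z \<notin> ball c R \<longrightarrow> winding_number (circlepath c r) z = 0" using out assms(3) by auto
    show "path_image (circlepath c r) \<subseteq> ball c R - {w\<in>ball c R. poly p w = 0 \<or> w \<in> {}}"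
      using assms(3,5) path by auto
  qed (use assms fin in \<open>auto intro!: holomorphic_intros\<close>)
  also have "(\<lambda>x. deriv (poly p) x * h x / poly p x) = (\<lambda>x. poly (pderiv p) x * h x / poly p x)"
    by (simp add: DERIV_imp_deriv[OF poly_DERIV])
  also have "(\<Sum>l\<in>{w\<in>ball c R. poly p w = 0 \<or> w \<in> {}}. winding_number (circlepath c r) l * h l * zorder (poly p) l)
      = (\<Sum>l\<in>{l\<in>ball c r. poly p l = 0}. of_int (zorder (poly p) l) * h l)"
  proof (rule sum.mono_neutral_cong_right[OF fin])
    show "{l\<in>ball c r. poly p l = 0} \<subseteq> {w\<in>ball c R. poly p w = 0 \<or> w \<in> {}}" using assms(3) by auto
    show "\<forall>l\<in>{w\<in>ball c R. poly p w = 0 \<or> w \<in> {}} - {l\<in>ball c r. poly p l = 0}.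
        winding_number (circlepath c r) l * h l * zorder (poly p) l = 0"
    proof
      fix l assume l: "l \<in> {w\<in>ball c R. poly p w = 0 \<or> w \<in> {}} - {l\<in>ball c r. poly p l = 0}"
      then have "l \<notin> ball c r" "l \<notin> sphere c r" using assms(5) by auto
      then have "winding_number (circlepath c r) l = 0" by (intro out) auto
      then show "winding_number (circlepath c r) l * h l * zorder (poly p) l = 0" by simp
    qed
    fix l assume "l \<in> {l\<in>ball c r. poly p l = 0}"
    then have "winding_number (circlepath c r) l = 1"
      by (intro winding_number_circlepath) (auto simp: dist_norm norm_minus_commute)
    then show "winding_number (circlepath c r) l * h l * zorder (poly p) l = of_int (zorder (poly p) l) * h l"
      by simp
  qed
  finally show ?thesis .
qed

text \<open>\<open>F t l\<close> is meaningful only if \<open>l\<close> is a root of \<open>P t\<close>. Near the root \<open>l0\<close> of \<open>P t0\<close> it is required to be the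
  restriction of a function \<open>G\<close> of two independent variables that is holomorphic in each.\<close>

definition extends_on_roots :: "(complex \<Rightarrow> complex poly) \<Rightarrow> (complex \<Rightarrow> complex \<Rightarrow> complex) \<Rightarrow>
    complex \<Rightarrow> complex \<Rightarrow> real \<Rightarrow> (complex \<Rightarrow> complex \<Rightarrow> complex) \<Rightarrow> bool" where
  "extends_on_roots P F t0 l0 e G \<longleftrightarrow> e > 0 \<and>
     continuous_on (ball t0 e \<times> ball l0 e) (\<lambda>(t, l). G t l) \<and>
     (\<forall>l\<in>ball l0 e. (\<lambda>t. G t l) holomorphic_on ball t0 e) \<and>
     (\<forall>t\<in>ball t0 e. G t holomorphic_on ball l0 e) \<and>
     (\<forall>t\<in>ball t0 e. \<forall>l\<in>ball l0 e. poly (P t) l = 0 \<longrightarrow> G t l = F t l)"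

lemma extends_on_rootsD:
  assumes "extends_on_roots P F t0 l0 e G"
  shows "e > 0" "continuous_on (ball t0 e \<times> ball l0 e) (\<lambda>(t, l). G t l)"
    "\<And>l. l \<in> ball l0 e \<Longrightarrow> (\<lambda>t. G t l) holomorphic_on ball t0 e"
    "\<And>t. t \<in> ball t0 e \<Longrightarrow> G t holomorphic_on ball l0 e"
    "\<And>t l. t \<in> ball t0 e \<Longrightarrow> l \<in> ball l0 e \<Longrightarrow> poly (P t) l = 0 \<Longrightarrow> G t l = F t l"
  using assms unfolding extends_on_roots_def by auto

text \<open>Near a parameter \<open>t0\<close> all roots stay in small disjoint discs around the roots at \<open>t0\<close>. In each disc \<open>F\<close>
  may be replaced by its extension \<open>G\<close>, and the argument principle turns the sum into a contour integral
  whose integrand is holomorphic in the parameter.\<close>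

lemma power_sum_over_roots_holomorphic:
  fixes P :: "complex \<Rightarrow> complex poly"
  assumes hol: "\<And>k. (\<lambda>t. coeff (P t) k) holomorphic_on UNIV"
    and deg: "\<And>t. degree (P t) = D" and nz: "\<And>t. P t \<noteq> 0"
    and loc: "\<And>t l. poly (P t) l = 0 \<Longrightarrow> \<exists>e G. extends_on_roots P F t l e G"
  shows "(\<lambda>t. \<Sum>l\<in>{l. poly (P t) l = 0}. of_int (zorder (poly (P t)) l) * F t l ^ m) holomorphic_on UNIV"
proof -
  define N where "N t = (\<Sum>l\<in>{l. poly (P t) l = 0}. of_int (zorder (poly (P t)) l) * F t l ^ m)" for t
  have cont: "continuous_on UNIV (\<lambda>t. coeff (P t) k)" for k
    using hol by (rule holomorphic_on_imp_continuous_on)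
  have "\<exists>T. open T \<and> t0 \<in> T \<and> N holomorphic_on T" for t0
  proof -
    define Z where "Z = {l. poly (P t0) l = 0}"
    have finZ: "finite Z" unfolding Z_def by (rule poly_roots_finite[OF nz])
    have "\<forall>l\<in>Z. \<exists>eG. extends_on_roots P F t0 l (fst eG) (snd eG)"
      using loc[of t0] by (auto simp: Z_def)
    then obtain eG where eG: "\<forall>l\<in>Z. extends_on_roots P F t0 l (fst (eG l)) (snd (eG l))"
      using bchoice[of Z "\<lambda>l p. extends_on_roots P F t0 l (fst p) (snd p)"] by blast
    define e G where "e l = fst (eG l)" and "G l = snd (eG l)" for l
    have G: "extends_on_roots P F t0 l (e l) (G l)" if "l \<in> Z" for l
      using eG that by (auto simp: e_def G_def)
    note e = extends_on_rootsD(1)[OF G]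
    \<comment> \<open>Closed discs of radius R/2 around the roots are disjoint, and the extensions are defined on those of radius R.\<close>
    obtain R where R: "R > 0" "\<And>l. l \<in> Z \<Longrightarrow> R \<le> e l" "\<And>l l'. l \<in> Z \<Longrightarrow> l' \<in> Z \<Longrightarrow> l \<noteq> l' \<Longrightarrow> 2 * R \<le> dist l l'"
    proof -
      define E where "E = insert 1 (e ` Z \<union> (\<lambda>(l, l'). dist l l' / 2) ` {p\<in>Z \<times> Z. fst p \<noteq> snd p})"
      have finE: "finite E" unfolding E_def using finZ by auto
      have "Min E \<in> E" by (rule Min_in[OF finE]) (auto simp: E_def)
      moreover have "\<forall>x\<in>E. x > 0" using e by (auto simp: E_def)
      moreover have "Min E \<le> e l" if "l \<in> Z" for l
        by (rule Min_le[OF finE]) (use that in \<open>auto simp: E_def\<close>)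
      moreover have "Min E \<le> dist l l' / 2" if "l \<in> Z" "l' \<in> Z" "l \<noteq> l'" for l l'
        by (rule Min_le[OF finE]) (use that in \<open>force simp: E_def\<close>)
      ultimately show ?thesis using that[of "Min E"] by (force simp: field_simps)
    qed
    define r where "r = R / 2"
    have r: "0 < r" "r < R" using R(1) by (auto simp: r_def)
    have disj: "l = l'" if "l \<in> Z" "l' \<in> Z" "x \<in> cball l r" "x \<in> cball l' r" for l l' x
    proof (rule ccontr)
      assume "l \<noteq> l'"
      then have "2 * R \<le> dist l l'" using R(3) that by blast
      also have "\<dots> \<le> dist l x + dist l' x" by (rule dist_triangle2)
      also have "\<dots> \<le> R" using that by (simp add: r_def)
      finally show False using R(1) by simp
    qed
    define W where "W = (\<Union>l\<in>Z. ball l r)"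
    obtain T0 where T0: "open T0" "t0 \<in> T0" "\<And>t l. t \<in> T0 \<Longrightarrow> poly (P t) l = 0 \<Longrightarrow> l \<in> W"
      by (rule roots_stay_close[OF cont deg nz, of W t0]) (use r in \<open>auto simp: W_def Z_def\<close>)
    define T where "T = T0 \<inter> ball t0 R"
    have T: "open T" "t0 \<in> T" using T0 R by (auto simp: T_def)
    have off: "poly (P t) x \<noteq> 0" if tlx: "t \<in> T" "l \<in> Z" "x \<in> sphere l r" for t l x
    proof
      assume "poly (P t) x = 0"
      then obtain l' where "l' \<in> Z" "x \<in> ball l' r" using T0(3) tlx by (auto simp: T_def W_def)
      then show False using disj[of l l' x] tlx by auto
    qed
    have "N t = (\<Sum>l\<in>Z. contour_integral (circlepath l r)
        (\<lambda>x. poly (pderiv (P t)) x * G l t x ^ m / poly (P t) x)) / (2 * pi * \<i>)" if t: "t \<in> T" for t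
    proof -
      have "{l. poly (P t) l = 0} = (\<Union>l\<in>Z. {x\<in>ball l r. poly (P t) x = 0})"
        using T0(3) t by (auto simp: T_def W_def)
      then have "N t = (\<Sum>x\<in>(\<Union>l\<in>Z. {x\<in>ball l r. poly (P t) x = 0}). of_int (zorder (poly (P t)) x) * F t x ^ m)"
        by (simp add: N_def)
      also have "\<dots> = (\<Sum>l\<in>Z. \<Sum>x\<in>{x\<in>ball l r. poly (P t) x = 0}. of_int (zorder (poly (P t)) x) * F t x ^ m)"
      proof (rule sum.UNION_disjoint[OF finZ])
        show "\<forall>l\<in>Z. finite {x\<in>ball l r. poly (P t) x = 0}"
          using poly_roots_finite[OF nz[of t]] by (auto intro: finite_subset[rotated])
        show "\<forall>l\<in>Z. \<forall>l'\<in>Z. l \<noteq> l' \<longrightarrow> {x\<in>ball l r. poly (P t) x = 0} \<inter> {x\<in>ball l' r. poly (P t) x = 0} = {}"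
          using disj by (fastforce dest: less_imp_le)
      qed
      also have "\<dots> = (\<Sum>l\<in>Z. contour_integral (circlepath l r)
        (\<lambda>x. poly (pderiv (P t)) x * G l t x ^ m / poly (P t) x) / (2 * pi * \<i>))"
      proof (rule sum.cong[OF refl])
        fix l assume l: "l \<in> Z"
        have tl: "t \<in> ball t0 (e l)" using t R(2)[OF l] by (auto simp: T_def)
        have "G l t holomorphic_on ball l R"
          by (rule holomorphic_on_subset[OF extends_on_rootsD(4)[OF G[OF l] tl]]) (use R(2)[OF l] in auto)
        then have "contour_integral (circlepath l r) (\<lambda>x. poly (pderiv (P t)) x * G l t x ^ m / poly (P t) x)
          = 2 * pi * \<i> * (\<Sum>x\<in>{x\<in>ball l r. poly (P t) x = 0}. of_int (zorder (poly (P t)) x) * G l t x ^ m)"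
          using nz r off[OF t l] by (intro sum_roots_in_disc[of _ r R]) (auto intro!: holomorphic_intros)
        moreover have "(\<Sum>x\<in>{x\<in>ball l r. poly (P t) x = 0}. of_int (zorder (poly (P t)) x) * G l t x ^ m)
          = (\<Sum>x\<in>{x\<in>ball l r. poly (P t) x = 0}. of_int (zorder (poly (P t)) x) * F t x ^ m)"
          by (rule sum.cong[OF refl]) (use extends_on_rootsD(5)[OF G[OF l] tl] R(2)[OF l] r in auto)
        ultimately show "(\<Sum>x\<in>{x\<in>ball l r. poly (P t) x = 0}. of_int (zorder (poly (P t)) x) * F t x ^ m) =
          contour_integral (circlepath l r) (\<lambda>x. poly (pderiv (P t)) x * G l t x ^ m / poly (P t) x) / (2 * pi * \<i>)"
          by simp
      qed
      finally show ?thesis by (simp add: sum_divide_distrib)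
    qed
    moreover have "(\<lambda>t. (\<Sum>l\<in>Z. contour_integral (circlepath l r)
        (\<lambda>x. poly (pderiv (P t)) x * G l t x ^ m / poly (P t) x)) / (2 * pi * \<i>)) holomorphic_on T"
    proof (intro holomorphic_intros)
      fix l assume l: "l \<in> Z"
      have dP: "poly (pderiv (P t)) x = (\<Sum>k\<le>D. of_nat (Suc k) * coeff (P t) (Suc k) * x ^ k)" for t x
        unfolding poly_altdef by (rule sum.mono_neutral_cong_left)
          (auto simp: coeff_pderiv degree_pderiv deg coeff_eq_0)
      have sub: "T \<times> sphere l r \<subseteq> ball t0 (e l) \<times> ball l (e l)"
        using R(2)[OF l] r by (auto simp: T_def)
      show "(\<lambda>t. contour_integral (circlepath l r) (\<lambda>x. poly (pderiv (P t)) x * G l t x ^ m / poly (P t) x)) holomorphic_on T"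
      proof (rule holomorphic_on_circle_integral_param[OF T(1)])
        have "continuous_on (T \<times> sphere l r) (\<lambda>(t, x). G l t x)"
          by (rule continuous_on_subset[OF extends_on_rootsD(2)[OF G[OF l]] sub])
        then have "continuous_on (T \<times> sphere l r) (\<lambda>p. G l (fst p) (snd p))"
          by (simp add: case_prod_unfold)
        then show "continuous_on (T \<times> path_image (circlepath l r)) (\<lambda>(t, x). poly (pderiv (P t)) x * G l t x ^ m / poly (P t) x)"
          unfolding case_prod_unfold dP unfolding poly_family_eval[of P D, OF deg]
          using off[OF _ l] r unfolding poly_family_eval[of P D, OF deg]
          by (intro continuous_intros continuous_on_compose2[OF cont]) auto
        fix x assume "x \<in> path_image (circlepath l r)"
        then have x: "x \<in> sphere l r" using r by simp
        then have "x \<in> ball l (e l)" using R(2)[OF l] r by auto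
        then have "(\<lambda>t. G l t x) holomorphic_on ball t0 (e l)" by (rule extends_on_rootsD(3)[OF G[OF l]])
        then have "(\<lambda>t. G l t x) holomorphic_on T"
          by (rule holomorphic_on_subset) (use R(2)[OF l] in \<open>auto simp: T_def\<close>)
        moreover have "(\<lambda>t. coeff (P t) k) holomorphic_on T" for k
          using hol holomorphic_on_subset by blast
        ultimately show "(\<lambda>t. poly (pderiv (P t)) x * G l t x ^ m / poly (P t) x) holomorphic_on T"
          using off[OF _ l x] unfolding dP unfolding poly_family_eval[of P D, OF deg]
          by (intro holomorphic_intros) auto
      qed
    qed auto
    ultimately have "N holomorphic_on T" using holomorphic_transform by (metis (no_types, lifting))
    with T show ?thesis by blast
  qed
  then have "N analytic_on {t}" for t unfolding analytic_at by blast
  then have "N analytic_on UNIV" using analytic_on_analytic_at by blast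
  then show ?thesis unfolding N_def by (rule analytic_imp_holomorphic)
qed

text \<open>The power sums of the values of \<open>F\<close> over all the roots are entire and vanish on the real axis, hence
  everywhere; the weights are positive multiplicities, so all values vanish.\<close>

lemma vanishing_on_root_family:
  fixes P :: "complex \<Rightarrow> complex poly"
  assumes hol: "\<And>k. (\<lambda>t. coeff (P t) k) holomorphic_on UNIV"
    and deg: "\<And>t. degree (P t) = D" and nz: "\<And>t. P t \<noteq> 0"
    and loc: "\<And>t l. poly (P t) l = 0 \<Longrightarrow> \<exists>e G. extends_on_roots P F t l e G"
    and real: "\<And>t l. t \<in> \<real> \<Longrightarrow> poly (P t) l = 0 \<Longrightarrow> F t l = 0"
    and root: "poly (P t) l = 0"
  shows "F t l = 0"
proof (rule power_sums_zero_imp_zero[where v = "F t" and w = "zorder (poly (P t))" and Z = "{l. poly (P t) l = 0}"])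
  show "finite {l. poly (P t) l = 0}" by (rule poly_roots_finite[OF nz])
  show "zorder (poly (P t)) x > 0" if "x \<in> {l. poly (P t) l = 0}" for x
    using zorder_poly_pos[OF nz] that by simp
  show "l \<in> {l. poly (P t) l = 0}" using root by simp
  fix m :: nat assume "m \<ge> 1"
  show "(\<Sum>l\<in>{l. poly (P t) l = 0}. of_int (zorder (poly (P t)) l) * F t l ^ m) = 0"
    by (rule entire_zero_on_reals[OF power_sum_over_roots_holomorphic[OF hol deg nz loc]])
       (use real \<open>m \<ge> 1\<close> in \<open>auto intro!: sum.neutral\<close>)
qed

section \<open>Holomorphic functions of several variables\<close>

lemma has_derivative_vec_nth:
  "((\<lambda>z :: complex ^ 'n::finite. z $ i) has_derivative (\<lambda>v. v $ i)) (at z)"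
  by (rule bounded_linear_imp_has_derivative[OF bounded_linear_vec_nth])

text \<open>The pointwise condition in \<open>holomorphic_several\<close>, which is the one that is closed under arithmetic.\<close>

definition complex_differentiable_at :: "(complex ^ 'n::finite \<Rightarrow> complex) \<Rightarrow> complex ^ 'n \<Rightarrow> bool" where
  "complex_differentiable_at f z \<longleftrightarrow>
     (\<exists>f'. (f has_derivative f') (at z) \<and> (\<forall>c v. f' (c *s v) = c * f' v))"

lemma complex_differentiable_at_const: "complex_differentiable_at (\<lambda>_. c) z"
  unfolding complex_differentiable_at_def by (rule exI[of _ "\<lambda>_. 0"]) simp

lemma complex_differentiable_at_nth: "complex_differentiable_at (\<lambda>z. z $ i) z"
  unfolding complex_differentiable_at_def
  by (rule exI[of _ "\<lambda>v. v $ i"]) (simp add: has_derivative_vec_nth)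

lemma complex_differentiable_at_add:
  assumes "complex_differentiable_at f z" "complex_differentiable_at g z"
  shows "complex_differentiable_at (\<lambda>z. f z + g z) z"
proof -
  obtain f' where f': "(f has_derivative f') (at z)" "\<And>c v. f' (c *s v) = c * f' v"
    using assms(1) unfolding complex_differentiable_at_def by blast
  obtain g' where g': "(g has_derivative g') (at z)" "\<And>c v. g' (c *s v) = c * g' v"
    using assms(2) unfolding complex_differentiable_at_def by blast
  show ?thesis unfolding complex_differentiable_at_def
    by (rule exI[of _ "\<lambda>v. f' v + g' v"]) (use has_derivative_add[OF f'(1) g'(1)] f' g' in \<open>simp add: algebra_simps\<close>)
qed

lemma complex_differentiable_at_mult:
  assumes "complex_differentiable_at f z" "complex_differentiable_at g z"
  shows "complex_differentiable_at (\<lambda>z. f z * g z) z"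
proof -
  obtain f' where f': "(f has_derivative f') (at z)" "\<And>c v. f' (c *s v) = c * f' v"
    using assms(1) unfolding complex_differentiable_at_def by blast
  obtain g' where g': "(g has_derivative g') (at z)" "\<And>c v. g' (c *s v) = c * g' v"
    using assms(2) unfolding complex_differentiable_at_def by blast
  show ?thesis unfolding complex_differentiable_at_def
    by (rule exI[of _ "\<lambda>v. f z * g' v + f' v * g z"])
       (use has_derivative_mult[OF f'(1) g'(1)] f' g' in \<open>simp add: algebra_simps\<close>)
qed

lemma complex_differentiable_at_power:
  "complex_differentiable_at f z \<Longrightarrow> complex_differentiable_at (\<lambda>z. f z ^ n) z"
  by (induction n) (auto intro: complex_differentiable_at_const complex_differentiable_at_mult)

lemma complex_differentiable_at_sum:
  "(\<And>x. x \<in> A \<Longrightarrow> complex_differentiable_at (f x) z) \<Longrightarrow> complex_differentiable_at (\<lambda>z. \<Sum>x\<in>A. f x z) z"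
  by (induction A rule: infinite_finite_induct)
     (auto intro: complex_differentiable_at_const complex_differentiable_at_add)

lemma complex_differentiable_at_prod:
  "(\<And>x. x \<in> A \<Longrightarrow> complex_differentiable_at (f x) z) \<Longrightarrow> complex_differentiable_at (\<lambda>z. \<Prod>x\<in>A. f x z) z"
  by (induction A rule: infinite_finite_induct)
     (auto intro: complex_differentiable_at_const complex_differentiable_at_mult)

lemma holomorphic_several_cpoly_eval: "holomorphic_several (cpoly_eval p) UNIV"
proof -
  have "complex_differentiable_at (cpoly_eval p) z" for z
    unfolding cpoly_eval_def[abs_def]
    by (intro complex_differentiable_at_sum complex_differentiable_at_mult complex_differentiable_at_prod
        complex_differentiable_at_power complex_differentiable_at_const complex_differentiable_at_nth)
  then show ?thesis unfolding holomorphic_several_def complex_differentiable_at_def by simp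
qed

lemma holomorphic_several_imp_continuous_on:
  "holomorphic_several f U \<Longrightarrow> continuous_on U f"
  unfolding holomorphic_several_def
  by (meson continuous_at_imp_continuous_on has_derivative_continuous)

text \<open>The chain rule: complex linearity turns the real derivative along a holomorphic curve into
  multiplication by a complex number.\<close>

lemma holomorphic_several_compose_curve:
  fixes \<gamma> :: "complex \<Rightarrow> complex ^ 'n::finite"
  assumes f: "holomorphic_several f U" and \<gamma>: "\<And>i. (\<lambda>t. \<gamma> t $ i) holomorphic_on T"
    and "open T" "\<And>t. t \<in> T \<Longrightarrow> \<gamma> t \<in> U"
  shows "(\<lambda>t. f (\<gamma> t)) holomorphic_on T"
proof -
  have "\<exists>D. ((\<lambda>t. f (\<gamma> t)) has_field_derivative D) (at t)" if t: "t \<in> T" for t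
  proof -
    have "\<forall>i. \<exists>d. ((\<lambda>t. \<gamma> t $ i) has_field_derivative d) (at t)"
      using \<gamma> t assms(3) holomorphic_on_open by blast
    then obtain d where d: "\<And>i. ((\<lambda>t. \<gamma> t $ i) has_field_derivative d i) (at t)" by metis
    define v where "v = (\<chi> i. d i)"
    have "(\<gamma> has_derivative (\<lambda>h. h *s v)) (at t)"
      unfolding has_derivative_componentwise_within[of \<gamma>]
    proof
      fix b :: "complex ^ 'n" assume "b \<in> Basis"
      then obtain i u where b: "b = axis i u" by (auto simp: Basis_vec_def)
      have "((\<lambda>t. \<gamma> t $ i \<bullet> u) has_derivative (\<lambda>h. (d i * h) \<bullet> u)) (at t)"
        using d[of i] unfolding has_field_derivative_def by (rule has_derivative_inner_left)
      then show "((\<lambda>t. \<gamma> t \<bullet> b) has_derivative (\<lambda>h. (h *s v) \<bullet> b)) (at t)"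
        by (simp add: b inner_axis v_def mult.commute)
    qed
    moreover obtain f' where f': "(f has_derivative f') (at (\<gamma> t))" "\<And>c v. f' (c *s v) = c * f' v"
      using f assms(4)[OF t] unfolding holomorphic_several_def by blast
    ultimately have "((\<lambda>t. f (\<gamma> t)) has_derivative (\<lambda>h. f' (h *s v))) (at t)"
      using has_derivative_compose by blast
    moreover have "(\<lambda>h. f' (h *s v)) = (*) (f' v)" by (auto simp: f'(2) mult.commute)
    ultimately have "((\<lambda>t. f (\<gamma> t)) has_field_derivative f' v) (at t)"
      unfolding has_field_derivative_def by simp
    then show ?thesis by blast
  qed
  then show ?thesis using assms(3) by (simp add: holomorphic_on_open)
qed

lemmas holomorphic_cpoly_eval_curve =
  holomorphic_several_compose_curve[OF holomorphic_several_cpoly_eval]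

lemma continuous_on_cpoly_eval [continuous_intros]:
  "continuous_on S g \<Longrightarrow> continuous_on S (\<lambda>x. cpoly_eval p (g x))"
  using continuous_on_pf_eval[of S g "of_cpoly p"] by simp

lemma open_polydisc: "open (polydisc :: (complex ^ 'n::finite) set)"
proof -
  have "polydisc = (\<Inter>i\<in>UNIV. {z :: complex ^ 'n. norm (z $ i) < 1})" by (auto simp: polydisc_def)
  also have "open \<dots>" by (intro open_INT ballI open_Collect_less continuous_intros) auto
  finally show ?thesis .
qed

lemma open_exterior_polydisc: "open (exterior_polydisc :: (complex ^ 'n::finite) set)"
proof -
  have "exterior_polydisc = (\<Inter>i\<in>UNIV. {z :: complex ^ 'n. 1 < norm (z $ i)})" by (auto simp: exterior_polydisc_def)
  also have "open \<dots>" by (intro open_INT ballI open_Collect_less continuous_intros) auto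
  finally show ?thesis .
qed

lemma vanishing_off_zeros_imp_vanishing:
  fixes h :: "complex ^ 'n::finite \<Rightarrow> complex"
  assumes "open V" "continuous_on V h" "b \<noteq> 0" "\<And>z. z \<in> V \<Longrightarrow> cpoly_eval b z \<noteq> 0 \<Longrightarrow> h z = 0" "z \<in> V"
  shows "h z = 0"
proof (rule ccontr)
  assume "h z \<noteq> 0"
  have "open (V \<inter> h -` (- {0}))"
    by (rule continuous_open_preimage[OF assms(2,1)]) (auto intro: open_Compl)
  moreover have "z \<in> V \<inter> h -` (- {0})" using \<open>h z \<noteq> 0\<close> assms(5) by auto
  ultimately obtain w where "w \<in> V \<inter> h -` (- {0})" "pf_eval (of_cpoly b) w \<noteq> 0"
    using polyfun_nonvanishing_dense[of "of_cpoly b"] assms(3) by (metis empty_iff of_cpoly_eq_0_iff)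
  then show False using assms(4) by auto
qed

section \<open>Coprime representations of rational functions\<close>

lemma is_quotient_cleared:
  assumes "is_quotient f a b" "continuous_on polydisc f" "z \<in> polydisc"
  shows "f z * cpoly_eval b z = cpoly_eval a z"
proof -
  have "f z * cpoly_eval b z - cpoly_eval a z = 0"
    by (rule vanishing_off_zeros_imp_vanishing[OF open_polydisc, of _ b])
       (use assms in \<open>auto simp: is_quotient_def intro!: continuous_intros\<close>)
  then show ?thesis by simp
qed

lemma is_quotientI_cleared:
  assumes "b \<noteq> 0" "\<And>z. z \<in> polydisc \<Longrightarrow> f z * cpoly_eval b z = cpoly_eval a z"
  shows "is_quotient f a b"
  unfolding is_quotient_def
proof (intro conjI ballI impI)
  fix z assume "z \<in> polydisc" "cpoly_eval b z \<noteq> 0"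
  then show "f z = cpoly_eval a z / cpoly_eval b z" using assms(2)[of z] by (simp add: field_simps)
qed (use assms in auto)

text \<open>A denominator of least degree gives a coprime representation, since cancelling a common factor
  lowers the degree; at the zeros of that factor the equation persists by continuity.\<close>

lemma exists_coprime_quotient:
  assumes "rational f" "continuous_on polydisc f"
  shows "\<exists>a b. is_quotient f a b \<and> cpoly_coprime a b"
proof -
  obtain a0 b0 where "is_quotient f a0 b0" using assms(1) unfolding rational_def by blast
  have "\<exists>b. (\<exists>a. is_quotient f a b) \<and> (\<forall>b'. (\<exists>a. is_quotient f a b') \<longrightarrow> sum_deg (of_cpoly b) \<le> sum_deg (of_cpoly b'))"
    by (rule ex_has_least_nat[of "\<lambda>b. \<exists>a. is_quotient f a b"]) (use \<open>is_quotient f a0 b0\<close> in blast)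
  then obtain a b where ab: "is_quotient f a b"
    and min: "\<And>a' b'. is_quotient f a' b' \<Longrightarrow> sum_deg (of_cpoly b) \<le> sum_deg (of_cpoly b')" by blast
  have "c dvd 1" if dvd: "c dvd a" "c dvd b" for c
  proof -
    obtain a' where a': "a = c * a'" using dvd(1) by (elim dvdE)
    obtain b' where b': "b = c * b'" using dvd(2) by (elim dvdE)
    have "b \<noteq> 0" using ab by (simp add: is_quotient_def)
    then have nz: "c \<noteq> 0" "b' \<noteq> 0" using b' by auto
    have "f z * cpoly_eval b' z - cpoly_eval a' z = 0" if z: "z \<in> polydisc" for z
    proof (rule vanishing_off_zeros_imp_vanishing[OF open_polydisc _ nz(1) _ z])
      show "continuous_on polydisc (\<lambda>z. f z * cpoly_eval b' z - cpoly_eval a' z)"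
        by (intro continuous_intros assms(2))
      fix w assume w: "w \<in> polydisc" "cpoly_eval c w \<noteq> 0"
      have "cpoly_eval c w * (f w * cpoly_eval b' w - cpoly_eval a' w) = 0"
        using is_quotient_cleared[OF ab assms(2) w(1)] a' b' by (simp add: algebra_simps)
      then show "f w * cpoly_eval b' w - cpoly_eval a' w = 0" using w(2) by simp
    qed
    then have "is_quotient f a' b'" by (intro is_quotientI_cleared nz) simp
    from min[OF this] have "sum_deg (of_cpoly c) = 0"
      using nz b' sum_deg_mult[of "of_cpoly c" "of_cpoly b'"] by simp
    then have "of_cpoly c dvd 1" using nz by (simp add: polyfun_dvd_1_iff)
    then obtain k where k: "1 = of_cpoly c * k" by (elim dvdE)
    obtain k' where "k = of_cpoly k'" using of_cpoly_surj by blast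
    then have "of_cpoly 1 = of_cpoly (c * k')" using k by simp
    then have "1 = c * k'" by (rule of_cpoly_inject[THEN iffD1])
    then show "c dvd 1" by (rule dvdI)
  qed
  then show ?thesis using ab unfolding cpoly_coprime_def by blast
qed

section \<open>Rational inner functions\<close>

lemma AE_imp_dense:
  fixes P :: "'a::euclidean_space \<Rightarrow> bool"
  assumes "AE x in lborel. P x" "open U" "U \<noteq> {}"
  obtains x where "x \<in> U" "P x"
proof -
  obtain N where N: "{x \<in> space lborel. \<not> P x} \<subseteq> N" "emeasure lborel N = 0" "N \<in> sets lborel"
    using AE_E[OF assms(1)] by blast
  then have "negligible N"
    by (simp add: negligible_iff_null_sets null_sets_completionI null_setsI)
  then have "\<not> U \<subseteq> N" using open_not_negligible[OF assms(2,3)] negligible_subset by blast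
  then show ?thesis using that N(1) by auto
qed

definition torus_point :: "real ^ 'n::finite \<Rightarrow> complex ^ 'n" where
  "torus_point \<theta> = (\<chi> i. cis (\<theta> $ i))"

lemma torus_pointE:
  assumes "z \<in> torus" obtains \<theta> where "z = torus_point \<theta>"
proof
  have "cis (Arg (z $ i)) = z $ i" for i
  proof -
    have "norm (z $ i) = 1" using assms by (simp add: torus_def)
    then show ?thesis using cis_Arg[of "z $ i"] by (cases "z $ i = 0") (auto simp: sgn_eq)
  qed
  then show "z = torus_point (\<chi> i. Arg (z $ i))" by (simp add: torus_point_def vec_eq_iff)
qed

text \<open>Wherever the radial limit \<open>L\<close> exists, \<open>p = L q\<close>, so \<open>|p| = |q|\<close> there, even if the denominator vanishes.
  Such points are dense because they have full measure, and both sides are continuous.\<close>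

lemma inner_numerator_denominator_torus:
  assumes inner: "inner_function \<phi>"
    and pq: "\<And>z. z \<in> polydisc \<Longrightarrow> \<phi> z * cpoly_eval q z = cpoly_eval p z"
    and z: "z \<in> torus"
  shows "norm (cpoly_eval p z) = norm (cpoly_eval q z)"
proof (rule ccontr)
  assume neq: "\<not> ?thesis"
  obtain \<theta>0 where \<theta>0: "z = torus_point \<theta>0" using torus_pointE[OF z] .
  have cont: "continuous_on UNIV (torus_point :: real ^ 'a \<Rightarrow> _)"
    unfolding torus_point_def by (intro continuous_intros)
  define U where "U = {\<theta>. norm (cpoly_eval p (torus_point \<theta>)) \<noteq> norm (cpoly_eval q (torus_point \<theta>))}"
  have "open U" unfolding U_def by (intro open_Collect_neq continuous_intros cont)
  have "U \<noteq> {}" using neq \<theta>0 by (auto simp: U_def)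
  have "AE \<theta> in (lborel :: (real ^ 'a) measure).
        \<exists>L. ((\<lambda>r. \<phi> (r *\<^sub>R (\<chi> i. cis (\<theta> $ i)))) \<longlongrightarrow> L) (at_left 1) \<and> norm L = 1"
    using inner unfolding inner_function_def by blast
  then obtain \<theta> where "\<theta> \<in> U"
      "\<exists>L. ((\<lambda>r. \<phi> (r *\<^sub>R (\<chi> i. cis (\<theta> $ i)))) \<longlongrightarrow> L) (at_left 1) \<and> norm L = 1"
    by (rule AE_imp_dense[OF _ \<open>open U\<close> \<open>U \<noteq> {}\<close>])
  then obtain L where \<theta>: "\<theta> \<in> U"
      "((\<lambda>r. \<phi> (r *\<^sub>R torus_point \<theta>)) \<longlongrightarrow> L) (at_left 1)" "norm L = 1"
    unfolding torus_point_def by blast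
  have lim: "((\<lambda>r. cpoly_eval f (r *\<^sub>R torus_point \<theta>)) \<longlongrightarrow> cpoly_eval f (torus_point \<theta>)) (at_left 1)" for f
  proof -
    have "continuous_on UNIV (\<lambda>r::real. cpoly_eval f (r *\<^sub>R torus_point \<theta>))" by (intro continuous_intros)
    then have "isCont (\<lambda>r::real. cpoly_eval f (r *\<^sub>R torus_point \<theta>)) 1" by (simp add: continuous_on_eq_continuous_at)
    then have "((\<lambda>r. cpoly_eval f (r *\<^sub>R torus_point \<theta>)) \<longlongrightarrow> cpoly_eval f (1 *\<^sub>R torus_point \<theta>)) (at_left 1)"
      unfolding isCont_def by (rule tendsto_within_subset) simp
    then show ?thesis by simp
  qed
  have "eventually (\<lambda>r. \<phi> (r *\<^sub>R torus_point \<theta>) * cpoly_eval q (r *\<^sub>R torus_point \<theta>) = cpoly_eval p (r *\<^sub>R torus_point \<theta>)) (at_left (1::real))"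
    using eventually_at_left_real[of 0 1, OF zero_less_one]
  proof eventually_elim
    case (elim r)
    then have "r *\<^sub>R torus_point \<theta> \<in> polydisc" by (auto simp: polydisc_def torus_point_def)
    then show ?case by (rule pq)
  qed
  moreover have "((\<lambda>r. \<phi> (r *\<^sub>R torus_point \<theta>) * cpoly_eval q (r *\<^sub>R torus_point \<theta>)) \<longlongrightarrow> L * cpoly_eval q (torus_point \<theta>)) (at_left 1)"
    by (intro tendsto_intros \<theta>(2) lim)
  ultimately have "((\<lambda>r. cpoly_eval p (r *\<^sub>R torus_point \<theta>)) \<longlongrightarrow> L * cpoly_eval q (torus_point \<theta>)) (at_left 1)"
    by (rule Lim_transform_eventually[rotated])
  then have "cpoly_eval p (torus_point \<theta>) = L * cpoly_eval q (torus_point \<theta>)"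
    using tendsto_unique[OF _ lim[of p]] by simp
  then have "norm (cpoly_eval p (torus_point \<theta>)) = norm (cpoly_eval q (torus_point \<theta>))"
    using \<theta>(3) by (simp add: norm_mult)
  with \<theta>(1) show False by (simp add: U_def)
qed

text \<open>Multiplication by \<open>Q\<close> compensates for its zeros on the circle: up to an error that tends to \<open>0\<close> at the
  circle, \<open>|u|\<^sup>k |Q|\<close> is at most \<open>|Q|\<close> there. By the maximum principle \<open>|u(0)|\<^sup>k |Q(0)|\<close> is at most the
  maximum of \<open>|Q|\<close> for every \<open>k\<close>, which forces \<open>|u(0)| \<le> 1\<close>.\<close>

lemma bounded_quotient_le_1:
  fixes u P Q :: "complex \<Rightarrow> complex"
  assumes hol: "u holomorphic_on ball 0 1" "Q holomorphic_on ball 0 1"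
    and cont: "continuous_on (cball 0 1) P" "continuous_on (cball 0 1) Q"
    and quot: "\<And>l. norm l < 1 \<Longrightarrow> u l * Q l = P l"
    and circle: "\<And>l. norm l = 1 \<Longrightarrow> norm (P l) = norm (Q l)"
    and bound: "\<And>l. norm l < 1 \<Longrightarrow> norm (u l) \<le> M"
    and "Q 0 \<noteq> 0"
  shows "norm (u 0) \<le> 1"
proof -
  have "M \<ge> 0" using bound[of 0] norm_ge_zero[of "u 0"] by (simp del: norm_ge_zero)
  have "bounded (Q ` cball 0 1)" by (intro compact_imp_bounded compact_continuous_image cont) auto
  then obtain C where "\<forall>x\<in>Q ` cball 0 1. norm x \<le> C" unfolding bounded_iff by blast
  then have C: "\<And>l. norm l \<le> 1 \<Longrightarrow> norm (Q l) \<le> C" by auto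
  have near: "\<exists>r>0. r < 1 \<and> (\<forall>l. norm l = r \<longrightarrow> norm (P l) \<le> norm (Q l) + e)" if "e > 0" for e
  proof -
    have "uniformly_continuous_on (cball 0 1) (\<lambda>l. norm (P l) - norm (Q l))"
      by (intro compact_uniformly_continuous continuous_intros cont) auto
    then obtain d where d: "d > 0" "\<And>x y. x \<in> cball 0 1 \<Longrightarrow> y \<in> cball 0 1 \<Longrightarrow> dist y x < d \<Longrightarrow>
        dist (norm (P y) - norm (Q y)) (norm (P x) - norm (Q x)) < e"
      using \<open>e > 0\<close> unfolding uniformly_continuous_on_def by meson
    define r where "r = max (1/2) (1 - d/2)"
    have r: "0 < r" "r < 1" "1 - r < d" using d(1) by (auto simp: r_def)
    have "norm (P l) \<le> norm (Q l) + e" if l: "norm l = r" for l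
    proof -
      define x where "x = l / of_real r"
      have x: "norm x = 1" using l r by (simp add: x_def norm_divide)
      have "l = of_real r * x" using r by (simp add: x_def)
      then have "l - x = of_real (r - 1) * x" by (simp add: algebra_simps)
      then have "dist l x < d" using r x by (simp add: dist_norm norm_mult del: of_real_diff)
      then have "dist (norm (P l) - norm (Q l)) (norm (P x) - norm (Q x)) < e"
        using d(2)[of x l] x l r by simp
      then show ?thesis using circle[OF x] by (simp add: dist_norm)
    qed
    then show ?thesis using r by blast
  qed
  have power_bound: "norm (u 0) ^ k * norm (Q 0) \<le> C" for k
  proof (rule field_le_epsilon)
    fix e :: real assume "e > 0"
    \<comment> \<open>An error d in |P| = |u| |Q| grows to d times the sum of M^j for j < k in the k-th power.\<close>
    define K where "K = (\<Sum>j<k. M ^ j) + 1"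
    have "K > 0" unfolding K_def using \<open>M \<ge> 0\<close> by (intro add_nonneg_pos sum_nonneg) auto
    obtain r where r: "0 < r" "r < 1" "\<And>l. norm l = r \<Longrightarrow> norm (P l) \<le> norm (Q l) + e / K"
      using near[of "e / K"] \<open>e > 0\<close> \<open>K > 0\<close> by auto
    have on_circle: "norm (u l) ^ j * norm (Q l) \<le> norm (Q l) + e / K * (\<Sum>i<j. M ^ i)" if l: "norm l = r" for l j
    proof (induction j)
      case (Suc j)
      have ul: "norm (u l) \<le> M" using bound[of l] l r by simp
      have "norm (u l) ^ Suc j * norm (Q l) = norm (u l) ^ j * norm (P l)"
        using quot[of l] l r by (simp flip: norm_mult add: mult_ac)
      also have "\<dots> \<le> norm (u l) ^ j * (norm (Q l) + e / K)"
        using r(3)[OF l] by (intro mult_left_mono) auto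
      also have "\<dots> \<le> norm (u l) ^ j * norm (Q l) + M ^ j * (e / K)"
        unfolding distrib_left using ul \<open>e > 0\<close> \<open>K > 0\<close>
        by (intro add_left_mono mult_right_mono power_mono) auto
      also have "\<dots> \<le> norm (Q l) + e / K * (\<Sum>i<j. M ^ i) + M ^ j * (e / K)"
        using Suc by simp
      finally show ?case by (simp add: algebra_simps)
    qed simp
    have "norm (u 0 ^ k * Q 0) \<le> C + e"
    proof (rule maximum_modulus_frontier[where S = "cball 0 r" and f = "\<lambda>l. u l ^ k * Q l"])
      have hol': "(\<lambda>l. u l ^ k * Q l) holomorphic_on ball 0 1" by (intro holomorphic_intros hol)
      have sub: "cball (0::complex) r \<subseteq> ball 0 1" using r by auto
      show "(\<lambda>l. u l ^ k * Q l) holomorphic_on interior (cball 0 r)"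
        by (rule holomorphic_on_subset[OF hol']) (use sub in auto)
      show "continuous_on (closure (cball 0 r)) (\<lambda>l. u l ^ k * Q l)"
        by (rule continuous_on_subset[OF holomorphic_on_imp_continuous_on[OF hol']]) (use sub in auto)
      fix l :: complex assume "l \<in> frontier (cball 0 r)"
      then have l: "norm l = r" using r by simp
      have "norm (u l ^ k * Q l) \<le> norm (Q l) + e / K * (\<Sum>i<k. M ^ i)"
        using on_circle[OF l, of k] by (simp add: norm_mult norm_power)
      also have "\<dots> \<le> C + e / K * K"
        using C[of l] l r \<open>e > 0\<close> \<open>K > 0\<close> by (intro add_mono mult_left_mono) (auto simp: K_def)
      finally show "norm (u l ^ k * Q l) \<le> C + e" using \<open>K > 0\<close> by simp
    qed (use r in auto)
    then show "norm (u 0) ^ k * norm (Q 0) \<le> C + e" by (simp add: norm_mult norm_power)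
  qed
  show ?thesis
  proof (rule ccontr)
    assume "\<not> ?thesis"
    then obtain k where "C / norm (Q 0) < norm (u 0) ^ k" using real_arch_pow by (metis not_le)
    then show False using power_bound[of k] \<open>Q 0 \<noteq> 0\<close> by (simp add: field_simps)
  qed
qed

text \<open>The previous bound applies on the disc \<open>l \<mapsto> ((l + w\<^sub>i) / (1 + cnj w\<^sub>i l))\<^sub>i\<close>, which has centre \<open>w\<close> and
  boundary on the torus.\<close>

lemma rational_inner_norm_le_1_off_zeros:
  fixes \<phi> :: "complex ^ 'n::finite \<Rightarrow> complex"
  assumes hol: "holomorphic_several \<phi> polydisc" and bdd: "bounded (\<phi> ` polydisc)"
    and pq: "\<And>z. z \<in> polydisc \<Longrightarrow> \<phi> z * cpoly_eval q z = cpoly_eval p z"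
    and torus: "\<And>z. z \<in> torus \<Longrightarrow> norm (cpoly_eval p z) = norm (cpoly_eval q z)"
    and w: "w \<in> polydisc" "cpoly_eval q w \<noteq> 0"
  shows "norm (\<phi> w) \<le> 1"
proof -
  define m where "m l = (\<chi> i. (l + w $ i) / (1 + cnj (w $ i) * l))" for l
  have wi: "norm (w $ i) < 1" for i using w by (simp add: polydisc_def)
  have den: "1 + cnj (w $ i) * l \<noteq> 0" if "norm l \<le> 1" for l i
  proof
    assume "1 + cnj (w $ i) * l = 0"
    then have "cnj (w $ i) * l = - 1" by (simp add: eq_neg_iff_add_eq_0 add.commute)
    then have "norm (w $ i) * norm l = 1" by (metis complex_mod_cnj norm_minus_cancel norm_mult norm_one)
    moreover have "norm (w $ i) * norm l \<le> norm (w $ i) * 1" using that by (intro mult_left_mono) auto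
    ultimately show False using wi[of i] by simp
  qed
  have m_in: "m l \<in> polydisc" if "norm l < 1" for l
  proof -
    have "norm (Moebius_function 0 (- (w $ i)) l) < 1" for i
      by (rule Moebius_function_norm_lt_1) (use wi that in auto)
    then show ?thesis by (simp add: polydisc_def m_def Moebius_function_simple)
  qed
  have m_torus: "m l \<in> torus" if l: "norm l = 1" for l
  proof -
    have "norm (l + w $ i) = norm (1 + cnj (w $ i) * l)" for i
    proof -
      have "l * cnj l = 1" using l by (metis complex_norm_square of_real_1 power_one)
      then have "l + w $ i = l * cnj (1 + cnj (w $ i) * l)" by (simp add: algebra_simps)
      then have "norm (l + w $ i) = norm l * norm (cnj (1 + cnj (w $ i) * l))" by (metis norm_mult)
      then show ?thesis using l by (simp only: complex_mod_cnj)
    qed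
    then show ?thesis using den[of l] l by (simp add: torus_def m_def norm_divide)
  qed
  have cont_m: "continuous_on (cball 0 1) m"
    unfolding m_def by (intro continuous_intros) (use den in auto)
  have hol_m: "(\<lambda>l. m l $ i) holomorphic_on ball 0 1" for i
    unfolding m_def by (simp, intro holomorphic_intros) (use den in auto)
  obtain M where M: "\<And>z. z \<in> polydisc \<Longrightarrow> norm (\<phi> z) \<le> M"
    using bdd unfolding bounded_iff by auto
  have m0: "m 0 = w" by (simp add: m_def vec_eq_iff)
  have "norm (\<phi> (m 0)) \<le> 1"
  proof (rule bounded_quotient_le_1[where P = "\<lambda>l. cpoly_eval p (m l)" and Q = "\<lambda>l. cpoly_eval q (m l)" and M = M])
    show "(\<lambda>l. \<phi> (m l)) holomorphic_on ball 0 1"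
      by (rule holomorphic_several_compose_curve[OF hol hol_m]) (use m_in in auto)
    show "(\<lambda>l. cpoly_eval q (m l)) holomorphic_on ball 0 1"
      by (rule holomorphic_cpoly_eval_curve[OF hol_m]) auto
  qed (use m_in m_torus M pq torus w m0 cont_m in \<open>auto intro!: continuous_intros\<close>)
  then show ?thesis using m0 by simp
qed

text \<open>If \<open>|\<phi>|\<close> attained the value \<open>1\<close> at \<open>w\<close>, then \<open>\<phi>\<close> would be constant on every complex line through \<open>w\<close> by
  the maximum modulus principle.\<close>

lemma rational_inner_norm_lt_1:
  fixes \<phi> :: "complex ^ 'n::finite \<Rightarrow> complex"
  assumes hol: "holomorphic_several \<phi> polydisc" and bdd: "bounded (\<phi> ` polydisc)"
    and pq: "\<And>z. z \<in> polydisc \<Longrightarrow> \<phi> z * cpoly_eval q z = cpoly_eval p z" and "q \<noteq> 0"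
    and torus: "\<And>z. z \<in> torus \<Longrightarrow> norm (cpoly_eval p z) = norm (cpoly_eval q z)"
    and nonconst: "\<not> \<phi> constant_on polydisc" and w: "w \<in> polydisc"
  shows "norm (\<phi> w) < 1"
proof -
  have cont: "continuous_on polydisc \<phi>" by (rule holomorphic_several_imp_continuous_on[OF hol])
  have le: "norm (\<phi> z) \<le> 1" if z: "z \<in> polydisc" for z
  proof -
    have "complex_of_real (max 0 (norm (\<phi> z) - 1)) = 0"
    proof (rule vanishing_off_zeros_imp_vanishing[OF open_polydisc _ \<open>q \<noteq> 0\<close> _ z])
      show "continuous_on polydisc (\<lambda>z. complex_of_real (max 0 (norm (\<phi> z) - 1)))"
        by (intro continuous_intros cont)
      show "complex_of_real (max 0 (norm (\<phi> z) - 1)) = 0" if "z \<in> polydisc" "cpoly_eval q z \<noteq> 0" for z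
        using rational_inner_norm_le_1_off_zeros[OF hol bdd pq torus that] by simp
    qed
    then have "max 0 (norm (\<phi> z) - 1) = 0" by (simp only: of_real_eq_0_iff)
    then show ?thesis by linarith
  qed
  show ?thesis
  proof (rule ccontr)
    assume "\<not> ?thesis"
    then have w1: "norm (\<phi> w) = 1" using le[OF w] by simp
    have "\<phi> z = \<phi> w" if z: "z \<in> polydisc" for z
    proof -
      define \<gamma> where "\<gamma> t = w + t *s (z - w)" for t
      define T where "T = \<gamma> -` polydisc"
      have "open T" unfolding T_def
        by (rule open_vimage[OF open_polydisc]) (unfold \<gamma>_def, intro continuous_intros)
      have "convex T"
      proof (rule convexI)
        fix x y and u v :: real assume xy: "x \<in> T" "y \<in> T" and uv: "0 \<le> u" "0 \<le> v" "u + v = 1"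
        have "norm (\<gamma> (u *\<^sub>R x + v *\<^sub>R y) $ i) < 1" for i
        proof -
          have "\<gamma> x $ i \<in> ball 0 1" "\<gamma> y $ i \<in> ball 0 1" using xy by (auto simp: T_def polydisc_def)
          then have "u *\<^sub>R (\<gamma> x $ i) + v *\<^sub>R (\<gamma> y $ i) \<in> ball 0 1"
            by (rule convexD[OF convex_ball]) (use uv in auto)
          moreover have "\<gamma> (u *\<^sub>R x + v *\<^sub>R y) $ i = u *\<^sub>R (\<gamma> x $ i) + v *\<^sub>R (\<gamma> y $ i)"
          proof -
            have v: "v = 1 - u" using uv(3) by simp
            show ?thesis unfolding v by (simp add: \<gamma>_def scaleR_conv_of_real algebra_simps)
          qed
          ultimately show ?thesis by simp
        qed
        then show "u *\<^sub>R x + v *\<^sub>R y \<in> T" by (simp add: T_def polydisc_def)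
      qed
      have "(\<lambda>t. \<phi> (\<gamma> t)) constant_on T"
      proof (rule maximum_modulus_principle[where U = T and \<xi> = 0])
        show "(\<lambda>t. \<phi> (\<gamma> t)) holomorphic_on T"
          by (rule holomorphic_several_compose_curve[OF hol _ \<open>open T\<close>])
             (auto simp: T_def \<gamma>_def intro!: holomorphic_intros)
        show "0 \<in> T" using w by (simp add: T_def \<gamma>_def)
        show "norm (\<phi> (\<gamma> t)) \<le> norm (\<phi> (\<gamma> 0))" if "t \<in> T" for t
          using le[of "\<gamma> t"] that w1 by (simp add: T_def) (simp add: \<gamma>_def)
      qed (use \<open>open T\<close> \<open>convex T\<close> convex_connected in auto)
      moreover have "0 \<in> T" "1 \<in> T" using w z by (auto simp: T_def \<gamma>_def)
      ultimately have "\<phi> (\<gamma> 1) = \<phi> (\<gamma> 0)" unfolding constant_on_def by metis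
      then show ?thesis by (simp add: \<gamma>_def)
    qed
    then have "\<phi> constant_on polydisc" unfolding constant_on_def by blast
    with nonconst show False by blast
  qed
qed

section \<open>Reflection in the torus\<close>

text \<open>For real \<open>t\<close> the curve is on the torus, and for \<open>t = \<i>\<close> it can reach any point without zero
  coordinates. Along it, an identity on the torus extends by the identity theorem in one variable.\<close>

definition torus_curve :: "real ^ 'n::finite \<Rightarrow> real ^ 'n \<Rightarrow> complex \<Rightarrow> complex ^ 'n" where
  "torus_curve x y t = (\<chi> k. exp (\<i> * (of_real (x $ k) + t * of_real (y $ k))))"

lemma torus_curve_real: "t \<in> \<real> \<Longrightarrow> torus_curve x y t \<in> torus"
  by (auto simp: torus_curve_def torus_def elim!: Reals_cases)

lemma torus_curve_holomorphic: "(\<lambda>t. torus_curve x y t $ k) holomorphic_on T"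
  unfolding torus_curve_def by (simp, intro holomorphic_intros)

lemma continuous_on_torus_curve [continuous_intros]:
  "continuous_on S f \<Longrightarrow> continuous_on S (\<lambda>t. torus_curve x y (f t))"
  unfolding torus_curve_def by (intro continuous_intros)

lemma torus_curve_cnj: "torus_curve x y (cnj t) = (\<chi> k. inverse (cnj (torus_curve x y t $ k)))"
  by (simp add: torus_curve_def vec_eq_iff exp_cnj flip: exp_minus)

lemma torus_curve_reaches:
  assumes "\<And>k. z $ k \<noteq> 0"
  obtains x y where "torus_curve x y \<i> = z"
proof
  define c where "c k = - \<i> * Ln (z $ k)" for k
  show "torus_curve (\<chi> k. Re (c k)) (\<chi> k. Im (c k)) \<i> = z"
  proof -
    have "\<i> * (of_real (Re (c k)) + \<i> * of_real (Im (c k))) = Ln (z $ k)" for k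
      by (simp add: complex_eq[symmetric]) (simp add: c_def)
    then show ?thesis using assms by (simp add: torus_curve_def vec_eq_iff)
  qed
qed

definition reflect :: "complex ^ 'n::finite \<Rightarrow> complex ^ 'n" where
  "reflect z = (\<chi> k. inverse (cnj (z $ k)))"

lemma reflect_exterior: "z \<in> exterior_polydisc \<Longrightarrow> reflect z \<in> polydisc"
  by (auto simp: exterior_polydisc_def polydisc_def reflect_def norm_inverse intro!: inverse_less_1_iff[THEN iffD2])

lemma reflection_identity:
  assumes torus: "\<And>z. z \<in> torus \<Longrightarrow> norm (cpoly_eval p z) = norm (cpoly_eval q z)"
    and nz: "\<And>k. z $ k \<noteq> 0"
  shows "cpoly_eval p z * cnj (cpoly_eval p (reflect z)) = cpoly_eval q z * cnj (cpoly_eval q (reflect z))"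
proof -
  obtain x y where xy: "torus_curve x y \<i> = z" using torus_curve_reaches[OF nz] .
  define h where "h f t = cpoly_eval f (torus_curve x y t)" for f t
  have hol: "h f holomorphic_on UNIV" for f
    unfolding h_def[abs_def] by (rule holomorphic_cpoly_eval_curve[OF torus_curve_holomorphic]) auto
  have hol': "(\<lambda>t. cnj (h f (cnj t))) holomorphic_on UNIV" for f
    using holomorphic_on_compose_cnj_cnj[OF holomorphic_on_subset[OF hol[of f]], of UNIV] by (simp add: o_def)
  have "h p \<i> * cnj (h p (cnj \<i>)) - h q \<i> * cnj (h q (cnj \<i>)) = 0"
  proof (rule entire_zero_on_reals[of "\<lambda>t. h p t * cnj (h p (cnj t)) - h q t * cnj (h q (cnj t))"])
    show "(\<lambda>t. h p t * cnj (h p (cnj t)) - h q t * cnj (h q (cnj t))) holomorphic_on UNIV"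
      by (intro holomorphic_intros hol hol')
    fix t :: complex assume t: "t \<in> \<real>"
    then have "norm (h p t) = norm (h q t)" unfolding h_def by (intro torus torus_curve_real)
    then have "h p t * cnj (h p t) = h q t * cnj (h q t)" by (metis complex_norm_square)
    then show "h p t * cnj (h p (cnj t)) - h q t * cnj (h q (cnj t)) = 0" using t by (simp add: Reals_cnj_iff)
  qed
  then show ?thesis unfolding h_def torus_curve_cnj xy reflect_def by simp
qed

section \<open>Hypersurfaces avoiding the polydisc and its exterior are toral\<close>

text \<open>The restrictions of \<open>a\<close> to the lines through \<open>0\<close> and the points of a torus curve through \<open>w\<close> form a
  holomorphic family of univariate polynomials. For real \<open>t\<close> all roots are unimodular, so they lie over
  points of the torus, where \<open>f\<close> vanishes.\<close>

lemma toral_off_coordinate_hyperplanes: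
  fixes a :: "'n::finite cpoly"
  assumes disc: "cpoly_zeros a \<inter> polydisc = {}" and ext: "cpoly_zeros a \<inter> exterior_polydisc = {}"
    and f: "f \<in> Hol (cpoly_zeros a)" "\<And>z. z \<in> torus \<inter> cpoly_zeros a \<Longrightarrow> f z = 0"
    and w: "w \<in> cpoly_zeros a" "\<And>k. w $ k \<noteq> 0"
  shows "f w = 0"
proof -
  obtain x y where xy: "torus_curve x y \<i> = w" using torus_curve_reaches[OF w(2)] .
  let ?\<gamma> = "torus_curve x y"
  define K where "K = Poly_Mapping.keys a"
  define deg where "deg m = (\<Sum>i\<in>UNIV. Poly_Mapping.lookup m i)" for m :: "'n \<Rightarrow>\<^sub>0 nat"
  define P where "P t = (\<Sum>m\<in>K. monom (Poly_Mapping.lookup a m * monomial_eval m (?\<gamma> t)) (deg m))" for t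
  have finK: "finite K" by (simp add: K_def)
  have P: "poly (P t) l = cpoly_eval a (l *s ?\<gamma> t)" for t l
  proof -
    have "monomial_eval m (l *s z) = monomial_eval m z * l ^ deg m" for m and z :: "complex ^ 'n"
      by (simp add: monomial_eval_def deg_def power_mult_distrib prod.distrib power_sum mult.commute)
    then show ?thesis
      by (simp add: P_def poly_sum poly_monom cpoly_eval_eq_sum_superset[OF finite_keys order.refl] K_def mult_ac)
  qed
  have hol: "(\<lambda>t. coeff (P t) k) holomorphic_on UNIV" for k
  proof -
    have "(\<lambda>t. cpoly_eval (Poly_Mapping.single m 1) (?\<gamma> t)) holomorphic_on UNIV" for m
      by (rule holomorphic_cpoly_eval_curve[OF torus_curve_holomorphic]) auto
    then have "(\<lambda>t. monomial_eval m (?\<gamma> t)) holomorphic_on UNIV" for m by simp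
    then have "(\<lambda>t. if deg m = k then Poly_Mapping.lookup a m * monomial_eval m (?\<gamma> t) else 0) holomorphic_on UNIV" for m
      by (cases "deg m = k") (auto intro!: holomorphic_intros)
    then show ?thesis unfolding P_def coeff_sum coeff_monom by (intro holomorphic_intros)
  qed
  define c where "c = cpoly_eval a 0"
  have c: "c \<noteq> 0" using disc by (auto simp: c_def cpoly_zeros_def polydisc_def)
  have const: "coeff (P t) 0 = c" for t using P[of t 0] by (simp add: poly_0_coeff_0 c_def)
  have bound: "degree (P t) \<le> Max (insert 0 (deg ` K))" for t
    unfolding P_def
  proof (rule degree_sum_le[OF finK])
    fix m assume "m \<in> K"
    then have "deg m \<le> Max (insert 0 (deg ` K))" using finK by (intro Max_ge) auto
    then show "degree (monom (Poly_Mapping.lookup a m * monomial_eval m (?\<gamma> t)) (deg m)) \<le> Max (insert 0 (deg ` K))"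
      using degree_monom_le order.trans by blast
  qed
  have unim: "norm l = 1" if t: "t \<in> \<real>" and root: "poly (P t) l = 0" for t l
  proof -
    have coord: "norm ((l *s ?\<gamma> t) $ k) = norm l" for k
      using torus_curve_real[OF t, of x y] by (simp add: torus_def norm_mult)
    have "l *s ?\<gamma> t \<in> cpoly_zeros a" using root P by (simp add: cpoly_zeros_def)
    then have "l *s ?\<gamma> t \<notin> polydisc" "l *s ?\<gamma> t \<notin> exterior_polydisc" using disc ext by auto
    then have "\<not> norm l < 1" "\<not> norm l > 1"
      unfolding polydisc_def exterior_polydisc_def mem_Collect_eq coord by auto
    then show ?thesis by simp
  qed
  obtain D where D: "\<And>t. degree (P t) = D"
    using degree_constant_of_unimodular_roots[of P, OF hol bound const c] unim by blast
  have "f (1 *s ?\<gamma> \<i>) = 0"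
  proof (rule vanishing_on_root_family[where F = "\<lambda>t l. f (l *s ?\<gamma> t)" and P = P and l = 1 and t = \<i>, OF hol D])
    show "P t \<noteq> 0" for t using const[of t] c by auto
    show "poly (P \<i>) 1 = 0" using w(1) by (simp add: P xy cpoly_zeros_def)
    show "f (l *s ?\<gamma> t) = 0" if "t \<in> \<real>" "poly (P t) l = 0" for t l
    proof (rule f(2))
      have "norm l = 1" using unim that by blast
      then show "l *s ?\<gamma> t \<in> torus \<inter> cpoly_zeros a"
        using torus_curve_real[OF that(1), of x y] that(2) P by (simp add: torus_def cpoly_zeros_def norm_mult)
    qed
    fix t0 l0 assume root: "poly (P t0) l0 = 0"
    then have "l0 *s ?\<gamma> t0 \<in> cpoly_zeros a" using P by (simp add: cpoly_zeros_def)
    then obtain U g where U: "open U" "l0 *s ?\<gamma> t0 \<in> U" "holomorphic_several g U"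
        "\<And>z. z \<in> U \<inter> cpoly_zeros a \<Longrightarrow> g z = f z"
      using f(1) unfolding Hol_def by blast
    have "open ((\<lambda>(t, l). l *s ?\<gamma> t) -` U)"
      by (rule open_vimage[OF U(1)]) (auto intro!: continuous_intros simp: case_prod_unfold)
    moreover have "(t0, l0) \<in> (\<lambda>(t, l). l *s ?\<gamma> t) -` U" using U(2) by simp
    ultimately obtain A B where AB: "open A" "open B" "(t0, l0) \<in> A \<times> B" "A \<times> B \<subseteq> (\<lambda>(t, l). l *s ?\<gamma> t) -` U"
      by (rule open_prod_elim)
    obtain e1 where e1: "e1 > 0" "ball t0 e1 \<subseteq> A" using AB open_contains_ball by blast
    obtain e2 where e2: "e2 > 0" "ball l0 e2 \<subseteq> B" using AB open_contains_ball by blast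
    define e where "e = min e1 e2"
    have in_U: "l *s ?\<gamma> t \<in> U" if "t \<in> ball t0 e" "l \<in> ball l0 e" for t l
    proof -
      have "t \<in> A" "l \<in> B" using that e1 e2 by (auto simp: e_def)
      then show ?thesis using AB(4) by auto
    qed
    have "extends_on_roots P (\<lambda>t l. f (l *s ?\<gamma> t)) t0 l0 e (\<lambda>t l. g (l *s ?\<gamma> t))"
      unfolding extends_on_roots_def
    proof (intro conjI ballI impI)
      show "e > 0" using e1 e2 by (simp add: e_def)
      show "continuous_on (ball t0 e \<times> ball l0 e) (\<lambda>(t, l). g (l *s ?\<gamma> t))"
        unfolding case_prod_unfold
        by (rule continuous_on_compose2[OF holomorphic_several_imp_continuous_on[OF U(3)]])
           (use in_U in \<open>auto intro!: continuous_intros\<close>)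
      show "(\<lambda>t. g (l *s ?\<gamma> t)) holomorphic_on ball t0 e" if "l \<in> ball l0 e" for l
        by (rule holomorphic_several_compose_curve[OF U(3)])
           (use in_U that torus_curve_holomorphic in \<open>auto intro!: holomorphic_intros\<close>)
      show "(\<lambda>l. g (l *s ?\<gamma> t)) holomorphic_on ball l0 e" if "t \<in> ball t0 e" for t
        by (rule holomorphic_several_compose_curve[OF U(3)])
           (use in_U that in \<open>auto intro!: holomorphic_intros\<close>)
      show "g (l *s ?\<gamma> t) = f (l *s ?\<gamma> t)" if "t \<in> ball t0 e" "l \<in> ball l0 e" "poly (P t) l = 0" for t l
        using U(4) in_U that P by (simp add: cpoly_zeros_def)
    qed
    then show "\<exists>e G. extends_on_roots P (\<lambda>t l. f (l *s ?\<gamma> t)) t0 l0 e G" by blast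
  qed
  then show ?thesis by (simp add: xy)
qed

lemma sum_deg_var: "sum_deg (pf_var i :: 'n::finite polyfun) = 1"
proof -
  have "deg_in j (pf_var i :: 'n polyfun) = (if j = i then 1 else 0)" for j
  proof (cases "j = i")
    case True
    have "expand_in i (pf_var i :: 'n polyfun) = monom 1 1" using expand_in_var_power[of i 1] by simp
    then show ?thesis using True by (simp add: deg_in_def degree_monom_eq)
  next
    case False
    then have "(pf_var i :: 'n polyfun) \<in> poly_in (-{j})" by (intro poly_in_var) auto
    then show ?thesis using False by (simp add: deg_in_eq_0_iff)
  qed
  then show ?thesis by (simp add: sum_deg_def)
qed

text \<open>A prime divisor of \<open>z\<^sub>i\<close> is a constant multiple of \<open>z\<^sub>i\<close> by comparison of degrees.\<close>

lemma prime_not_dvd_var: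
  assumes g: "prime_elem g" "pf_eval g 0 \<noteq> 0"
  shows "\<not> g dvd pf_var i"
proof
  assume "g dvd pf_var i"
  then obtain k where k: "pf_var i = g * k" by (elim dvdE)
  have "pf_eval (pf_var i :: 'a polyfun) (\<chi> j. 1) \<noteq> pf_eval 0 (\<chi> j. 1)" by simp
  then have "pf_var i \<noteq> (0 :: 'a polyfun)" by metis
  then have nz: "g \<noteq> 0" "k \<noteq> 0" using k by auto
  have "sum_deg g > 0" using g(1) nz polyfun_dvd_1_iff[of g] prime_elem_not_unit by auto
  then have "sum_deg k = 0" using sum_deg_mult[OF nz] sum_deg_var[of i] k by simp
  then have k_const: "k = pf_const (pf_eval k 0)" by (rule sum_deg_eq_0D)
  have "pf_eval g 0 * pf_eval k 0 = 0" using arg_cong[OF k, of "\<lambda>f. pf_eval f 0"] by simp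
  then have "pf_eval k 0 = 0" using g(2) by simp
  then have "k = 0" using k_const by (intro polyfun_eqI) (metis pf_eval_const pf_eval_simps(1))
  with nz show False by simp
qed

text \<open>Zeros with a zero coordinate are limits of zeros without one: \<open>a\<close> does not vanish at \<open>0\<close>, so no prime
  factor of \<open>a\<close> divides the product of the variables, and Study's lemma applies.\<close>

lemma toral_of_avoiding:
  fixes a :: "'n::finite cpoly"
  assumes disc: "cpoly_zeros a \<inter> polydisc = {}" and ext: "cpoly_zeros a \<inter> exterior_polydisc = {}"
  shows "toral (cpoly_zeros a)"
  unfolding toral_def determining_def
proof (intro ballI impI)
  fix f w assume f: "f \<in> Hol (cpoly_zeros a)" "\<forall>z\<in>torus \<inter> cpoly_zeros a. f z = 0" and w: "w \<in> cpoly_zeros a"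
  show "f w = 0"
  proof (rule ccontr)
    assume "f w \<noteq> 0"
    obtain U g where U: "open U" "w \<in> U" "holomorphic_several g U" "\<And>z. z \<in> U \<inter> cpoly_zeros a \<Longrightarrow> g z = f z"
      using f(1) w unfolding Hol_def by blast
    have "g w \<noteq> 0" using U w \<open>f w \<noteq> 0\<close> by auto
    have a0: "pf_eval (of_cpoly a) 0 \<noteq> 0" using disc by (auto simp: cpoly_zeros_def polydisc_def)
    then have "of_cpoly a \<noteq> 0" by auto
    moreover have "pf_eval (of_cpoly a) w = 0" using w by (simp add: cpoly_zeros_def)
    ultimately obtain h where h: "prime_elem h" "h dvd of_cpoly a" "pf_eval h w = 0"
      using pf_prime_zero_divisor by blast
    obtain k where k: "of_cpoly a = h * k" using h(2) by (elim dvdE)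
    have "pf_eval h 0 \<noteq> 0" using a0 k by auto
    have "\<not> h dvd (\<Prod>i\<in>A. pf_var i)" if "finite A" for A :: "'n set"
      using that
    proof (induction A rule: finite_induct)
      case empty
      then show ?case using h(1) prime_elem_not_unit by simp
    next
      case (insert i A)
      then show ?case
        using prime_not_dvd_var[OF h(1) \<open>pf_eval h 0 \<noteq> 0\<close>] prime_elem_dvd_mult_iff[OF h(1)] by simp
    qed
    then have not_dvd: "\<not> h dvd (\<Prod>i\<in>UNIV. pf_var i)" by simp
    define V where "V = U \<inter> g -` (- {0})"
    have "open V" unfolding V_def
      by (rule continuous_open_preimage[OF holomorphic_several_imp_continuous_on[OF U(3)] U(1)]) (auto intro: open_Compl)
    moreover have "w \<in> V" using U(2) \<open>g w \<noteq> 0\<close> by (simp add: V_def)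
    ultimately obtain z where z: "z \<in> V" "pf_eval h z = 0" "pf_eval (\<Prod>i\<in>UNIV. pf_var i) z \<noteq> 0"
      using prime_zeros_not_contained[OF h(1) not_dvd h(3)] by blast
    have "pf_eval (of_cpoly a) z = 0" unfolding k using z by simp
    then have za: "z \<in> cpoly_zeros a" by (simp add: cpoly_zeros_def)
    have "\<And>k. z $ k \<noteq> 0" using z(3) by (simp add: pf_eval_prod)
    then have "f z = 0"
      using toral_off_coordinate_hyperplanes[OF disc ext f(1) _ za] f(2) by blast
    then show False using U(4) z(1) za by (auto simp: V_def)
  qed
qed

section \<open>The level sets of a rational inner function\<close>

lemma numerator_coprime:
  assumes "rational f" "continuous_on polydisc f"
  shows "\<exists>b. is_quotient f (numerator f) b \<and> cpoly_coprime (numerator f) b"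
  unfolding numerator_def by (rule someI_ex) (rule exists_coprime_quotient[OF assms])

lemma rational_diff_const:
  assumes "rational f"
  shows "rational (\<lambda>z. f z - c)"
proof -
  obtain a b where ab: "is_quotient f a b" using assms unfolding rational_def by blast
  have "is_quotient (\<lambda>z. f z - c) (a - Poly_Mapping.single 0 c * b) b"
    using ab unfolding is_quotient_def by (simp add: diff_divide_distrib)
  then show ?thesis unfolding rational_def by blast
qed

lemma no_common_prime_sym: "no_common_prime a b \<Longrightarrow> no_common_prime b a"
  unfolding no_common_prime_def by blast

lemma no_common_prime_add_mult:
  assumes "no_common_prime a b"
  shows "no_common_prime (a + c * b) b"
  unfolding no_common_prime_def
proof (intro allI impI notI)
  fix g assume g: "prime_elem g" "g dvd a + c * b" "g dvd b"
  have "g dvd (a + c * b) - c * b" by (rule dvd_diff[OF g(2) dvd_mult[OF g(3)]])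
  then show False using assms g unfolding no_common_prime_def by simp
qed

text \<open>The polynomial \<open>b\<close> itself is a holomorphic function that vanishes on the torus part of each component,
  but not on the whole component.\<close>

lemma atoral_of_torus_zeros_in_coprime:
  assumes "a \<noteq> 0" "no_common_prime (of_cpoly a) (of_cpoly b)"
    and "\<And>z. z \<in> torus \<Longrightarrow> cpoly_eval a z = 0 \<Longrightarrow> cpoly_eval b z = 0"
  shows "atoral (cpoly_zeros a)"
  unfolding atoral_def
proof (intro allI impI notI)
  fix V assume V: "irreducible_component V (cpoly_zeros a)" and det: "determining torus V"
  have "V \<subseteq> cpoly_zeros a" using V by (simp add: irreducible_component_def)
  obtain z where z: "z \<in> V" "cpoly_eval b z \<noteq> 0"
    by (rule component_not_in_coprime_zeros[OF V assms(1,2)], rule that)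
  have "cpoly_eval b \<in> Hol V"
    unfolding Hol_def using holomorphic_several_cpoly_eval by blast
  moreover have "\<forall>z\<in>torus \<inter> V. cpoly_eval b z = 0"
    using assms(3) \<open>V \<subseteq> cpoly_zeros a\<close> by (auto simp: cpoly_zeros_def)
  ultimately have "cpoly_eval b z = 0" using det z(1) unfolding determining_def by blast
  with z(2) show False by simp
qed

theorem proposition3p4:
  fixes \<phi> :: "complex ^ 'n::finite \<Rightarrow> complex" and \<alpha> :: complex
  assumes "rational_inner \<phi>"
    and "\<not> \<phi> constant_on polydisc"
  shows "(norm \<alpha> < 1 \<or> norm \<alpha> > 1 \<longrightarrow> atoral (Z_rational (\<lambda>z. \<phi> z - \<alpha>))) \<and>
    (norm \<alpha> = 1 \<longrightarrow> toral (Z_rational (\<lambda>z. \<phi> z - \<alpha>))) \<and>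
    (norm \<alpha> < 1 \<longrightarrow> Z_rational (\<lambda>z. \<phi> z - \<alpha>) \<inter> exterior_polydisc = {}) \<and>
    (norm \<alpha> > 1 \<longrightarrow> Z_rational (\<lambda>z. \<phi> z - \<alpha>) \<inter> polydisc = {}) \<and>
    (norm \<alpha> = 1 \<longrightarrow> Z_rational (\<lambda>z. \<phi> z - \<alpha>) \<inter> polydisc = {} \<and>
                     Z_rational (\<lambda>z. \<phi> z - \<alpha>) \<inter> exterior_polydisc = {})"
proof -
  have inner: "inner_function \<phi>" and rat: "rational \<phi>"
    using assms(1) by (auto simp: rational_inner_def)
  have hol: "holomorphic_several \<phi> polydisc" and bdd: "bounded (\<phi> ` polydisc)"
    using inner by (auto simp: inner_function_def)
  have cont: "continuous_on polydisc (\<lambda>z. \<phi> z - \<alpha>)"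
    using holomorphic_several_imp_continuous_on[OF hol] by (intro continuous_intros)
  define a where "a = numerator (\<lambda>z. \<phi> z - \<alpha>)"
  have Z: "Z_rational (\<lambda>z. \<phi> z - \<alpha>) = cpoly_zeros a" by (simp add: Z_rational_def a_def)
  obtain b where ab: "is_quotient (\<lambda>z. \<phi> z - \<alpha>) a b" "cpoly_coprime a b"
    using numerator_coprime[OF rational_diff_const[OF rat] cont] unfolding a_def by blast
  have "b \<noteq> 0" using ab(1) by (simp add: is_quotient_def)
  define p where "p = a + Poly_Mapping.single 0 \<alpha> * b"
  have p: "cpoly_eval p z = cpoly_eval a z + \<alpha> * cpoly_eval b z" for z by (simp add: p_def)
  have pq: "\<phi> z * cpoly_eval b z = cpoly_eval p z" if "z \<in> polydisc" for z
    using is_quotient_cleared[OF ab(1) cont that] by (simp add: p algebra_simps)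
  have torus: "norm (cpoly_eval p z) = norm (cpoly_eval b z)" if "z \<in> torus" for z
    by (rule inner_numerator_denominator_torus[OF inner pq that])
  have lt1: "norm (\<phi> z) < 1" if "z \<in> polydisc" for z
    by (rule rational_inner_norm_lt_1[OF hol bdd pq \<open>b \<noteq> 0\<close> torus assms(2) that])

  have const_if: "\<phi> constant_on polydisc"
    if c: "\<And>z. z \<in> polydisc \<Longrightarrow> (\<phi> z - c) * cpoly_eval b z = 0" for c
  proof -
    have "\<phi> z - c = 0" if "z \<in> polydisc" for z
      by (rule vanishing_off_zeros_imp_vanishing[OF open_polydisc _ \<open>b \<noteq> 0\<close> _ that])
         (use c holomorphic_several_imp_continuous_on[OF hol] in \<open>auto intro!: continuous_intros\<close>)
    then show ?thesis unfolding constant_on_def by (intro exI[of _ c]) auto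
  qed
  have "a \<noteq> 0"
  proof
    assume "a = 0"
    then have "\<phi> constant_on polydisc" by (intro const_if[of \<alpha>]) (use pq p in \<open>auto simp: algebra_simps\<close>)
    with assms(2) show False by blast
  qed
  have "p \<noteq> 0"
  proof
    assume "p = 0"
    then have "\<phi> constant_on polydisc" by (intro const_if[of 0]) (use pq in auto)
    with assms(2) show False by blast
  qed
  have ncp: "no_common_prime (of_cpoly a) (of_cpoly b)"
    by (rule cpoly_coprime_no_common_prime[OF ab(2)])
  then have ncp_pb: "no_common_prime (of_cpoly p) (of_cpoly b)"
    unfolding p_def of_cpoly_hom by (rule no_common_prime_add_mult)

  \<comment> \<open>Zeros of b in the polydisc are zeros of p = \<phi> b, and p and b have no common factor.\<close>
  have b_disc: "cpoly_eval b z \<noteq> 0" if z: "z \<in> polydisc" for z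
  proof -
    have "pf_eval (of_cpoly b) z \<noteq> 0"
    proof (rule coprime_zeros_not_locally_contained[OF ncp_pb _ open_polydisc _ z])
      show "pf_eval (of_cpoly p) z = 0" if "z \<in> polydisc" "pf_eval (of_cpoly b) z = 0" for z
        using pq[OF that(1)] that(2) by simp
    qed (use \<open>b \<noteq> 0\<close> in simp)
    then show ?thesis by simp
  qed
  have reflection: "cpoly_eval p z * cnj (cpoly_eval p (reflect z)) = cpoly_eval b z * cnj (cpoly_eval b (reflect z))"
    if "z \<in> exterior_polydisc" for z
  proof (rule reflection_identity[OF torus])
    have "norm (z $ k) > 1" for k using that by (simp add: exterior_polydisc_def)
    then show "z $ k \<noteq> 0" for k by (metis norm_zero not_one_less_zero)
  qed auto
  \<comment> \<open>The reflected point of z is in the polydisc, so b does not vanish there, and a zero of p is a zero of b.\<close>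
  have p_ext: "cpoly_eval p z \<noteq> 0" if z: "z \<in> exterior_polydisc" for z
  proof -
    have "pf_eval (of_cpoly p) z \<noteq> 0"
    proof (rule coprime_zeros_not_locally_contained[OF no_common_prime_sym[OF ncp_pb] _ open_exterior_polydisc _ z])
      show "pf_eval (of_cpoly b) z = 0" if "z \<in> exterior_polydisc" "pf_eval (of_cpoly p) z = 0" for z
        using reflection[OF that(1)] that(2) b_disc[OF reflect_exterior[OF that(1)]] by simp
    qed (use \<open>p \<noteq> 0\<close> in simp)
    then show ?thesis by simp
  qed

  have disc: "cpoly_zeros a \<inter> polydisc = {}" if \<alpha>: "norm \<alpha> \<ge> 1"
  proof -
    have "cpoly_eval a z \<noteq> 0" if z: "z \<in> polydisc" for z
    proof
      assume "cpoly_eval a z = 0"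
      then have "\<phi> z = \<alpha>" using pq[OF z] p[of z] b_disc[OF z] by simp
      with lt1[OF z] \<alpha> show False by simp
    qed
    then show ?thesis by (auto simp: cpoly_zeros_def)
  qed
  have ext: "cpoly_zeros a \<inter> exterior_polydisc = {}" if \<alpha>: "norm \<alpha> \<le> 1"
  proof -
    have "cpoly_eval a z \<noteq> 0" if z: "z \<in> exterior_polydisc" for z
    proof
      assume "cpoly_eval a z = 0"
      then have pz: "cpoly_eval p z = \<alpha> * cpoly_eval b z" by (simp add: p)
      then have "cpoly_eval b z \<noteq> 0" using p_ext[OF z] by auto
      let ?w = "reflect z"
      have w: "?w \<in> polydisc" by (rule reflect_exterior[OF z])
      have "\<alpha> * cnj (cpoly_eval p ?w) = cnj (cpoly_eval b ?w)"
        using reflection[OF z] \<open>cpoly_eval b z \<noteq> 0\<close> by (simp add: pz)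
      then have "norm (cpoly_eval b ?w) = norm \<alpha> * norm (cpoly_eval p ?w)"
        by (metis complex_mod_cnj norm_mult)
      also have "\<dots> \<le> 1 * norm (cpoly_eval p ?w)" using \<alpha> by (intro mult_right_mono) auto
      also have "norm (cpoly_eval p ?w) = norm (\<phi> ?w) * norm (cpoly_eval b ?w)"
        by (simp flip: pq[OF w] add: norm_mult)
      finally show False using lt1[OF w] b_disc[OF w] by simp
    qed
    then show ?thesis by (auto simp: cpoly_zeros_def)
  qed
  have "toral (cpoly_zeros a)" if "norm \<alpha> = 1"
    by (rule toral_of_avoiding) (use disc ext that in auto)
  moreover have "atoral (cpoly_zeros a)" if \<alpha>: "norm \<alpha> \<noteq> 1"
  proof (rule atoral_of_torus_zeros_in_coprime[OF \<open>a \<noteq> 0\<close> ncp])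
    fix z :: "complex ^ 'n" assume z: "z \<in> torus" "cpoly_eval a z = 0"
    then have "norm (cpoly_eval b z) = norm \<alpha> * norm (cpoly_eval b z)"
      using torus[OF z(1)] by (simp add: p norm_mult)
    then show "cpoly_eval b z = 0" using \<alpha> by simp
  qed
  ultimately show ?thesis unfolding Z using disc ext by simp
qed

end
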